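(* Let $M^2$ be a PNMC biharmonic surface in $\mathbb{S}^n$. Then $M$ is minimal in a small hypersphere $\mathbb{S}^{n-1}(1/\sqrt 2)\subset\mathbb{S}^n$.
   Context: All manifolds are smooth and connected. $\mathbb{S}^n\subset\mathbb{R}^{n+1}$ is the unit Euclidean sphere. Let $\varphi:M^m\to N$ be the inclusion of an $m$-dimensional submanifold in a Riemannian manifold $N$ (here $m=2$), with mean curvature vector field $H$ (so $mH$ is the trace of the second fundamental form) and mean curvature $f=|H|$. $M$ is biharmonic if $\Delta H+\operatorname{trace}R^N(d\varphi(\cdot),H)d\varphi(\cdot)=0$, where $\Delta V=-\operatorname{trace}\nabla^2V$ is the rough Laplacian on sections of $\varphi^{-1}(TN)$ and $R^N(X,Y)=[\nabla_X,\nabla_Y]-\nabla_{[X,Y]}$. $M$ is PNMC if $f>0$ everywhere and $\nabla^\perp(H/f)=0$, where $\nabla^\perp$ is the normal connection. $\mathbb{S}^{n-1}(1/\sqrt2)=\{(x,1/\sqrt2)\in\mathbb{R}^{n+1}:x\in\mathbb{R}^n,|x|^2=1/2\}\subset\mathbb{S}^n$, understood up to isometries of $\mathbb{S}^n$. *)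

theory Defs
  imports "HOL-Analysis.Analysis"
begin

text \<open>
  Manifolds are submanifolds of a Euclidean space \<open>'a\<close>, given as a topology on a subset of \<open>'a\<close>.
  The topology of a submanifold may be finer than the one induced from \<open>'a\<close>, so that immersed
  submanifolds are covered; an embedded submanifold \<open>S\<close> is \<^term>\<open>top_of_set S\<close>. Every
  submanifold carries the metric induced from \<open>'a\<close>.

  All differential operators below are expressed through derivatives of \<open>'a\<close>-valued functions along
  a submanifold, followed by orthogonal projections (Gauss formula: the Levi-Civita connection
  of \<open>N \<subseteq> 'a\<close> is the tangential part of the Euclidean derivative).
\<close>

subsection \<open>Submanifolds\<close>

fun differentiable_times_on :: "nat \<Rightarrow> 'b::real_normed_vector set \<Rightarrow> ('b \<Rightarrow> 'a::real_normed_vector) \<Rightarrow> bool"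
  where
    "differentiable_times_on 0 V f \<longleftrightarrow> continuous_on V f"
  | "differentiable_times_on (Suc k) V f \<longleftrightarrow>
       (\<forall>x\<in>V. f differentiable (at x)) \<and>
       (\<forall>v. differentiable_times_on k V (\<lambda>x. frechet_derivative f (at x) v))"

text \<open>Class \<open>C\<^sup>\<infinity>\<close>; meant for open \<open>V\<close>.\<close>
definition smooth_on :: "'b::real_normed_vector set \<Rightarrow> ('b \<Rightarrow> 'a::real_normed_vector) \<Rightarrow> bool"
  where "smooth_on V f \<longleftrightarrow> (\<forall>k. differentiable_times_on k V f)"

definition local_parametrization ::
    "'a::euclidean_space topology \<Rightarrow> 'b::euclidean_space set \<Rightarrow> ('b \<Rightarrow> 'a) \<Rightarrow> bool"
  where "local_parametrization M V u \<longleftrightarrow>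
    open V \<and> openin M (u ` V) \<and>
    homeomorphic_map (top_of_set V) (subtopology M (u ` V)) u \<and>
    smooth_on V u \<and> (\<forall>a\<in>V. inj (frechet_derivative u (at a)))"

text \<open>
  Connected smooth surfaces whose inclusion into \<open>'a\<close> is a smooth immersion. No atlas has to be
  recorded: the changes between local parametrizations are automatically smooth, since they are
  continuous and the parametrizations are immersions.
\<close>
definition immersed_surface :: "'a::euclidean_space topology \<Rightarrow> bool"
  where "immersed_surface M \<longleftrightarrow>
    Hausdorff_space M \<and> second_countable M \<and> connected_space M \<and>
    (\<forall>p\<in>topspace M. \<exists>(V::(real^2) set) u. local_parametrization M V u \<and> p \<in> u ` V)"

text \<open>
  Velocities at \<open>p\<close> of curves in \<open>M\<close>. Convergence to \<open>p\<close> is required in the topology of \<open>M\<close>,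
  so that other sheets of an immersed submanifold accumulating at \<open>p\<close> do not contribute.
\<close>
definition tangent_space :: "'a::euclidean_space topology \<Rightarrow> 'a \<Rightarrow> 'a set"
  where "tangent_space M p =
    {v. \<exists>\<gamma>::real \<Rightarrow> 'a. \<gamma> 0 = p \<and> limitin M \<gamma> p (at 0) \<and> (\<gamma> has_vector_derivative v) (at 0)}"

text \<open>The normal space of \<open>M\<close> in \<open>N\<close>.\<close>
definition normal_space :: "'a::euclidean_space topology \<Rightarrow> 'a topology \<Rightarrow> 'a \<Rightarrow> 'a set"
  where "normal_space M N p = {v \<in> tangent_space N p. \<forall>w\<in>tangent_space M p. orthogonal v w}"

subsection \<open>Linear algebra on subspaces\<close>

definition orth_proj :: "'a::euclidean_space set \<Rightarrow> 'a \<Rightarrow> 'a"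
  where "orth_proj S v = (THE w. w \<in> S \<and> (\<forall>s\<in>S. orthogonal (v - w) s))"

definition orthonormal_basis_of :: "'a::euclidean_space set \<Rightarrow> 'a set \<Rightarrow> bool"
  where "orthonormal_basis_of S B \<longleftrightarrow> pairwise orthogonal B \<and> (\<forall>e\<in>B. norm e = 1) \<and> span B = S"

text \<open>Metric trace of a bilinear map on \<open>S\<close>; it does not depend on the orthonormal basis.\<close>
definition trace_on :: "'a::euclidean_space set \<Rightarrow> ('a \<Rightarrow> 'a \<Rightarrow> 'a) \<Rightarrow> 'a"
  where "trace_on S b = (\<Sum>e\<in>(SOME B. orthonormal_basis_of S B). b e e)"

subsection \<open>Connections and curvature\<close>

text \<open>
  Derivative at \<open>p\<close> of a function on \<open>M\<close> in the direction \<open>x\<close>. For \<^term>\<open>M = top_of_set S\<close> and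
  \<open>p \<in> S\<close> the filter is \<^term>\<open>at p within S\<close>. The value is determined for \<open>x\<close> in the tangent space
  of \<open>M\<close> at \<open>p\<close>, and only such \<open>x\<close> are used.
\<close>
definition deriv_along ::
    "'a::euclidean_space topology \<Rightarrow> ('a \<Rightarrow> 'a) \<Rightarrow> 'a \<Rightarrow> 'a \<Rightarrow> 'a"
  where "deriv_along M V p x = frechet_derivative V (atin M p) x"

text \<open>
  For a submanifold \<open>M\<close> of \<open>N\<close> with inclusion \<open>\<phi>\<close>, the connection of \<open>\<phi>\<^sup>-\<^sup>1(TN)\<close> (\<open>V\<close> is tangent
  to \<open>N\<close> along \<open>M\<close>). For \<^term>\<open>M = N\<close> it is the Levi-Civita connection of \<open>N\<close>.
\<close>
definition cov_deriv ::
    "'a::euclidean_space topology \<Rightarrow> 'a topology \<Rightarrow> ('a \<Rightarrow> 'a) \<Rightarrow> 'a \<Rightarrow> 'a \<Rightarrow> 'a"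
  where "cov_deriv M N V p x = orth_proj (tangent_space N p) (deriv_along M V p x)"

definition normal_cov_deriv ::
    "'a::euclidean_space topology \<Rightarrow> 'a topology \<Rightarrow> ('a \<Rightarrow> 'a) \<Rightarrow> 'a \<Rightarrow> 'a \<Rightarrow> 'a"
  where "normal_cov_deriv M N V p x = orth_proj (normal_space M N p) (cov_deriv M N V p x)"

text \<open>
  A tangent vector field on \<open>M\<close> whose value is \<open>x\<close> at every point where \<open>x\<close> is tangent. It
  serves to evaluate tensors defined through vector fields; by tensoriality any other extension
  gives the same values.
\<close>
definition tangent_extension :: "'a::euclidean_space topology \<Rightarrow> 'a \<Rightarrow> ('a \<Rightarrow> 'a)"
  where "tangent_extension M x = (\<lambda>q. orth_proj (tangent_space M q) x)"

definition lie_bracket ::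
    "'a::euclidean_space topology \<Rightarrow> ('a \<Rightarrow> 'a) \<Rightarrow> ('a \<Rightarrow> 'a) \<Rightarrow> ('a \<Rightarrow> 'a)"
  where "lie_bracket N X Y = (\<lambda>q. deriv_along N Y q (X q) - deriv_along N X q (Y q))"

text \<open>\<open>R\<^sup>N(x,y)z\<close> at \<open>p\<close>, with \<open>R(X,Y) = [\<nabla>\<^sub>X,\<nabla>\<^sub>Y] - \<nabla>\<^bsub>[X,Y]\<^esub>\<close>.\<close>
definition curvature ::
    "'a::euclidean_space topology \<Rightarrow> 'a \<Rightarrow> 'a \<Rightarrow> 'a \<Rightarrow> 'a \<Rightarrow> 'a"
  where "curvature N p x y z =
    (let X = tangent_extension N x; Y = tangent_extension N y; Z = tangent_extension N z
     in cov_deriv N N (\<lambda>q. cov_deriv N N Z q (Y q)) p (X p)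
        - cov_deriv N N (\<lambda>q. cov_deriv N N Z q (X q)) p (Y p)
        - cov_deriv N N Z p (lie_bracket N X Y p))"

text \<open>\<open>(\<nabla>\<^sup>2V)(x,y) = \<nabla>\<^sub>X\<nabla>\<^sub>Y V - \<nabla>\<^bsub>\<nabla>\<^sub>X Y\<^esub> V\<close> at \<open>p\<close>, where the inner \<open>\<nabla>\<^sub>X Y\<close> is taken in \<open>M\<close>.\<close>
definition second_cov_deriv ::
    "'a::euclidean_space topology \<Rightarrow> 'a topology \<Rightarrow> ('a \<Rightarrow> 'a) \<Rightarrow> 'a \<Rightarrow> 'a \<Rightarrow> 'a \<Rightarrow> 'a"
  where "second_cov_deriv M N V p x y =
    (let X = tangent_extension M x; Y = tangent_extension M y
     in cov_deriv M N (\<lambda>q. cov_deriv M N V q (Y q)) p (X p)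
        - cov_deriv M N V p (cov_deriv M M Y p (X p)))"

definition rough_laplacian ::
    "'a::euclidean_space topology \<Rightarrow> 'a topology \<Rightarrow> ('a \<Rightarrow> 'a) \<Rightarrow> ('a \<Rightarrow> 'a)"
  where "rough_laplacian M N V = (\<lambda>p. - trace_on (tangent_space M p) (second_cov_deriv M N V p))"

subsection \<open>Mean curvature, PNMC and biharmonic submanifolds\<close>

definition second_fundamental_form ::
    "'a::euclidean_space topology \<Rightarrow> 'a topology \<Rightarrow> 'a \<Rightarrow> 'a \<Rightarrow> 'a \<Rightarrow> 'a"
  where "second_fundamental_form M N p x y = normal_cov_deriv M N (tangent_extension M y) p x"

definition mean_curvature_vector ::
    "'a::euclidean_space topology \<Rightarrow> 'a topology \<Rightarrow> ('a \<Rightarrow> 'a)"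
  where "mean_curvature_vector M N = (\<lambda>p.
    trace_on (tangent_space M p) (second_fundamental_form M N p) /\<^sub>R real (dim (tangent_space M p)))"

definition mean_curvature ::
    "'a::euclidean_space topology \<Rightarrow> 'a topology \<Rightarrow> ('a \<Rightarrow> real)"
  where "mean_curvature M N = (\<lambda>p. norm (mean_curvature_vector M N p))"

definition minimal_in :: "'a::euclidean_space topology \<Rightarrow> 'a topology \<Rightarrow> bool"
  where "minimal_in M N \<longleftrightarrow>
    topspace M \<subseteq> topspace N \<and> (\<forall>p\<in>topspace M. mean_curvature_vector M N p = 0)"

definition biharmonic_in :: "'a::euclidean_space topology \<Rightarrow> 'a topology \<Rightarrow> bool"
  where "biharmonic_in M N \<longleftrightarrow>
    (let H = mean_curvature_vector M N
     in \<forall>p\<in>topspace M.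
          rough_laplacian M N H p
          + trace_on (tangent_space M p) (\<lambda>x y. curvature N p x (H p) y) = 0)"

definition PNMC_in :: "'a::euclidean_space topology \<Rightarrow> 'a topology \<Rightarrow> bool"
  where "PNMC_in M N \<longleftrightarrow>
    (let H = mean_curvature_vector M N; f = mean_curvature M N
     in \<forall>p\<in>topspace M. f p > 0 \<and>
          (\<forall>x\<in>tangent_space M p. normal_cov_deriv M N (\<lambda>q. H q /\<^sub>R f q) p x = 0))"

subsection \<open>The sphere and its small hypersphere\<close>

text \<open>
  \<open>\<real>\<^sup>n\<^sup>+\<^sup>1\<close> is \<open>\<real>\<^sup>n \<times> \<real>\<close> with \<open>n = CARD('n)\<close>; the product norm is the Euclidean one.
\<close>
abbreviation unit_sphere :: "((real^'n) \<times> real) set"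
  where "unit_sphere \<equiv> sphere 0 1"

definition small_hypersphere :: "((real^'n) \<times> real) set"
  where "small_hypersphere = {(x, 1 / sqrt 2) | x. (norm x)\<^sup>2 = 1 / 2}"

end

theory Submission
  imports Defs
begin

text \<open>
  Write \<open>H = f\<eta>\<close> with \<open>\<eta>\<close> a parallel unit normal field with shape operator \<open>A\<close>. The biharmonic equation
  splits into \<open>A(grad f) = -f grad f\<close>, \<open>\<Delta>f = f(2 - |A|\<^sup>2)\<close> and \<open>\<langle>A, A\<^sub>\<xi>\<rangle> = 0\<close> for normals \<open>\<xi> \<bottom> \<eta>\<close>.
  Since \<open>\<eta>\<close> is parallel, \<open>A\<close> and \<open>A\<^sub>\<xi>\<close> commute, so \<open>A\<^sub>\<xi> = 0\<close> wherever \<open>A\<close> is not scalar, and there the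
  surface satisfies the structure equations of a surface in \<open>S\<^sup>3\<close>. Where \<open>grad f \<noteq> 0\<close>, these are
  overdetermined ordinary differential equations along the gradient without a positive solution \<open>f\<close>.
  So \<open>f\<close> is locally constant and \<open>|A|\<^sup>2 = 2\<close>; if \<open>A\<close> were not scalar, the surface would be flat, contradicting
  the Gauss equation. Hence \<open>A\<close> is the identity and \<open>f = 1\<close>, so \<open>p + H(p)\<close> is a constant vector \<open>k\<close> of
  length \<open>\<surd>2\<close>. The surface lies in the hypersphere \<open>p \<bullet> k = 1\<close>, in which its mean curvature vanishes
  because \<open>H\<close> is spanned by \<open>k\<close> and the position vector.
\<close>

section \<open>Smooth maps and directional derivatives\<close>

text \<open>The obstacle is the arbitrary codimension: apart from \<open>\<eta>\<close>, nothing is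
  known about the normal bundle. No basis of it is chosen; normal statements are tested against
  arbitrary vectors \<open>v\<close> or \<open>\<xi>\<close>, and the reduction to three dimensions
  is only the pointwise vanishing of the remaining normal components. The tangential part of the
  biharmonic equation is -2 A(grad f) - f div A = 0. Codazzi and tr A = 2f give div A = 2 grad f,
  hence A(grad f) = -f grad f; the trace then fixes the other eigenvalue as 3f wherever grad f is
  nonzero. Both contradictions differentiate identities, so they need them on open sets. Each is
  therefore phrased as emptiness of an open set that carries a certain frame, and is applied to the
  open locus where grad f is nonzero or where A is not scalar. This yields the opposite condition
  everywhere, without unique continuation. All geometry is computed in a parameter domain with
  derivatives of ambient vector-valued functions; Gauss, Codazzi and Ricci equations then come from
  one commutator identity, applied to \<open>E1\<close> or to \<open>\<eta>\<close>.\<close>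

lemma differentiable_times_on_SucD:
  "differentiable_times_on (Suc k) V f \<Longrightarrow> differentiable_times_on k V f"
proof (induction k arbitrary: f)
  case 0
  then show ?case
    by (auto intro!: differentiable_imp_continuous_on differentiable_at_imp_differentiable_on)
next
  case (Suc k)
  then show ?case by (metis differentiable_times_on.simps(2))
qed

lemma differentiable_times_on_subset:
  "differentiable_times_on k V f \<Longrightarrow> W \<subseteq> V \<Longrightarrow> differentiable_times_on k W f"
  by (induction k arbitrary: f) (auto intro: continuous_on_subset)

lemma differentiable_times_on_cong:
  assumes "open V" "\<And>x. x \<in> V \<Longrightarrow> f x = g x"
  shows "differentiable_times_on k V f \<Longrightarrow> differentiable_times_on k V g"
  using assms(2)
proof (induction k arbitrary: f g)
  case 0
  then show ?case by (auto cong: continuous_on_cong)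
next
  case (Suc k)
  have diff: "f differentiable (at x)" if "x \<in> V" for x using Suc.prems that by auto
  have "g differentiable (at x) \<and> (frechet_derivative f (at x) = frechet_derivative g (at x))"
    if "x \<in> V" for x
  proof -
    have "(g has_derivative frechet_derivative f (at x)) (at x)"
      by (rule has_derivative_transform_within_open[OF _ assms(1) that Suc.prems(2)])
        (use diff[OF that] in \<open>auto simp: frechet_derivative_works\<close>)
    then show ?thesis using frechet_derivative_at by (auto simp: differentiable_def)
  qed
  moreover have "differentiable_times_on k V (\<lambda>x. frechet_derivative g (at x) v)" for v
    by (rule Suc.IH[of "\<lambda>x. frechet_derivative f (at x) v"]) (use Suc.prems(1) calculation in auto)
  ultimately show ?case by simp
qed

lemma differentiable_times_on_const: "differentiable_times_on k V (\<lambda>x. c)"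
  by (induction k arbitrary: c) auto

text \<open>The recursion speaks of \<open>frechet_derivative\<close>. Uniqueness of the derivative
  on an open set allows any explicit formula \<open>f'\<close> instead, so each closure property
  below reduces to a differentiation rule.\<close>

lemma differentiable_times_on_SucI:
  assumes "open V" and "\<And>x. x \<in> V \<Longrightarrow> (f has_derivative f' x) (at x)"
    and "\<And>v. differentiable_times_on k V (\<lambda>x. f' x v)"
  shows "differentiable_times_on (Suc k) V f"
proof -
  have "frechet_derivative f (at x) v = f' x v" if "x \<in> V" for x v
    using assms(2)[OF that] by (metis frechet_derivative_at)
  then have "differentiable_times_on k V (\<lambda>x. frechet_derivative f (at x) v)" for v
    using differentiable_times_on_cong[OF assms(1) _ assms(3)[of v]] by simp
  then show ?thesis using assms(2) by (auto simp: differentiable_def)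
qed

lemma differentiable_times_on_SucE:
  assumes "differentiable_times_on (Suc k) V f"
  shows "\<And>x. x \<in> V \<Longrightarrow> (f has_derivative frechet_derivative f (at x)) (at x)"
    and "\<And>v. differentiable_times_on k V (\<lambda>x. frechet_derivative f (at x) v)"
  using assms by (auto simp: frechet_derivative_works)

lemma differentiable_times_on_add:
  assumes "open V"
  shows "differentiable_times_on k V f \<Longrightarrow> differentiable_times_on k V g
    \<Longrightarrow> differentiable_times_on k V (\<lambda>x. f x + g x)"
proof (induction k arbitrary: f g)
  case 0
  then show ?case by (auto intro: continuous_intros)
next
  case (Suc k)
  note f = differentiable_times_on_SucE[OF Suc.prems(1)] and g = differentiable_times_on_SucE[OF Suc.prems(2)]
  show ?case
    by (rule differentiable_times_on_SucI[OF assms has_derivative_add[OF f(1) g(1)]])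
      (use Suc.IH[OF f(2) g(2)] in auto)
qed

lemma differentiable_times_on_bounded_linear:
  assumes "open V" "bounded_linear h"
  shows "differentiable_times_on k V f \<Longrightarrow> differentiable_times_on k V (\<lambda>x. h (f x))"
proof (induction k arbitrary: f)
  case 0
  then show ?case using assms by (auto intro: bounded_linear.continuous_on)
next
  case (Suc k)
  note f = differentiable_times_on_SucE[OF Suc.prems(1)]
  show ?case
    by (rule differentiable_times_on_SucI[OF assms(1)
          bounded_linear.has_derivative[OF assms(2) f(1)]]) (use Suc.IH[OF f(2)] in auto)
qed

lemma differentiable_times_on_bounded_bilinear:
  assumes "open V" "bounded_bilinear B"
  shows "differentiable_times_on k V f \<Longrightarrow> differentiable_times_on k V g
    \<Longrightarrow> differentiable_times_on k V (\<lambda>x. B (f x) (g x))"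
proof (induction k arbitrary: f g)
  case 0
  then show ?case using assms by (auto intro: bounded_bilinear.continuous_on)
next
  case (Suc k)
  note f = differentiable_times_on_SucE[OF Suc.prems(1)] and g = differentiable_times_on_SucE[OF Suc.prems(2)]
  \<comment> \<open>The product rule also contains the undifferentiated factors, which are needed
    with one order less than assumed.\<close>
  note f' = differentiable_times_on_SucD[OF Suc.prems(1)] and g' = differentiable_times_on_SucD[OF Suc.prems(2)]
  show ?case
    by (rule differentiable_times_on_SucI[OF assms(1)
          bounded_bilinear.FDERIV[OF assms(2) f(1) g(1)]])
      (use Suc.IH[OF f' g(2)] Suc.IH[OF f(2) g'] in
        \<open>auto intro!: differentiable_times_on_add[OF assms(1)]\<close>)
qed

lemmas differentiable_times_on_mult =
  differentiable_times_on_bounded_bilinear[OF _ bounded_bilinear_mult]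

text \<open>The derivative -f'/f^2 contains the reciprocal itself, now with one order less, so the
  induction on the order closes. The square root is treated in the same way.\<close>

lemma differentiable_times_on_inverse:
  fixes f :: "'b::real_normed_vector \<Rightarrow> real"
  assumes "open V" "\<And>x. x \<in> V \<Longrightarrow> f x \<noteq> 0"
  shows "differentiable_times_on k V f \<Longrightarrow> differentiable_times_on k V (\<lambda>x. inverse (f x))"
proof (induction k)
  case 0
  then show ?case using assms by (auto intro: continuous_intros)
next
  case (Suc k)
  note f = differentiable_times_on_SucE[OF Suc.prems(1)]
  note i = Suc.IH[OF differentiable_times_on_SucD[OF Suc.prems(1)]]
  have "differentiable_times_on k V (\<lambda>x. -1 * (inverse (f x) * frechet_derivative f (at x) v * inverse (f x)))" for v
    by (intro differentiable_times_on_mult assms(1) i f(2) differentiable_times_on_const)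
  then show ?case
    by (intro differentiable_times_on_SucI[OF assms(1)
          Deriv.has_derivative_inverse[OF assms(2) f(1)]]) auto
qed

lemma differentiable_times_on_sqrt:
  fixes f :: "'b::real_normed_vector \<Rightarrow> real"
  assumes "open V" "\<And>x. x \<in> V \<Longrightarrow> f x > 0"
  shows "differentiable_times_on k V f \<Longrightarrow> differentiable_times_on k V (\<lambda>x. sqrt (f x))"
proof (induction k)
  case 0
  then show ?case using assms by (auto intro: continuous_intros)
next
  case (Suc k)
  note f = differentiable_times_on_SucE[OF Suc.prems(1)]
  note i = Suc.IH[OF differentiable_times_on_SucD[OF Suc.prems(1)]]
  have nz: "sqrt (f x) \<noteq> 0" if "x \<in> V" for x using assms(2)[OF that] by simp
  have "differentiable_times_on k V (\<lambda>x. frechet_derivative f (at x) v * (inverse (sqrt (f x)) * (1/2)))" for v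
    by (intro differentiable_times_on_mult assms(1) f(2) differentiable_times_on_const
        differentiable_times_on_inverse i nz)
  moreover have "((\<lambda>x. sqrt (f x)) has_derivative
      (\<lambda>v. frechet_derivative f (at x) v * (inverse (sqrt (f x)) * (1/2)))) (at x)" if "x \<in> V" for x
    using has_derivative_real_sqrt[OF assms(2)[OF that] f(1)[OF that]]
    by (simp add: divide_simps mult.commute)
  ultimately show ?case
    by (intro differentiable_times_on_SucI[OF assms(1)])
qed

context
  fixes V :: "'b::euclidean_space set"
  assumes V: "open V"
begin

lemma smooth_on_const: "smooth_on V (\<lambda>x. c)"
  by (simp add: smooth_on_def differentiable_times_on_const)

lemma smooth_on_cong: "smooth_on V f \<Longrightarrow> (\<And>x. x \<in> V \<Longrightarrow> f x = g x) \<Longrightarrow> smooth_on V g"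
  using differentiable_times_on_cong[OF V] unfolding smooth_on_def by blast

lemma smooth_on_add: "smooth_on V f \<Longrightarrow> smooth_on V g \<Longrightarrow> smooth_on V (\<lambda>x. f x + g x)"
  by (simp add: smooth_on_def differentiable_times_on_add V)

lemma smooth_on_bounded_linear: "bounded_linear h \<Longrightarrow> smooth_on V f \<Longrightarrow> smooth_on V (\<lambda>x. h (f x))"
  by (simp add: smooth_on_def differentiable_times_on_bounded_linear V)

lemma smooth_on_minus: "smooth_on V f \<Longrightarrow> smooth_on V (\<lambda>x. - f x)"
  by (rule smooth_on_bounded_linear[OF bounded_linear_minus[OF bounded_linear_ident]])

lemma smooth_on_diff: "smooth_on V f \<Longrightarrow> smooth_on V g \<Longrightarrow> smooth_on V (\<lambda>x. f x - g x)"
  using smooth_on_add[OF _ smooth_on_minus] by fastforce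

lemma smooth_on_mult:
  "smooth_on V f \<Longrightarrow> smooth_on V g \<Longrightarrow> smooth_on V (\<lambda>x. f x * g x :: real)"
  by (simp add: smooth_on_def differentiable_times_on_mult V)

lemma smooth_on_scaleR: "smooth_on V f \<Longrightarrow> smooth_on V g \<Longrightarrow> smooth_on V (\<lambda>x. f x *\<^sub>R g x)"
  by (simp add: smooth_on_def differentiable_times_on_bounded_bilinear[OF _ bounded_bilinear_scaleR] V)

lemma smooth_on_inner: "smooth_on V f \<Longrightarrow> smooth_on V g \<Longrightarrow> smooth_on V (\<lambda>x. f x \<bullet> g x)"
  by (simp add: smooth_on_def differentiable_times_on_bounded_bilinear[OF _ bounded_bilinear_inner] V)

lemma smooth_on_inverse:
  "smooth_on V f \<Longrightarrow> (\<And>x. x \<in> V \<Longrightarrow> f x \<noteq> 0) \<Longrightarrow> smooth_on V (\<lambda>x. inverse (f x :: real))"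
  by (simp add: smooth_on_def differentiable_times_on_inverse V)

lemma smooth_on_divide:
  "smooth_on V f \<Longrightarrow> smooth_on V g \<Longrightarrow> (\<And>x. x \<in> V \<Longrightarrow> g x \<noteq> 0) \<Longrightarrow> smooth_on V (\<lambda>x. f x / g x :: real)"
  by (simp add: divide_inverse smooth_on_mult smooth_on_inverse)

lemma smooth_on_sqrt:
  "smooth_on V f \<Longrightarrow> (\<And>x. x \<in> V \<Longrightarrow> f x > 0) \<Longrightarrow> smooth_on V (\<lambda>x. sqrt (f x))"
  by (simp add: smooth_on_def differentiable_times_on_sqrt V)

lemma smooth_on_norm:
  fixes f :: "'b \<Rightarrow> 'a::real_inner"
  assumes "smooth_on V f" "\<And>x. x \<in> V \<Longrightarrow> f x \<noteq> 0"
  shows "smooth_on V (\<lambda>x. norm (f x))"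
  unfolding norm_eq_sqrt_inner by (intro smooth_on_sqrt smooth_on_inner assms) (use assms in auto)

lemma smooth_on_sum: "(\<And>i. i \<in> I \<Longrightarrow> smooth_on V (f i)) \<Longrightarrow> smooth_on V (\<lambda>x. \<Sum>i\<in>I. f i x)"
  by (induction I rule: infinite_finite_induct) (auto intro: smooth_on_const smooth_on_add)

lemma smooth_on_has_derivative:
  "smooth_on V f \<Longrightarrow> x \<in> V \<Longrightarrow> (f has_derivative frechet_derivative f (at x)) (at x)"
  using differentiable_times_on_SucE(1) unfolding smooth_on_def by blast

lemma smooth_on_frechet_derivative:
  "smooth_on V f \<Longrightarrow> smooth_on V (\<lambda>x. frechet_derivative f (at x) v)"
  unfolding smooth_on_def using differentiable_times_on_SucE(2) by blast

lemma smooth_on_continuous_on: "smooth_on V f \<Longrightarrow> continuous_on V f"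
  by (metis differentiable_times_on.simps(1) smooth_on_def)

end

lemma smooth_on_subset: "smooth_on V f \<Longrightarrow> W \<subseteq> V \<Longrightarrow> smooth_on W f"
  unfolding smooth_on_def using differentiable_times_on_subset by blast

lemmas smooth_on_intros = smooth_on_const smooth_on_add smooth_on_minus
  smooth_on_diff smooth_on_mult smooth_on_scaleR smooth_on_inner smooth_on_divide smooth_on_norm
  smooth_on_frechet_derivative

lemma frechet_derivative_eqI:
  "(f has_derivative f') (at x) \<Longrightarrow> frechet_derivative f (at x) v = f' v"
  by (metis frechet_derivative_at)

lemma frechet_derivative_cong_open:
  fixes V :: "'b::euclidean_space set"
  assumes "open V" "smooth_on V f" "x \<in> V" "\<And>y. y \<in> V \<Longrightarrow> f y = g y"
  shows "frechet_derivative g (at x) v = frechet_derivative f (at x) v"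
  by (rule frechet_derivative_eqI)
    (rule has_derivative_transform_within_open[OF smooth_on_has_derivative[OF assms(1-3)] assms(1,3,4)])

text \<open>The second difference of f over a parallelogram is symmetric in v and w. Two
  applications of the mean value theorem turn it into a mixed derivative at a nearby point, in
  either order; continuity of the mixed derivatives gives equality in the limit.\<close>

lemma mixed_derivative_symmetric_real:
  fixes f :: "'b::euclidean_space \<Rightarrow> real"
  assumes "open V" "smooth_on V f" "a \<in> V"
  defines "D \<equiv> \<lambda>f v x. frechet_derivative f (at x) v"
  shows "D (D f v) w a = D (D f w) v a"
proof -
  have D: "((\<lambda>t. g (x + t *\<^sub>R y)) has_real_derivative D g y (x + t *\<^sub>R y)) (at t)"
    if "smooth_on V g" "x + t *\<^sub>R y \<in> V" for g x y t
  proof -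
    have "((\<lambda>t. g (x + t *\<^sub>R y)) has_derivative (\<lambda>h. frechet_derivative g (at (x + t *\<^sub>R y)) (h *\<^sub>R y))) (at t)"
      by (rule has_derivative_compose[of "\<lambda>t. x + t *\<^sub>R y", OF _ smooth_on_has_derivative[OF assms(1) that]])
        (auto intro!: derivative_eq_intros)
    moreover have "frechet_derivative g (at (x + t *\<^sub>R y)) (h *\<^sub>R y) = D g y (x + t *\<^sub>R y) * h" for h
      using linear_cmul[OF has_derivative_linear[OF smooth_on_has_derivative[OF assms(1) that]]]
      by (simp add: D_def)
    ultimately show ?thesis by (simp add: has_field_derivative_def)
  qed
  obtain r where r: "r > 0" "ball a r \<subseteq> V" using assms(1,3) openE by blast
  have mean: "\<exists>x y. 0 < x \<and> x < s \<and> 0 < y \<and> y < s \<and>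
      f (a + s *\<^sub>R v + s *\<^sub>R w) - f (a + s *\<^sub>R v) - f (a + s *\<^sub>R w) + f a
       = s * s * D (D f v) w (a + x *\<^sub>R v + y *\<^sub>R w)"
    if s: "s > 0" "s * (norm v + norm w) < r" for s v w
  proof -
    have inV: "a + x *\<^sub>R v + y *\<^sub>R w \<in> V" if "0 \<le> x" "x \<le> s" "0 \<le> y" "y \<le> s" for x y
    proof -
      have "norm (x *\<^sub>R v + y *\<^sub>R w) \<le> x * norm v + y * norm w"
        using norm_triangle_ineq[of "x *\<^sub>R v" "y *\<^sub>R w"] that by simp
      also have "\<dots> \<le> s * norm v + s * norm w"
        by (intro add_mono mult_right_mono that) auto
      finally have "dist a (a + x *\<^sub>R v + y *\<^sub>R w) < r"
        using s by (simp add: dist_norm algebra_simps) (metis minus_add_distrib norm_minus_cancel uminus_add_conv_diff le_less_trans add.commute)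
      then show ?thesis using r by auto
    qed
    \<comment> \<open>The increment of \<open>?p\<close> over [0,s] is the second difference. The
      mean value theorem in direction v leaves a difference of \<open>D f v\<close>, to which it is
      applied again in direction w.\<close>
    let ?p = "\<lambda>t. f (a + t *\<^sub>R v + s *\<^sub>R w) - f (a + t *\<^sub>R v)"
    have "(?p has_real_derivative D f v (a + t *\<^sub>R v + s *\<^sub>R w) - D f v (a + t *\<^sub>R v)) (at t)"
      if "0 \<le> t" "t \<le> s" for t
    proof (intro DERIV_diff)
      show "((\<lambda>t. f (a + t *\<^sub>R v + s *\<^sub>R w)) has_real_derivative D f v (a + t *\<^sub>R v + s *\<^sub>R w)) (at t)"
        using D[OF assms(2), of "a + s *\<^sub>R w" t v] inV[of t s] that s by (simp add: add.assoc add.commute[of "s *\<^sub>R w"])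
      show "((\<lambda>t. f (a + t *\<^sub>R v)) has_real_derivative D f v (a + t *\<^sub>R v)) (at t)"
        using D[OF assms(2), of a t v] inV[of t 0] that s by simp
    qed
    from MVT2[OF s(1) this] obtain x where x: "0 < x" "x < s"
      "?p s - ?p 0 = s * (D f v (a + x *\<^sub>R v + s *\<^sub>R w) - D f v (a + x *\<^sub>R v))"
      by auto
    have "((\<lambda>t. D f v (a + x *\<^sub>R v + t *\<^sub>R w)) has_real_derivative D (D f v) w (a + x *\<^sub>R v + t *\<^sub>R w)) (at t)"
      if "0 \<le> t" "t \<le> s" for t
      using D[of "D f v" "a + x *\<^sub>R v" t w] inV[of x t] that x assms(2)
      by (simp add: D_def smooth_on_frechet_derivative[OF assms(1)])
    from MVT2[OF s(1) this] obtain y where y: "0 < y" "y < s"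
      "D f v (a + x *\<^sub>R v + s *\<^sub>R w) - D f v (a + x *\<^sub>R v) = s * D (D f v) w (a + x *\<^sub>R v + y *\<^sub>R w)"
      by auto
    show ?thesis using x y by (intro exI[of _ x] exI[of _ y]) (simp add: algebra_simps)
  qed
  \<comment> \<open>The summand 1 keeps the denominator positive also for v = w = 0 and keeps the
    parallelogram inside the ball; the factor n + 2 sends the side lengths to 0.\<close>
  define s where "s n = r / (norm v + norm w + 1) / real (n + 2)" for n
  have pos: "norm v + norm w + 1 > 0" by (simp add: add_nonneg_pos)
  have s0: "s n > 0" for n using r pos by (simp add: s_def)
  have s1: "s n * (norm v + norm w) < r" for n
  proof -
    have "s n \<le> r / (norm v + norm w + 1)" unfolding s_def using r pos
      by (simp add: divide_le_eq)
    then have "s n * (norm v + norm w) \<le> r / (norm v + norm w + 1) * (norm v + norm w)"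
      by (intro mult_right_mono) auto
    also have "\<dots> < r" using r pos by (simp add: divide_simps mult_less_cancel_left)
    finally show ?thesis .
  qed
  have slim: "s \<longlonglongrightarrow> 0" unfolding s_def by (rule LIMSEQ_ignore_initial_segment[OF lim_const_over_n])
  have lim: "(\<lambda>n. D (D f v) w (a + x n *\<^sub>R v + y n *\<^sub>R w)) \<longlonglongrightarrow> D (D f v) w a"
    if "\<And>n. 0 < x n \<and> x n < s n" "\<And>n. 0 < y n \<and> y n < s n" for x y v w
  proof -
    have "x \<longlonglongrightarrow> 0" "y \<longlonglongrightarrow> 0"
      using that by (auto intro!: real_tendsto_sandwich[OF _ _ tendsto_const slim] always_eventually
          simp: less_imp_le)
    then have "(\<lambda>n. a + x n *\<^sub>R v + y n *\<^sub>R w) \<longlonglongrightarrow> a + 0 *\<^sub>R v + 0 *\<^sub>R w"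
      by (intro tendsto_intros)
    moreover have "isCont (D (D f v) w) a"
      using smooth_on_continuous_on[OF assms(1), of "D (D f v) w"] assms(1-3)
      by (auto simp: D_def continuous_on_eq_continuous_at smooth_on_frechet_derivative)
    ultimately show ?thesis using isCont_tendsto_compose by fastforce
  qed
  have "\<forall>n. \<exists>x y. 0 < x \<and> x < s n \<and> 0 < y \<and> y < s n \<and>
      f (a + s n *\<^sub>R v + s n *\<^sub>R w) - f (a + s n *\<^sub>R v) - f (a + s n *\<^sub>R w) + f a
       = s n * s n * D (D f v) w (a + x *\<^sub>R v + y *\<^sub>R w)"
    using mean s0 s1 by blast
  then obtain x y where xy: "\<And>n. 0 < x n \<and> x n < s n" "\<And>n. 0 < y n \<and> y n < s n"
    "\<And>n. f (a + s n *\<^sub>R v + s n *\<^sub>R w) - f (a + s n *\<^sub>R v) - f (a + s n *\<^sub>R w) + f a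
       = s n * s n * D (D f v) w (a + x n *\<^sub>R v + y n *\<^sub>R w)" by metis
  have "\<forall>n. \<exists>x y. 0 < x \<and> x < s n \<and> 0 < y \<and> y < s n \<and>
      f (a + s n *\<^sub>R w + s n *\<^sub>R v) - f (a + s n *\<^sub>R w) - f (a + s n *\<^sub>R v) + f a
       = s n * s n * D (D f w) v (a + x *\<^sub>R w + y *\<^sub>R v)"
    using mean s0 s1 by (metis add.commute)
  then obtain x' y' where xy': "\<And>n. 0 < x' n \<and> x' n < s n" "\<And>n. 0 < y' n \<and> y' n < s n"
    "\<And>n. f (a + s n *\<^sub>R w + s n *\<^sub>R v) - f (a + s n *\<^sub>R w) - f (a + s n *\<^sub>R v) + f a
       = s n * s n * D (D f w) v (a + x' n *\<^sub>R w + y' n *\<^sub>R v)" by metis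
  have "D (D f v) w (a + x n *\<^sub>R v + y n *\<^sub>R w) = D (D f w) v (a + x' n *\<^sub>R w + y' n *\<^sub>R v)" for n
  proof -
    have "s n * s n * D (D f v) w (a + x n *\<^sub>R v + y n *\<^sub>R w)
        = s n * s n * D (D f w) v (a + x' n *\<^sub>R w + y' n *\<^sub>R v)"
    proof -
      have "f (a + s n *\<^sub>R w + s n *\<^sub>R v) = f (a + s n *\<^sub>R v + s n *\<^sub>R w)"
        by (simp only: add.assoc add.commute[of "s n *\<^sub>R w"])
      then show ?thesis using xy(3)[of n] xy'(3)[of n] by linarith
    qed
    then show ?thesis using s0[of n] by simp
  qed
  with lim[OF xy(1,2), of v w] lim[OF xy'(1,2), of w v] show ?thesis
    using LIMSEQ_unique by auto
qed

lemma mixed_derivative_symmetric: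
  fixes f :: "'b::euclidean_space \<Rightarrow> 'a::euclidean_space"
  assumes "open V" "smooth_on V f" "a \<in> V"
  defines "D \<equiv> \<lambda>f v x. frechet_derivative f (at x) v"
  shows "D (D f v) w a = D (D f w) v a"
proof (rule euclidean_eqI)
  fix i :: 'a
  have comp: "frechet_derivative (\<lambda>x. g x \<bullet> i) (at x) w = frechet_derivative g (at x) w \<bullet> i"
    if "smooth_on V g" "x \<in> V" for g :: "'b \<Rightarrow> 'a" and x w
    by (rule frechet_derivative_eqI)
      (intro derivative_intros smooth_on_has_derivative[OF assms(1) that])
  have comp2: "frechet_derivative (\<lambda>x. frechet_derivative (\<lambda>x. f x \<bullet> i) (at x) v) (at a) w
      = frechet_derivative (\<lambda>x. frechet_derivative f (at x) v) (at a) w \<bullet> i" for v w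
  proof -
    have s: "smooth_on V (\<lambda>x. frechet_derivative f (at x) v)"
      using assms by (intro smooth_on_frechet_derivative)
    have "frechet_derivative (\<lambda>x. frechet_derivative (\<lambda>x. f x \<bullet> i) (at x) v) (at a) w
        = frechet_derivative (\<lambda>x. frechet_derivative f (at x) v \<bullet> i) (at a) w"
      using comp[OF assms(2)]
      by (intro frechet_derivative_cong_open[OF assms(1) _ assms(3)] smooth_on_intros assms s) simp
    then show ?thesis using comp[OF s assms(3)] by simp
  qed
  show "D (D f v) w a \<bullet> i = D (D f w) v a \<bullet> i"
    using mixed_derivative_symmetric_real[OF assms(1) smooth_on_inner[OF assms(1,2) smooth_on_const[OF assms(1)]] assms(3), of i v w]
    by (simp add: D_def comp2)
qed

text \<open>The field \<open>c\<close> lives in the parameter domain. For a parametrization u,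
  \<open>dir_deriv c u\<close> is the field it induces on the surface, and for any pulled-back
  function this is the derivative along that field.\<close>

definition dir_deriv :: "('b::real_normed_vector \<Rightarrow> 'b) \<Rightarrow> ('b \<Rightarrow> 'a::real_normed_vector) \<Rightarrow> 'b \<Rightarrow> 'a"
  where "dir_deriv c f x = frechet_derivative f (at x) (c x)"

lemma dir_deriv_const [simp]: "dir_deriv c (\<lambda>x. k) x = 0"
  by (simp add: dir_deriv_def)

lemma dir_deriv_cong_open:
  fixes V :: "'b::euclidean_space set"
  assumes "open V" "smooth_on V f" "x \<in> V" "\<And>y. y \<in> V \<Longrightarrow> f y = g y"
  shows "dir_deriv c g x = dir_deriv c f x"
  using frechet_derivative_cong_open[OF assms] by (simp add: dir_deriv_def)

context
  fixes V :: "'b::euclidean_space set" and x :: 'b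
  assumes V: "open V" "x \<in> V"
begin

lemma frechet_derivative_linear: "smooth_on V f \<Longrightarrow> linear (frechet_derivative f (at x))"
  using has_derivative_linear smooth_on_has_derivative V by blast

lemma dir_deriv_add:
  "smooth_on V f \<Longrightarrow> smooth_on V g \<Longrightarrow> dir_deriv c (\<lambda>x. f x + g x) x = dir_deriv c f x + dir_deriv c g x"
  unfolding dir_deriv_def
  by (rule frechet_derivative_eqI) (intro has_derivative_add smooth_on_has_derivative[OF V(1) _ V(2)])

lemma dir_deriv_diff:
  "smooth_on V f \<Longrightarrow> smooth_on V g \<Longrightarrow> dir_deriv c (\<lambda>x. f x - g x) x = dir_deriv c f x - dir_deriv c g x"
  unfolding dir_deriv_def
  by (rule frechet_derivative_eqI) (intro has_derivative_diff smooth_on_has_derivative[OF V(1) _ V(2)])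

lemma dir_deriv_minus: "smooth_on V f \<Longrightarrow> dir_deriv c (\<lambda>x. - f x) x = - dir_deriv c f x"
  unfolding dir_deriv_def
  by (rule frechet_derivative_eqI) (intro has_derivative_minus smooth_on_has_derivative[OF V(1) _ V(2)])

lemma dir_deriv_inner_left:
  assumes "smooth_on V f"
  shows "dir_deriv c (\<lambda>x. f x \<bullet> k) x = dir_deriv c f x \<bullet> k"
  unfolding dir_deriv_def
  by (rule frechet_derivative_eqI)
    (rule has_derivative_inner_left[OF smooth_on_has_derivative[OF V(1) assms V(2)]])

lemma dir_deriv_bilinear:
  assumes "bounded_bilinear B" "smooth_on V f" "smooth_on V g"
  shows "dir_deriv c (\<lambda>x. B (f x) (g x)) x = B (dir_deriv c f x) (g x) + B (f x) (dir_deriv c g x)"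
  unfolding dir_deriv_def
  by (subst add.commute, rule frechet_derivative_eqI)
    (rule bounded_bilinear.FDERIV[OF assms(1) smooth_on_has_derivative[OF V(1) assms(2) V(2)]
        smooth_on_has_derivative[OF V(1) assms(3) V(2)]])

lemmas dir_deriv_scaleR = dir_deriv_bilinear[OF bounded_bilinear_scaleR]
  and dir_deriv_mult = dir_deriv_bilinear[OF bounded_bilinear_mult]
  and dir_deriv_inner = dir_deriv_bilinear[OF bounded_bilinear_inner]

lemma dir_deriv_lincomb:
  assumes "smooth_on V f"
  shows "dir_deriv (\<lambda>x. r x *\<^sub>R c x + s x *\<^sub>R d x) f x = r x *\<^sub>R dir_deriv c f x + s x *\<^sub>R dir_deriv d f x"
  using frechet_derivative_linear[OF assms] by (simp add: dir_deriv_def linear_add linear_cmul)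

end

lemma frechet_derivative_expand:
  fixes V :: "'b::euclidean_space set"
  assumes "open V" "x \<in> V" "smooth_on V f"
  shows "frechet_derivative f (at x) v = (\<Sum>i\<in>Basis. (v \<bullet> i) *\<^sub>R frechet_derivative f (at x) i)"
proof -
  have "frechet_derivative f (at x) v = frechet_derivative f (at x) (\<Sum>i\<in>Basis. (v \<bullet> i) *\<^sub>R i)"
    by (simp add: euclidean_representation)
  then show ?thesis
    using frechet_derivative_linear[OF assms] by (simp add: linear_sum linear_cmul)
qed

text \<open>Smoothness of derivatives is available for constant directions only, so the field is
  expanded in \<open>Basis\<close>.\<close>

lemma smooth_on_dir_deriv:
  fixes V :: "'b::euclidean_space set"
  assumes "open V" "smooth_on V c" "smooth_on V f"
  shows "smooth_on V (dir_deriv c f)"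
proof -
  have "smooth_on V (\<lambda>x. \<Sum>i\<in>Basis. (c x \<bullet> i) *\<^sub>R frechet_derivative f (at x) i)"
    by (intro smooth_on_sum smooth_on_intros assms)
  then show ?thesis
    by (rule smooth_on_cong[OF assms(1)])
      (simp add: dir_deriv_def flip: frechet_derivative_expand[OF assms(1) _ assms(3)])
qed

text \<open>By symmetry of mixed derivatives the second-order terms cancel; what remains is df
  applied to the Lie bracket of the two fields.\<close>

lemma dir_deriv_commutator:
  fixes f :: "'b::euclidean_space \<Rightarrow> 'a::euclidean_space"
  assumes V: "open V" "x \<in> V" and c: "smooth_on V c" and d: "smooth_on V d" and f: "smooth_on V f"
  shows "dir_deriv c (dir_deriv d f) x - dir_deriv d (dir_deriv c f) x
    = frechet_derivative f (at x) (dir_deriv c d x - dir_deriv d c x)"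
proof -
  let ?D = "\<lambda>i x. frechet_derivative f (at x) i"
  let ?E = "\<lambda>i j. frechet_derivative (?D i) (at x) j"
  have eq: "dir_deriv c (dir_deriv d f) x
      = ?D (dir_deriv c d x) x + (\<Sum>i\<in>Basis. \<Sum>j\<in>Basis. (d x \<bullet> i) *\<^sub>R (c x \<bullet> j) *\<^sub>R ?E i j)"
    if c: "smooth_on V c" and d: "smooth_on V d" for c d
  proof -
    note sD = smooth_on_frechet_derivative[OF V(1) f]
    have s: "smooth_on V (\<lambda>x. \<Sum>i\<in>Basis. (d x \<bullet> i) *\<^sub>R ?D i x)"
      by (intro smooth_on_sum smooth_on_intros V f d)
    have "dir_deriv c (dir_deriv d f) x = dir_deriv c (\<lambda>x. \<Sum>i\<in>Basis. (d x \<bullet> i) *\<^sub>R ?D i x) x"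
      by (rule dir_deriv_cong_open[OF V(1) s V(2)])
        (simp add: dir_deriv_def flip: frechet_derivative_expand[OF V(1) _ f])
    also have "\<dots> = (\<Sum>i\<in>Basis. dir_deriv c (\<lambda>x. (d x \<bullet> i) *\<^sub>R ?D i x) x)"
      unfolding dir_deriv_def
      by (rule frechet_derivative_eqI)
        (intro has_derivative_sum smooth_on_has_derivative[OF V(1) _ V(2)] smooth_on_intros V f d)
    also have "\<dots> = (\<Sum>i\<in>Basis. (dir_deriv c d x \<bullet> i) *\<^sub>R ?D i x
        + (d x \<bullet> i) *\<^sub>R (\<Sum>j\<in>Basis. (c x \<bullet> j) *\<^sub>R ?E i j))"
    proof (rule sum.cong[OF refl])
      fix i :: 'b
      have "dir_deriv c (\<lambda>x. (d x \<bullet> i) *\<^sub>R ?D i x) x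
          = dir_deriv c (\<lambda>x. d x \<bullet> i) x *\<^sub>R ?D i x + (d x \<bullet> i) *\<^sub>R dir_deriv c (?D i) x"
        by (rule dir_deriv_scaleR[OF V smooth_on_inner[OF V(1) d smooth_on_const[OF V(1)]] sD])
      moreover have "dir_deriv c (\<lambda>x. d x \<bullet> i) x = dir_deriv c d x \<bullet> i"
        by (rule dir_deriv_inner_left[OF V d])
      moreover have "dir_deriv c (?D i) x = (\<Sum>j\<in>Basis. (c x \<bullet> j) *\<^sub>R ?E i j)"
        unfolding dir_deriv_def by (rule frechet_derivative_expand[OF V sD])
      ultimately show "dir_deriv c (\<lambda>x. (d x \<bullet> i) *\<^sub>R ?D i x) x = (dir_deriv c d x \<bullet> i) *\<^sub>R ?D i x
        + (d x \<bullet> i) *\<^sub>R (\<Sum>j\<in>Basis. (c x \<bullet> j) *\<^sub>R ?E i j)" by simp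
    qed
    also have "\<dots> = ?D (dir_deriv c d x) x + (\<Sum>i\<in>Basis. \<Sum>j\<in>Basis. (d x \<bullet> i) *\<^sub>R (c x \<bullet> j) *\<^sub>R ?E i j)"
      by (simp add: sum.distrib scaleR_right.sum flip: frechet_derivative_expand[OF V f])
    finally show ?thesis .
  qed
  have "(\<Sum>i\<in>Basis. \<Sum>j\<in>Basis. (d x \<bullet> i) *\<^sub>R (c x \<bullet> j) *\<^sub>R ?E i j)
      = (\<Sum>i\<in>Basis. \<Sum>j\<in>Basis. (c x \<bullet> i) *\<^sub>R (d x \<bullet> j) *\<^sub>R ?E i j)"
    by (subst sum.swap) (simp add: mixed_derivative_symmetric[OF V(1) f V(2)] mult.commute)
  then show ?thesis
    using eq[OF c d] eq[OF d c] frechet_derivative_linear[OF V f] by (simp add: linear_diff)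
qed


section \<open>Moving frames\<close>

lemma inner_swap: "a \<bullet> b = k \<Longrightarrow> b \<bullet> a = k"
  by (simp add: inner_commute)

text \<open>An orthonormal tangent frame of a surface in the unit sphere, induced by two fields of
  the parameter domain. Two-dimensionality is encoded by \<open>tangent\<close> and
  \<open>inj\<close>, which leaves the type of the parameters free.\<close>

locale sphere_frame =
  fixes W :: "'b::euclidean_space set" and u :: "'b \<Rightarrow> 'a::euclidean_space" and c1 c2 :: "'b \<Rightarrow> 'b"
  assumes W: "open W"
    and smooth_u: "smooth_on W u" and smooth_c1: "smooth_on W c1" and smooth_c2: "smooth_on W c2"
    and inj: "\<And>x. x \<in> W \<Longrightarrow> inj (frechet_derivative u (at x))"
    and tangent: "\<And>x v. x \<in> W \<Longrightarrow> frechet_derivative u (at x) v \<in> span {dir_deriv c1 u x, dir_deriv c2 u x}"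
    and E11: "\<And>x. x \<in> W \<Longrightarrow> dir_deriv c1 u x \<bullet> dir_deriv c1 u x = 1"
    and E12: "\<And>x. x \<in> W \<Longrightarrow> dir_deriv c1 u x \<bullet> dir_deriv c2 u x = 0"
    and E22: "\<And>x. x \<in> W \<Longrightarrow> dir_deriv c2 u x \<bullet> dir_deriv c2 u x = 1"
    and unit: "\<And>x. x \<in> W \<Longrightarrow> u x \<bullet> u x = 1"
begin

abbreviation "D1 \<equiv> dir_deriv c1"
abbreviation "D2 \<equiv> dir_deriv c2"
abbreviation "E1 \<equiv> dir_deriv c1 u"
abbreviation "E2 \<equiv> dir_deriv c2 u"

text \<open>The connection form: \<open>\<nabla>E\<^sub>1 = \<omega>E\<^sub>2\<close> and \<open>\<nabla>E\<^sub>2 = -\<omega>E\<^sub>1\<close> with \<open>\<omega>(E\<^sub>1) = \<alpha>\<close>, \<open>\<omega>(E\<^sub>2) = \<beta>\<close>.\<close>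
definition "\<alpha> x = E2 x \<bullet> D1 E1 x"
definition "\<beta> x = E2 x \<bullet> D2 E1 x"

lemma smooth_D: "smooth_on W g \<Longrightarrow> smooth_on W (D1 g)" "smooth_on W g \<Longrightarrow> smooth_on W (D2 g)"
  using smooth_on_dir_deriv W smooth_c1 smooth_c2 by blast+

lemmas smooth_E = smooth_D[OF smooth_u]

lemma smooth_conn: "smooth_on W \<alpha>" "smooth_on W \<beta>"
  unfolding \<alpha>_def \<beta>_def by (intro smooth_on_intros W smooth_D smooth_u)+

lemmas smooth_rules = smooth_on_const[OF W] smooth_on_add[OF W] smooth_on_minus[OF W] smooth_on_diff[OF W]
  smooth_on_mult[OF W] smooth_on_scaleR[OF W] smooth_on_inner[OF W] smooth_D smooth_u smooth_conn

text \<open>Differentiating a constant inner product; every antisymmetry relation between frame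
  coefficients below is an instance.\<close>

lemma dd_inner_const:
  assumes "smooth_on W X" "smooth_on W Y" "\<And>y. y \<in> W \<Longrightarrow> X y \<bullet> Y y = k" "x \<in> W"
  shows "dir_deriv c X x \<bullet> Y x = - (X x \<bullet> dir_deriv c Y x)"
proof -
  have "dir_deriv c (\<lambda>x. X x \<bullet> Y x) x = dir_deriv c (\<lambda>x. k) x"
    by (rule dir_deriv_cong_open[OF W smooth_on_const[OF W] assms(4)]) (simp add: assms(3))
  then show ?thesis using dir_deriv_inner[OF W assms(4,1,2)] by (simp add: eq_neg_iff_add_eq_0)
qed

lemma dd_zero:
  assumes "\<And>y. y \<in> W \<Longrightarrow> X y = 0" "x \<in> W"
  shows "dir_deriv c X x = 0"
  using dir_deriv_cong_open[OF W smooth_on_const[OF W] assms(2), of 0 X c] assms(1) by simp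

lemma uE: assumes "x \<in> W" shows "u x \<bullet> E1 x = 0" "u x \<bullet> E2 x = 0"
  using dd_inner_const[OF smooth_u smooth_u unit assms, of c1] dd_inner_const[OF smooth_u smooth_u unit assms, of c2]
  by (simp_all add: inner_commute)

text \<open>All entries come from differentiating the orthonormality relations. Since
  \<open>u\<close> is the unit normal of the sphere, the entries -1 are the second fundamental form
  of the sphere itself.\<close>

lemma frame_derivs:
  assumes x: "x \<in> W"
  shows "E1 x \<bullet> D1 E1 x = 0" "E1 x \<bullet> D2 E1 x = 0" "E2 x \<bullet> D1 E2 x = 0" "E2 x \<bullet> D2 E2 x = 0"
    "E2 x \<bullet> D1 E1 x = \<alpha> x" "E2 x \<bullet> D2 E1 x = \<beta> x" "E1 x \<bullet> D1 E2 x = - \<alpha> x" "E1 x \<bullet> D2 E2 x = - \<beta> x"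
    "u x \<bullet> D1 E1 x = - 1" "u x \<bullet> D1 E2 x = 0" "u x \<bullet> D2 E1 x = 0" "u x \<bullet> D2 E2 x = - 1"
proof -
  note a = dd_inner_const[OF smooth_E(1) smooth_E(1) E11 x] and b = dd_inner_const[OF smooth_E(2) smooth_E(2) E22 x]
    and c = dd_inner_const[OF smooth_E(1) smooth_E(2) E12 x]
    and d = dd_inner_const[OF smooth_u smooth_E(1) uE(1) x] and e = dd_inner_const[OF smooth_u smooth_E(2) uE(2) x]
  show "E1 x \<bullet> D1 E1 x = 0" "E1 x \<bullet> D2 E1 x = 0" "E2 x \<bullet> D1 E2 x = 0" "E2 x \<bullet> D2 E2 x = 0"
    using a[of c1] a[of c2] b[of c1] b[of c2] by (simp_all add: inner_commute)
  show "E2 x \<bullet> D1 E1 x = \<alpha> x" "E2 x \<bullet> D2 E1 x = \<beta> x" by (simp_all add: \<alpha>_def \<beta>_def)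
  show "E1 x \<bullet> D1 E2 x = - \<alpha> x" "E1 x \<bullet> D2 E2 x = - \<beta> x"
    using c[of c1] c[of c2] by (simp_all add: \<alpha>_def \<beta>_def inner_commute)
  show "u x \<bullet> D1 E1 x = - 1" "u x \<bullet> D1 E2 x = 0" "u x \<bullet> D2 E1 x = 0" "u x \<bullet> D2 E2 x = - 1"
    using d[of c1] d[of c2] e[of c1] e[of c2] E11[OF x] E12[OF x] E22[OF x] by (simp_all add: inner_commute)
qed

lemma tangent_expand:
  assumes x: "x \<in> W" and "v \<in> span {E1 x, E2 x}"
  shows "v = (v \<bullet> E1 x) *\<^sub>R E1 x + (v \<bullet> E2 x) *\<^sub>R E2 x"
proof -
  obtain a b where "v = a *\<^sub>R E1 x + b *\<^sub>R E2 x"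
    using assms(2) by (auto simp: span_insert span_singleton algebra_simps)
  then show ?thesis using E11[OF x] E12[OF x] E12[OF x, THEN inner_swap] E22[OF x]
    by (simp add: inner_left_distrib)
qed

text \<open>The left side is du applied to the bracket of \<open>c1\<close> and \<open>c2\<close>,
  hence tangent to the surface. This contains both torsion-freeness and the symmetry of the second
  fundamental form.\<close>

lemma u_commutator: assumes x: "x \<in> W" shows "D1 E2 x - D2 E1 x = - \<alpha> x *\<^sub>R E1 x - \<beta> x *\<^sub>R E2 x"
proof -
  have "D1 E2 x - D2 E1 x \<in> span {E1 x, E2 x}"
    unfolding dir_deriv_commutator[OF W x smooth_c1 smooth_c2 smooth_u] by (rule tangent[OF x])
  from tangent_expand[OF x this] show ?thesis
    by (simp add: inner_diff_left frame_derivs[OF x, THEN inner_swap])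
qed

text \<open>Injectivity of du lifts the identity for \<open>u\<close> to the parameter domain: the
  bracket of \<open>c1\<close> and \<open>c2\<close> is -\<alpha> c1 - \<beta> c2. Any smooth
  function can then be differentiated along it.\<close>

lemma commutator:
  fixes g :: "'b \<Rightarrow> 'c::euclidean_space"
  assumes x: "x \<in> W" and g: "smooth_on W g"
  shows "D1 (D2 g) x - D2 (D1 g) x = - \<alpha> x *\<^sub>R D1 g x - \<beta> x *\<^sub>R D2 g x"
proof -
  let ?L = "frechet_derivative u (at x)"
  have lin: "linear ?L" using frechet_derivative_linear[OF W x smooth_u] .
  have "?L (D1 c2 x - D2 c1 x) = ?L (- \<alpha> x *\<^sub>R c1 x - \<beta> x *\<^sub>R c2 x)"
    using u_commutator[OF x] unfolding dir_deriv_commutator[OF W x smooth_c1 smooth_c2 smooth_u]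
    by (simp add: linear_diff[OF lin] linear_cmul[OF lin] linear_neg[OF lin] dir_deriv_def)
  then have "D1 c2 x - D2 c1 x = - \<alpha> x *\<^sub>R c1 x - \<beta> x *\<^sub>R c2 x"
    using inj[OF x] by (simp add: inj_eq)
  moreover have "linear (frechet_derivative g (at x))" using frechet_derivative_linear[OF W x g] .
  ultimately show ?thesis
    unfolding dir_deriv_commutator[OF W x smooth_c1 smooth_c2 g]
    by (simp add: linear_diff linear_cmul linear_neg dir_deriv_def)
qed

lemma commutator_real:
  fixes g :: "'b \<Rightarrow> real"
  assumes "x \<in> W" "smooth_on W g"
  shows "D1 (D2 g) x - D2 (D1 g) x = - \<alpha> x * D1 g x - \<beta> x * D2 g x"
  using commutator[OF assms] by simp

end

text \<open>The equations of a PNMC biharmonic surface with mean curvature vector \<open>f\<eta>\<close>. The vectors \<open>v\<close>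
  select the part normal to the surface, respectively tangent to the sphere.\<close>
locale biharmonic_frame = sphere_frame W u c1 c2
  for W :: "'b::euclidean_space set" and u :: "'b \<Rightarrow> 'a::euclidean_space" and c1 c2 :: "'b \<Rightarrow> 'b" +
  fixes \<eta> :: "'b \<Rightarrow> 'a" and f :: "'b \<Rightarrow> real"
  assumes smooth_\<eta>: "smooth_on W \<eta>" and smooth_f: "smooth_on W f"
    and f_pos: "\<And>x. x \<in> W \<Longrightarrow> f x > 0"
    and \<eta>\<eta>: "\<And>x. x \<in> W \<Longrightarrow> \<eta> x \<bullet> \<eta> x = 1"
    and \<eta>u: "\<And>x. x \<in> W \<Longrightarrow> \<eta> x \<bullet> u x = 0"
    and \<eta>E1: "\<And>x. x \<in> W \<Longrightarrow> \<eta> x \<bullet> E1 x = 0"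
    and \<eta>E2: "\<And>x. x \<in> W \<Longrightarrow> \<eta> x \<bullet> E2 x = 0"
    and mean: "\<And>x v. x \<in> W \<Longrightarrow> v \<bullet> u x = 0 \<Longrightarrow> v \<bullet> E1 x = 0 \<Longrightarrow> v \<bullet> E2 x = 0
      \<Longrightarrow> v \<bullet> D1 E1 x + v \<bullet> D2 E2 x = 2 * f x * (v \<bullet> \<eta> x)"
    and parallel: "\<And>x v. x \<in> W \<Longrightarrow> v \<bullet> u x = 0 \<Longrightarrow> v \<bullet> E1 x = 0 \<Longrightarrow> v \<bullet> E2 x = 0
      \<Longrightarrow> v \<bullet> D1 \<eta> x = 0 \<and> v \<bullet> D2 \<eta> x = 0"
    and biharmonic: "\<And>x v. x \<in> W \<Longrightarrow> v \<bullet> u x = 0 \<Longrightarrow>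
      v \<bullet> (D1 (D1 (\<lambda>x. f x *\<^sub>R \<eta> x)) x + D2 (D2 (\<lambda>x. f x *\<^sub>R \<eta> x)) x
        - \<alpha> x *\<^sub>R D2 (\<lambda>x. f x *\<^sub>R \<eta> x) x + \<beta> x *\<^sub>R D1 (\<lambda>x. f x *\<^sub>R \<eta> x) x) = - 2 * f x * (v \<bullet> \<eta> x)"
begin

section \<open>Structure equations for the parallel normal field and the components of the
  biharmonic equation\<close>

definition "h11 x = \<eta> x \<bullet> D1 E1 x"
definition "h12 x = \<eta> x \<bullet> D1 E2 x"
definition "h22 x = \<eta> x \<bullet> D2 E2 x"

lemma smooth_h: "smooth_on W h11" "smooth_on W h12" "smooth_on W h22"
  unfolding h11_def h12_def h22_def by (intro smooth_rules smooth_\<eta>)+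

text \<open>The commutator of the frame is tangent, so \<open>\<eta>\<close> does not see
  it.\<close>

lemma h21: "x \<in> W \<Longrightarrow> \<eta> x \<bullet> D2 E1 x = h12 x"
  using arg_cong[OF u_commutator, of x "(\<bullet>) (\<eta> x)"] by (simp add: h12_def inner_diff_right \<eta>E1 \<eta>E2)

lemma trace_h: "x \<in> W \<Longrightarrow> h11 x + h22 x = 2 * f x"
  using mean[of x "\<eta> x"] by (simp add: h11_def h22_def \<eta>E1 \<eta>E2 \<eta>u \<eta>\<eta>)

lemma D\<eta>_inner:
  assumes x: "x \<in> W"
  shows "D1 \<eta> x \<bullet> E1 x = - h11 x" "D1 \<eta> x \<bullet> E2 x = - h12 x" "D2 \<eta> x \<bullet> E1 x = - h12 x"
    "D2 \<eta> x \<bullet> E2 x = - h22 x" "D1 \<eta> x \<bullet> u x = 0" "D2 \<eta> x \<bullet> u x = 0"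
    "D1 \<eta> x \<bullet> \<eta> x = 0" "D2 \<eta> x \<bullet> \<eta> x = 0"
  using dd_inner_const[OF smooth_\<eta> smooth_E(1) \<eta>E1 x] dd_inner_const[OF smooth_\<eta> smooth_E(2) \<eta>E2 x]
    dd_inner_const[OF smooth_\<eta> smooth_u \<eta>u x, of c1] dd_inner_const[OF smooth_\<eta> smooth_u \<eta>u x, of c2]
    dd_inner_const[OF smooth_\<eta> smooth_\<eta> \<eta>\<eta> x, of c1] dd_inner_const[OF smooth_\<eta> smooth_\<eta> \<eta>\<eta> x, of c2]
    h21[OF x] \<eta>E1[OF x] \<eta>E2[OF x]
  by (simp_all add: h11_def h12_def h22_def inner_commute[of "\<eta> x"])

lemma D\<eta>:
  assumes x: "x \<in> W"
  shows "D1 \<eta> x = - h11 x *\<^sub>R E1 x - h12 x *\<^sub>R E2 x" "D2 \<eta> x = - h12 x *\<^sub>R E1 x - h22 x *\<^sub>R E2 x"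
proof -
  note s = D\<eta>_inner[OF x] E11[OF x] E12[OF x] E22[OF x] uE[OF x]
  note s = s s[THEN inner_swap]
  \<comment> \<open>The residual of the Weingarten formula. It is normal to the surface, so
    \<open>parallel\<close> makes it orthogonal to the derivative of \<open>\<eta>\<close>, and
    hence to itself.\<close>
  let ?v = "D1 \<eta> x + h11 x *\<^sub>R E1 x + h12 x *\<^sub>R E2 x"
  have v: "?v \<bullet> u x = 0" "?v \<bullet> E1 x = 0" "?v \<bullet> E2 x = 0"
    using s by (simp_all add: inner_left_distrib)
  then have "?v \<bullet> ?v = 0" using parallel[OF x v] by (simp only: inner_right_distrib inner_scaleR_right)
  then have "?v = 0" by (simp only: inner_eq_zero_iff)
  moreover have "D1 \<eta> x = ?v - h11 x *\<^sub>R E1 x - h12 x *\<^sub>R E2 x" by simp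
  ultimately show "D1 \<eta> x = - h11 x *\<^sub>R E1 x - h12 x *\<^sub>R E2 x" by simp
  let ?v = "D2 \<eta> x + h12 x *\<^sub>R E1 x + h22 x *\<^sub>R E2 x"
  have v: "?v \<bullet> u x = 0" "?v \<bullet> E1 x = 0" "?v \<bullet> E2 x = 0"
    using s by (simp_all add: inner_left_distrib)
  then have "?v \<bullet> ?v = 0" using parallel[OF x v] by (simp only: inner_right_distrib inner_scaleR_right)
  then have "?v = 0" by (simp only: inner_eq_zero_iff)
  moreover have "D2 \<eta> x = ?v - h12 x *\<^sub>R E1 x - h22 x *\<^sub>R E2 x" by simp
  ultimately show "D2 \<eta> x = - h12 x *\<^sub>R E1 x - h22 x *\<^sub>R E2 x" by simp
qed


text \<open>The derivatives of the frame stay unexpanded, since their components normal to both the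
  surface and \<open>\<eta>\<close> are not known yet. Pairing with suitable vectors extracts what
  each equation needs.\<close>

lemma DD\<eta>:
  assumes x: "x \<in> W"
  shows "dir_deriv c (D1 \<eta>) x = - (dir_deriv c h11 x *\<^sub>R E1 x + h11 x *\<^sub>R dir_deriv c E1 x)
      - (dir_deriv c h12 x *\<^sub>R E2 x + h12 x *\<^sub>R dir_deriv c E2 x)"
    and "dir_deriv c (D2 \<eta>) x = - (dir_deriv c h12 x *\<^sub>R E1 x + h12 x *\<^sub>R dir_deriv c E1 x)
      - (dir_deriv c h22 x *\<^sub>R E2 x + h22 x *\<^sub>R dir_deriv c E2 x)"
proof -
  have *: "dir_deriv c X x = - (dir_deriv c g x *\<^sub>R E1 x + g x *\<^sub>R dir_deriv c E1 x)
      - (dir_deriv c h x *\<^sub>R E2 x + h x *\<^sub>R dir_deriv c E2 x)"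
    if X: "\<And>y. y \<in> W \<Longrightarrow> X y = - g y *\<^sub>R E1 y - h y *\<^sub>R E2 y" and g: "smooth_on W g" and h: "smooth_on W h" for X g h
  proof -
    have "dir_deriv c X x = dir_deriv c (\<lambda>y. - (g y *\<^sub>R E1 y) - h y *\<^sub>R E2 y) x"
      by (rule dir_deriv_cong_open[OF W _ x]) (intro smooth_rules g h, simp add: X)
    also have "\<dots> = - (dir_deriv c g x *\<^sub>R E1 x + g x *\<^sub>R dir_deriv c E1 x)
        - (dir_deriv c h x *\<^sub>R E2 x + h x *\<^sub>R dir_deriv c E2 x)"
      by (simp add: dir_deriv_diff[OF W x] dir_deriv_minus[OF W x] dir_deriv_scaleR[OF W x]
          smooth_rules g h)
    finally show ?thesis .
  qed
  show "dir_deriv c (D1 \<eta>) x = - (dir_deriv c h11 x *\<^sub>R E1 x + h11 x *\<^sub>R dir_deriv c E1 x)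
      - (dir_deriv c h12 x *\<^sub>R E2 x + h12 x *\<^sub>R dir_deriv c E2 x)"
    by (rule *[OF D\<eta>(1) smooth_h(1,2)])
  show "dir_deriv c (D2 \<eta>) x = - (dir_deriv c h12 x *\<^sub>R E1 x + h12 x *\<^sub>R dir_deriv c E1 x)
      - (dir_deriv c h22 x *\<^sub>R E2 x + h22 x *\<^sub>R dir_deriv c E2 x)"
    by (rule *[OF D\<eta>(2) smooth_h(2,3)])
qed

text \<open>Tangential components of the commutator identity for \<open>\<eta>\<close>. As
  \<open>\<eta>\<close> is parallel, no term of the normal connection enters.\<close>

lemma codazzi:
  assumes x: "x \<in> W"
  shows "D2 h11 x - D1 h12 x = \<alpha> x * (h11 x - h22 x) + 2 * \<beta> x * h12 x"
    and "D2 h12 x - D1 h22 x = 2 * \<alpha> x * h12 x - \<beta> x * (h11 x - h22 x)"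
proof -
  note s = frame_derivs[OF x] E11[OF x] E12[OF x] E12[OF x, THEN inner_swap] E22[OF x]
  note c = commutator[OF x smooth_\<eta>, unfolded DD\<eta>[OF x] D\<eta>[OF x]]
  show "D2 h11 x - D1 h12 x = \<alpha> x * (h11 x - h22 x) + 2 * \<beta> x * h12 x"
    using arg_cong[OF c, of "(\<bullet>) (E1 x)"] by (simp add: inner_diff_right inner_add_right s algebra_simps)
  show "D2 h12 x - D1 h22 x = 2 * \<alpha> x * h12 x - \<beta> x * (h11 x - h22 x)"
    using arg_cong[OF c, of "(\<bullet>) (E2 x)"] by (simp add: inner_diff_right inner_add_right s algebra_simps)
qed

lemma DH:
  assumes x: "x \<in> W"
  shows "dir_deriv c (\<lambda>x. f x *\<^sub>R \<eta> x) x = dir_deriv c f x *\<^sub>R \<eta> x + f x *\<^sub>R dir_deriv c \<eta> x"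
  by (rule dir_deriv_scaleR[OF W x smooth_f smooth_\<eta>])

lemma DDH:
  assumes x: "x \<in> W" and d: "smooth_on W d"
  shows "dir_deriv c (dir_deriv d (\<lambda>x. f x *\<^sub>R \<eta> x)) x = dir_deriv c (dir_deriv d f) x *\<^sub>R \<eta> x
    + dir_deriv d f x *\<^sub>R dir_deriv c \<eta> x + dir_deriv c f x *\<^sub>R dir_deriv d \<eta> x + f x *\<^sub>R dir_deriv c (dir_deriv d \<eta>) x"
proof -
  note sm = smooth_rules smooth_f smooth_\<eta> smooth_on_dir_deriv[OF W d smooth_f] smooth_on_dir_deriv[OF W d smooth_\<eta>]
  have "dir_deriv c (dir_deriv d (\<lambda>x. f x *\<^sub>R \<eta> x)) x
      = dir_deriv c (\<lambda>x. dir_deriv d f x *\<^sub>R \<eta> x + f x *\<^sub>R dir_deriv d \<eta> x) x"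
    by (rule dir_deriv_cong_open[OF W _ x]) (intro sm, simp add: DH)
  also have "\<dots> = (dir_deriv c (dir_deriv d f) x *\<^sub>R \<eta> x + dir_deriv d f x *\<^sub>R dir_deriv c \<eta> x)
      + (dir_deriv c f x *\<^sub>R dir_deriv d \<eta> x + f x *\<^sub>R dir_deriv c (dir_deriv d \<eta>) x)"
    by (simp add: dir_deriv_add[OF W x] dir_deriv_scaleR[OF W x] sm)
  finally show ?thesis by (simp add: add.assoc)
qed

text \<open>Pairing the biharmonic equation with \<open>E1\<close> and \<open>E2\<close> produces
  A(grad f) and the divergence of A. Codazzi turns the divergence into the gradient of the trace,
  that is 2 grad f.\<close>

lemma biharmonic_tangent:
  assumes x: "x \<in> W"
  shows "h11 x * D1 f x + h12 x * D2 f x = - f x * D1 f x"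
    and "h12 x * D1 f x + h22 x * D2 f x = - f x * D2 f x"
proof -
  note s = frame_derivs[OF x] E11[OF x] E12[OF x] E12[OF x, THEN inner_swap] E22[OF x] \<eta>E1[OF x] \<eta>E2[OF x]
    \<eta>E1[OF x, THEN inner_swap] \<eta>E2[OF x, THEN inner_swap] uE[OF x] uE[OF x, THEN inner_swap]
  have tr: "dir_deriv c h11 x + dir_deriv c h22 x = 2 * dir_deriv c f x" for c
  proof -
    have "dir_deriv c (\<lambda>x. h11 x + h22 x) x = dir_deriv c (\<lambda>x. 2 * f x) x"
      by (rule dir_deriv_cong_open[OF W _ x]) (intro smooth_rules smooth_f, simp add: trace_h)
    then show ?thesis
      by (simp add: dir_deriv_add[OF W x smooth_h(1,3)] dir_deriv_mult[OF W x smooth_on_const[OF W] smooth_f])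
  qed
  note bh = biharmonic[OF x, unfolded DDH[OF x smooth_c1] DDH[OF x smooth_c2] DH[OF x] DD\<eta>[OF x] D\<eta>[OF x]]
  have tr': "D1 h22 x = 2 * D1 f x - D1 h11 x" "D2 h22 x = 2 * D2 f x - D2 h11 x"
    using tr[of c1] tr[of c2] by simp_all
  have cz: "D2 h12 x = D1 h22 x + 2 * \<alpha> x * h12 x - \<beta> x * (h11 x - h22 x)"
    "D1 h12 x = D2 h11 x - \<alpha> x * (h11 x - h22 x) - 2 * \<beta> x * h12 x" using codazzi[OF x] by simp_all
  have "- 2 * (h11 x * D1 f x + h12 x * D2 f x)
      + f x * (- D1 h11 x + \<alpha> x * h12 x - D2 h12 x + \<beta> x * h22 x) + \<alpha> x * f x * h12 x - \<beta> x * f x * h11 x = 0"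
    using bh[of "E1 x"] by (simp add: inner_diff_right inner_add_right s algebra_simps)
  then show "h11 x * D1 f x + h12 x * D2 f x = - f x * D1 f x"
    unfolding cz tr' by (simp add: algebra_simps)
  have "- 2 * (h12 x * D1 f x + h22 x * D2 f x)
      + f x * (- D1 h12 x - \<alpha> x * h11 x - D2 h22 x - \<beta> x * h12 x) + \<alpha> x * f x * h22 x - \<beta> x * f x * h12 x = 0"
    using bh[of "E2 x"] by (simp add: inner_diff_right inner_add_right s algebra_simps)
  then show "h12 x * D1 f x + h22 x * D2 f x = - f x * D2 f x"
    unfolding cz tr' by (simp add: algebra_simps)
qed

text \<open>The component along \<open>\<eta>\<close>: pairing \<open>\<eta>\<close> with the sum of
  its second derivatives gives -|A|^2, and the curvature of the sphere supplies the 2.\<close>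

lemma laplace:
  assumes x: "x \<in> W"
  shows "D1 (D1 f) x + D2 (D2 f) x - \<alpha> x * D2 f x + \<beta> x * D1 f x = f x * ((h11 x)\<^sup>2 + 2 * (h12 x)\<^sup>2 + (h22 x)\<^sup>2 - 2)"
proof -
  note bh = biharmonic[OF x, unfolded DDH[OF x smooth_c1] DDH[OF x smooth_c2] DH[OF x] DD\<eta>[OF x] D\<eta>[OF x]]
  show ?thesis
    using bh[of "\<eta> x"] h21[OF x]
    by (simp add: inner_diff_right inner_add_right \<eta>u[OF x] \<eta>\<eta>[OF x] \<eta>E1[OF x] \<eta>E2[OF x]
      flip: h11_def h12_def h22_def) (simp add: algebra_simps power2_eq_square)
qed

text \<open>The shape operator of \<open>\<xi>\<close> is trace-free; it commutes with that of \<open>\<eta>\<close> by the Ricci equation and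
  is orthogonal to it by the normal part of the biharmonic equation.\<close>
lemma normal_component_zero:
  assumes x: "x \<in> W" and ns: "h11 x \<noteq> h22 x \<or> h12 x \<noteq> 0"
    and \<xi>: "\<xi> \<bullet> u x = 0" "\<xi> \<bullet> E1 x = 0" "\<xi> \<bullet> E2 x = 0" "\<xi> \<bullet> \<eta> x = 0"
  shows "\<xi> \<bullet> D1 E1 x = 0" "\<xi> \<bullet> D1 E2 x = 0" "\<xi> \<bullet> D2 E1 x = 0" "\<xi> \<bullet> D2 E2 x = 0"
proof -
  have b21: "\<xi> \<bullet> D2 E1 x = \<xi> \<bullet> D1 E2 x"
    using arg_cong[OF u_commutator[OF x], of "(\<bullet>) \<xi>"] by (simp add: inner_diff_right \<xi>)
  have b22: "\<xi> \<bullet> D2 E2 x = - (\<xi> \<bullet> D1 E1 x)"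
    using mean[OF x, of \<xi>] \<xi> by simp
  note bh = biharmonic[OF x, unfolded DDH[OF x smooth_c1] DDH[OF x smooth_c2] DH[OF x] DD\<eta>[OF x] D\<eta>[OF x]]
  have 1: "(h11 x - h22 x) * (\<xi> \<bullet> D1 E1 x) + 2 * h12 x * (\<xi> \<bullet> D1 E2 x) = 0"
  proof -
    have "f x * (h11 x * (\<xi> \<bullet> D1 E1 x)) + f x * (2 * (h12 x * (\<xi> \<bullet> D1 E2 x))) = f x * (h22 x * (\<xi> \<bullet> D1 E1 x))"
      using bh[of \<xi>] \<xi> by (simp add: inner_diff_right inner_add_right b21 b22) (simp add: algebra_simps)
    then have "f x * ((h11 x - h22 x) * (\<xi> \<bullet> D1 E1 x) + 2 * h12 x * (\<xi> \<bullet> D1 E2 x)) = 0"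
      by algebra
    then show ?thesis using f_pos[OF x] by simp
  qed
  have 2: "- 2 * h12 x * (\<xi> \<bullet> D1 E1 x) + (h11 x - h22 x) * (\<xi> \<bullet> D1 E2 x) = 0"
    using arg_cong[OF commutator[OF x smooth_\<eta>, unfolded DD\<eta>[OF x] D\<eta>[OF x]], of "(\<bullet>) \<xi>"] \<xi>
    by (simp add: inner_diff_right inner_add_right b21 b22) (simp add: algebra_simps)
  \<comment> \<open>The equations \<open>1\<close> and \<open>2\<close> form a linear system for the
    two free entries of the shape operator of \<open>\<xi>\<close>; this is its determinant.\<close>
  have nz: "(h11 x - h22 x)\<^sup>2 + (2 * h12 x)\<^sup>2 \<noteq> 0" unfolding sum_power2_eq_zero_iff using ns by simp
  have "((h11 x - h22 x)\<^sup>2 + (2 * h12 x)\<^sup>2) * (\<xi> \<bullet> D1 E1 x) = 0"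
    using 1 2 by algebra
  then show 11: "\<xi> \<bullet> D1 E1 x = 0" using nz by simp
  have "((h11 x - h22 x)\<^sup>2 + (2 * h12 x)\<^sup>2) * (\<xi> \<bullet> D1 E2 x) = 0"
    using 1 2 by algebra
  then show 12: "\<xi> \<bullet> D1 E2 x = 0" using nz by simp
  show "\<xi> \<bullet> D2 E1 x = 0" "\<xi> \<bullet> D2 E2 x = 0" using b21 b22 11 12 by simp_all
qed

text \<open>The residual v - ?w is itself an admissible \<open>\<xi>\<close>. It is therefore
  orthogonal to v as well as to ?w, and so vanishes; no basis of the normal space is
  involved.\<close>

lemma normal_expand:
  assumes x: "x \<in> W" and \<xi>: "\<And>\<xi>. \<xi> \<bullet> u x = 0 \<Longrightarrow> \<xi> \<bullet> E1 x = 0 \<Longrightarrow> \<xi> \<bullet> E2 x = 0 \<Longrightarrow> \<xi> \<bullet> \<eta> x = 0 \<Longrightarrow> \<xi> \<bullet> v = 0"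
  shows "v = (u x \<bullet> v) *\<^sub>R u x + (E1 x \<bullet> v) *\<^sub>R E1 x + (E2 x \<bullet> v) *\<^sub>R E2 x + (\<eta> x \<bullet> v) *\<^sub>R \<eta> x"
    (is "v = ?w")
proof -
  note s = unit[OF x] E11[OF x] E12[OF x] E12[OF x, THEN inner_swap] E22[OF x] \<eta>E1[OF x] \<eta>E2[OF x]
    \<eta>E1[OF x, THEN inner_swap] \<eta>E2[OF x, THEN inner_swap] uE[OF x] uE[OF x, THEN inner_swap]
    \<eta>u[OF x] \<eta>u[OF x, THEN inner_swap] \<eta>\<eta>[OF x]
  have o: "(v - ?w) \<bullet> u x = 0" "(v - ?w) \<bullet> E1 x = 0" "(v - ?w) \<bullet> E2 x = 0" "(v - ?w) \<bullet> \<eta> x = 0"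
    by (simp_all add: inner_diff_left inner_left_distrib s) (simp_all add: inner_commute)
  have "(v - ?w) \<bullet> (v - ?w) = (v - ?w) \<bullet> v - (v - ?w) \<bullet> ?w" by (simp only: inner_diff_right)
  also have "\<dots> = 0" using \<xi>[OF o] by (simp only: inner_right_distrib inner_scaleR_right o)
  finally have "v - ?w = 0" by (simp only: inner_eq_zero_iff)
  then show ?thesis by (simp only: right_minus_eq)
qed

text \<open>Where A is not scalar, the derivatives of the frame have only frame,
  \<open>\<eta>\<close> and \<open>u\<close> components. The quadratic term D1 E2 . D2 E1 - D2 E2 .
  D1 E1 then equals -det A - 1, and the identity says that the Gauss curvature is 1 + det A.\<close>

lemma gauss:
  assumes x: "x \<in> W" and ns: "h11 x \<noteq> h22 x \<or> h12 x \<noteq> 0"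
  shows "D1 \<beta> x - D2 \<alpha> x + (\<alpha> x)\<^sup>2 + (\<beta> x)\<^sup>2 + h11 x * h22 x - (h12 x)\<^sup>2 + 1 = 0"
proof -
  note nz = normal_component_zero[OF x ns]
  note s = unit[OF x] E11[OF x] E12[OF x] E12[OF x, THEN inner_swap] E22[OF x] \<eta>E1[OF x] \<eta>E2[OF x]
    \<eta>E1[OF x, THEN inner_swap] \<eta>E2[OF x, THEN inner_swap] uE[OF x] uE[OF x, THEN inner_swap]
    \<eta>u[OF x] \<eta>u[OF x, THEN inner_swap] \<eta>\<eta>[OF x]
  have D1E1: "D1 E1 x = \<alpha> x *\<^sub>R E2 x + h11 x *\<^sub>R \<eta> x - u x"
    by (rule trans[OF normal_expand[OF x nz(1)]]) (simp_all add: frame_derivs[OF x] flip: h11_def)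
  have D2E2: "D2 E2 x = - \<beta> x *\<^sub>R E1 x + h22 x *\<^sub>R \<eta> x - u x"
    by (rule trans[OF normal_expand[OF x nz(4)]]) (simp_all add: frame_derivs[OF x] flip: h22_def)
  have D1E2: "D1 E2 x = - \<alpha> x *\<^sub>R E1 x + h12 x *\<^sub>R \<eta> x"
    by (rule trans[OF normal_expand[OF x nz(2)]]) (simp_all add: frame_derivs[OF x] flip: h12_def)
  have D2E1: "D2 E1 x = \<beta> x *\<^sub>R E2 x + h12 x *\<^sub>R \<eta> x"
    by (rule trans[OF normal_expand[OF x nz(3)]]) (simp_all add: frame_derivs[OF x] h21[OF x])
  have "D1 \<beta> x = D1 E2 x \<bullet> D2 E1 x + E2 x \<bullet> D1 (D2 E1) x"
    unfolding \<beta>_def by (rule dir_deriv_inner[OF W x]) (intro smooth_rules)+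
  moreover have "D2 \<alpha> x = D2 E2 x \<bullet> D1 E1 x + E2 x \<bullet> D2 (D1 E1) x"
    unfolding \<alpha>_def by (rule dir_deriv_inner[OF W x]) (intro smooth_rules)+
  moreover have "E2 x \<bullet> D1 (D2 E1) x - E2 x \<bullet> D2 (D1 E1) x = - (\<alpha> x)\<^sup>2 - (\<beta> x)\<^sup>2"
    using arg_cong[OF commutator[OF x smooth_E(1)], of "(\<bullet>) (E2 x)"]
    by (simp add: inner_diff_right frame_derivs[OF x] power2_eq_square)
  moreover have "D1 E2 x \<bullet> D2 E1 x = (h12 x)\<^sup>2" "D2 E2 x \<bullet> D1 E1 x = h11 x * h22 x + 1"
    unfolding D1E1 D2E2 D1E2 D2E1 by (simp_all add: inner_diff_left inner_diff_right inner_left_distrib inner_right_distrib s power2_eq_square)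
  ultimately show ?thesis by simp
qed

text \<open>The shape operator of \<open>\<eta>\<close> has the eigenvalues \<open>-f\<close> and \<open>3f\<close>. The Codazzi, Gauss and Laplace
  equations reduce to ordinary differential equations for \<open>\<beta>\<close> and \<open>f\<close> along \<open>E\<^sub>1\<close>, and eliminating the
  derivatives gives first \<open>8\<beta>\<^sup>2 = 63f\<^sup>2 - 15\<close> and then \<open>45f\<^sup>2 + 7 = 0\<close>.\<close>
lemma no_adapted_frame:
  assumes D1f: "\<And>x. x \<in> W \<Longrightarrow> D1 f x \<noteq> 0" and D2f: "\<And>x. x \<in> W \<Longrightarrow> D2 f x = 0"
  shows "W = {}"
proof (rule ccontr)
  assume "W \<noteq> {}"
  then obtain x where x: "x \<in> W" by auto
  have h: "h11 y = - f y" "h12 y = 0" "h22 y = 3 * f y" if y: "y \<in> W" for y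
  proof -
    \<comment> \<open>With D2 f = 0 the gradient equation only involves the first column of A, and
      D1 f can be cancelled. The trace supplies the other eigenvalue.\<close>
    have "D1 f y * (h11 y + f y) = 0" "D1 f y * h12 y = 0"
      using biharmonic_tangent[OF y] D2f[OF y] by (simp_all add: algebra_simps)
    then show "h11 y = - f y" "h12 y = 0" "h22 y = 3 * f y"
      using D1f[OF y] trace_h[OF y] by simp_all
  qed
  have Dh: "dir_deriv c h11 y = - dir_deriv c f y" "dir_deriv c h12 y = 0" "dir_deriv c h22 y = 3 * dir_deriv c f y"
    if y: "y \<in> W" for y c
  proof -
    have "dir_deriv c h11 y = dir_deriv c (\<lambda>y. - f y) y" "dir_deriv c h22 y = dir_deriv c (\<lambda>y. 3 * f y) y"
      by (rule dir_deriv_cong_open[OF W _ y]; (intro smooth_rules smooth_f | simp add: h))+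
    then show "dir_deriv c h11 y = - dir_deriv c f y" "dir_deriv c h22 y = 3 * dir_deriv c f y"
      by (simp_all add: dir_deriv_minus[OF W y smooth_f] dir_deriv_mult[OF W y smooth_on_const[OF W] smooth_f])
    show "dir_deriv c h12 y = 0" by (rule dd_zero[OF h(2) y])
  qed
  \<comment> \<open>The Codazzi factor h11 - h22 = -4f does not vanish; geometrically, the integral
    curves of \<open>E1\<close> are geodesics.\<close>
  have \<alpha>0: "\<alpha> y = 0" if y: "y \<in> W" for y
    using codazzi(1)[OF y] D2f[OF y] f_pos[OF y] by (simp add: h[OF y] Dh[OF y])
  have \<beta>f: "4 * (\<beta> y * f y) = - 3 * D1 f y" if y: "y \<in> W" for y
    using codazzi(2)[OF y] by (simp add: h[OF y] Dh[OF y])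
  have D\<beta>f: "4 * (D1 \<beta> y * f y + \<beta> y * D1 f y) = - 3 * D1 (D1 f) y" if y: "y \<in> W" for y
  proof -
    have "D1 (\<lambda>y. 4 * (\<beta> y * f y)) y = D1 (\<lambda>y. - 3 * D1 f y) y"
      by (rule dir_deriv_cong_open[OF W _ y]) (intro smooth_rules smooth_f, simp add: \<beta>f)
    then show ?thesis
      by (simp add: dir_deriv_mult[OF W y smooth_on_const[OF W]] dir_deriv_mult[OF W y] dir_deriv_minus[OF W y] smooth_rules smooth_f)
  qed
  have gs: "D1 \<beta> y + (\<beta> y)\<^sup>2 - 3 * (f y)\<^sup>2 + 1 = 0" if y: "y \<in> W" for y
    using gauss[OF y] dd_zero[where X=\<alpha> and c=c2, OF \<alpha>0 y] f_pos[OF y] by (simp add: h[OF y] \<alpha>0[OF y] power2_eq_square)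
  have lp: "D1 (D1 f) y + \<beta> y * D1 f y = f y * (10 * (f y)\<^sup>2 - 2)" if y: "y \<in> W" for y
    using laplace[OF y] dd_zero[where X="D2 f" and c=c2, OF D2f y] by (simp add: h[OF y] \<alpha>0[OF y] power2_eq_square)
  \<comment> \<open>In \<open>D\<beta>f\<close>, \<open>gs\<close> eliminates D1 \<beta>,
    \<open>lp\<close> eliminates D1 (D1 f), and \<open>\<beta>f\<close> eliminates D1 f. Every term
    keeps a factor f, which is cancelled.\<close>
  have b2: "8 * (\<beta> y * \<beta> y) = 63 * (f y * f y) - 15" if y: "y \<in> W" for y
  proof -
    have "f y * (8 * (\<beta> y * \<beta> y)) = f y * (63 * (f y * f y) - 15)"
      using \<beta>f[OF y] D\<beta>f[OF y] gs[OF y] lp[OF y] by algebra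
    then show ?thesis using f_pos[OF y] by simp
  qed
  have "D1 (\<lambda>y. 8 * (\<beta> y * \<beta> y)) x = D1 (\<lambda>y. 63 * (f y * f y) - 15) x"
    by (rule dir_deriv_cong_open[OF W _ x]) (intro smooth_rules smooth_f, simp add: b2)
  then have "16 * (\<beta> x * D1 \<beta> x) = 126 * (f x * D1 f x)"
    by (simp add: dir_deriv_mult[OF W x smooth_on_const[OF W]] dir_deriv_mult[OF W x] dir_deriv_diff[OF W x] smooth_rules smooth_f)
  \<comment> \<open>By \<open>\<beta>f\<close>, f D1 f = -(4/3) \<beta> f^2, so \<beta> splits off;
    it is nonzero because D1 f is.\<close>
  then have "\<beta> x * (2 * D1 \<beta> x + 21 * (f x)\<^sup>2) = 0"
    using \<beta>f[OF x] by algebra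
  moreover have "\<beta> x \<noteq> 0" using \<beta>f[OF x] D1f[OF x] by auto
  ultimately have "45 * (f x)\<^sup>2 + 7 = 0" using gs[OF x] b2[OF x] by (simp add: power2_eq_square)
  then show False by (smt (verit) zero_le_power2)
qed

text \<open>The vector \<open>(p, h\<^sub>1\<^sub>2)\<close> built from the trace-free part of the shape operator has constant positive
  length, so by the Codazzi equations the connection form is \<open>-1/2\<close> times the differential of its
  angle. Hence the surface is flat, and the Gauss equation reads \<open>2f\<^sup>2 = 0\<close>.\<close>
lemma no_constant_nonumbilical:
  assumes D1f: "\<And>x. x \<in> W \<Longrightarrow> D1 f x = 0" and D2f: "\<And>x. x \<in> W \<Longrightarrow> D2 f x = 0"
    and ns: "\<And>x. x \<in> W \<Longrightarrow> h11 x \<noteq> h22 x \<or> h12 x \<noteq> 0"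
  shows "W = {}"
proof (rule ccontr)
  assume "W \<noteq> {}"
  then obtain x where x: "x \<in> W" by auto
  \<comment> \<open>The trace-free part of the shape operator has the matrix rows (p, h12) and (h12,
    -p).\<close>
  define p where "p y = h11 y - f y" for y
  have h22: "h22 y = f y - p y" "h11 y = f y + p y" if "y \<in> W" for y
    using trace_h[OF that] by (simp_all add: p_def)
  have smp: "smooth_on W p" unfolding p_def by (intro smooth_rules smooth_h smooth_f)
  have Dh: "dir_deriv c h11 y = dir_deriv c p y" "dir_deriv c h22 y = - dir_deriv c p y"
    if y: "y \<in> W" and c: "c = c1 \<or> c = c2" for y c
  proof -
    have "dir_deriv c h11 y = dir_deriv c (\<lambda>y. f y + p y) y" "dir_deriv c h22 y = dir_deriv c (\<lambda>y. f y - p y) y"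
      by (rule dir_deriv_cong_open[OF W _ y]; (intro smooth_rules smooth_f smp | simp add: h22))+
    then show "dir_deriv c h11 y = dir_deriv c p y" "dir_deriv c h22 y = - dir_deriv c p y"
      using c D1f[OF y] D2f[OF y]
      by (auto simp: dir_deriv_add[OF W y smooth_f smp] dir_deriv_diff[OF W y smooth_f smp])
  qed
  have r: "(p y)\<^sup>2 + (h12 y)\<^sup>2 + (f y)\<^sup>2 = 1" if y: "y \<in> W" for y
    using laplace[OF y] D1f[OF y] D2f[OF y] dd_zero[where X="D1 f" and c=c1, OF D1f y] dd_zero[where X="D2 f" and c=c2, OF D2f y] f_pos[OF y]
    by (simp add: h22[OF y]) (simp add: power2_eq_square field_simps)
  have Dr: "p y * dir_deriv c p y + h12 y * dir_deriv c h12 y = 0" if y: "y \<in> W" and c: "c = c1 \<or> c = c2" for y c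
  proof -
    have "dir_deriv c (\<lambda>y. p y * p y + h12 y * h12 y + f y * f y) y = dir_deriv c (\<lambda>y. 1) y"
      by (rule dir_deriv_cong_open[OF W _ y]) (intro smooth_rules, use r in \<open>simp add: power2_eq_square\<close>)
    then show ?thesis using c D1f[OF y] D2f[OF y]
      by (auto simp: dir_deriv_mult[OF W y] dir_deriv_add[OF W y] smooth_rules smp smooth_h smooth_f)
  qed
  have nz: "(p y)\<^sup>2 + (h12 y)\<^sup>2 \<noteq> 0" if y: "y \<in> W" for y
    unfolding sum_power2_eq_zero_iff using ns[OF y] h22[OF y] by auto
  have D: "D1 p y = 2 * (\<alpha> y * h12 y)" "D1 h12 y = - 2 * (\<alpha> y * p y)" "D2 p y = 2 * (\<beta> y * h12 y)" "D2 h12 y = - 2 * (\<beta> y * p y)"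
    if y: "y \<in> W" for y
  proof -
    note e = Dr[OF y, of c1] Dr[OF y, of c2] codazzi[OF y, unfolded Dh(1)[OF y, of c2, simplified] Dh(2)[OF y, of c1, simplified] h22[OF y]]
    \<comment> \<open>Constant length and Codazzi give four linear equations for the four
      derivatives of \<open>p\<close> and \<open>h12\<close>; they are solved after multiplication
      by the nonzero squared length.\<close>
    have "((p y)\<^sup>2 + (h12 y)\<^sup>2) * (D1 p y - 2 * (\<alpha> y * h12 y)) = 0"
      "((p y)\<^sup>2 + (h12 y)\<^sup>2) * (D1 h12 y + 2 * (\<alpha> y * p y)) = 0"
      "((p y)\<^sup>2 + (h12 y)\<^sup>2) * (D2 p y - 2 * (\<beta> y * h12 y)) = 0"
      "((p y)\<^sup>2 + (h12 y)\<^sup>2) * (D2 h12 y + 2 * (\<beta> y * p y)) = 0"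
      using e(1)[OF disjI1[OF refl]] e(2)[OF disjI2[OF refl]] e(3,4) by algebra+
    then show "D1 p y = 2 * (\<alpha> y * h12 y)" "D1 h12 y = - 2 * (\<alpha> y * p y)" "D2 p y = 2 * (\<beta> y * h12 y)" "D2 h12 y = - 2 * (\<beta> y * p y)"
      using nz[OF y] by (auto simp: eq_neg_iff_add_eq_0)
  qed
  have DD: "dir_deriv c (D1 p) x = 2 * (dir_deriv c \<alpha> x * h12 x + \<alpha> x * dir_deriv c h12 x)"
    "dir_deriv c (D2 p) x = 2 * (dir_deriv c \<beta> x * h12 x + \<beta> x * dir_deriv c h12 x)"
    "dir_deriv c (D1 h12) x = - 2 * (dir_deriv c \<alpha> x * p x + \<alpha> x * dir_deriv c p x)"
    "dir_deriv c (D2 h12) x = - 2 * (dir_deriv c \<beta> x * p x + \<beta> x * dir_deriv c p x)" for c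
  proof -
    have *: "dir_deriv c X x = k * (dir_deriv c g x * h x + g x * dir_deriv c h x)"
      if "\<And>y. y \<in> W \<Longrightarrow> X y = k * (g y * h y)" "smooth_on W g" "smooth_on W h"
      for X g h :: "'b \<Rightarrow> real" and k
    proof -
      have "dir_deriv c X x = dir_deriv c (\<lambda>y. k * (g y * h y)) x"
        by (rule dir_deriv_cong_open[OF W _ x]) (intro smooth_rules that(2,3), simp add: that(1))
      then show ?thesis
        by (simp add: dir_deriv_mult[OF W x smooth_on_const[OF W]] dir_deriv_mult[OF W x] that(2,3) smooth_rules)
    qed
    show "dir_deriv c (D1 p) x = 2 * (dir_deriv c \<alpha> x * h12 x + \<alpha> x * dir_deriv c h12 x)"
      by (rule *[OF D(1) smooth_conn(1) smooth_h(2)])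
    show "dir_deriv c (D2 p) x = 2 * (dir_deriv c \<beta> x * h12 x + \<beta> x * dir_deriv c h12 x)"
      by (rule *[OF D(3) smooth_conn(2) smooth_h(2)])
    show "dir_deriv c (D1 h12) x = - 2 * (dir_deriv c \<alpha> x * p x + \<alpha> x * dir_deriv c p x)"
      by (rule *[OF D(2) smooth_conn(1) smp])
    show "dir_deriv c (D2 h12) x = - 2 * (dir_deriv c \<beta> x * p x + \<beta> x * dir_deriv c p x)"
      by (rule *[OF D(4) smooth_conn(2) smp])
  qed
  \<comment> \<open>The mixed products of \<alpha> and \<beta> cancel. The remaining factor is the
    exterior derivative of the connection form on the frame, which is minus the Gauss
    curvature.\<close>
  have "h12 x * (D1 \<beta> x - D2 \<alpha> x + (\<alpha> x)\<^sup>2 + (\<beta> x)\<^sup>2) = 0"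
    using commutator_real[OF x smp] by (simp add: DD D[OF x] power2_eq_square algebra_simps)
  moreover have "p x * (D1 \<beta> x - D2 \<alpha> x + (\<alpha> x)\<^sup>2 + (\<beta> x)\<^sup>2) = 0"
    using commutator_real[OF x smooth_h(2)] by (simp add: DD D[OF x] power2_eq_square algebra_simps)
  ultimately have "D1 \<beta> x - D2 \<alpha> x + (\<alpha> x)\<^sup>2 + (\<beta> x)\<^sup>2 = 0" using nz[OF x] by auto
  then have "2 * (f x)\<^sup>2 = 0"
    using gauss[OF x ns[OF x], unfolded h22[OF x]] r[OF x] by algebra
  then show False using f_pos[OF x] by simp
qed

text \<open>The two nonexistence lemmas are applied to open subsets on which a nondegeneracy
  condition holds; this provides the frame there.\<close>

lemma restrict: assumes "open W'" "W' \<subseteq> W" shows "biharmonic_frame W' u c1 c2 \<eta> f"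
proof
  show "frechet_derivative u (at x) v \<in> span {E1 x, E2 x}" if "x \<in> W'" for x v
    using tangent that assms by blast
qed (use assms W smooth_u smooth_c1 smooth_c2 inj E11 E12 E22 unit smooth_\<eta> smooth_f f_pos \<eta>\<eta> \<eta>u \<eta>E1 \<eta>E2
    mean parallel biharmonic in \<open>auto intro: smooth_on_subset\<close>)


text \<open>The open set where A is not scalar satisfies the assumptions of
  \<open>no_constant_nonumbilical\<close>, hence is empty. With A = f id the Laplace equation
  becomes f (2 f^2 - 2) = 0.\<close>

lemma umbilical:
  assumes D1f: "\<And>x. x \<in> W \<Longrightarrow> D1 f x = 0" and D2f: "\<And>x. x \<in> W \<Longrightarrow> D2 f x = 0" and x: "x \<in> W"
  shows "f x = 1" "D1 \<eta> x = - E1 x" "D2 \<eta> x = - E2 x"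
proof -
  define W' where "W' = {x \<in> W. (h11 x - h22 x)\<^sup>2 + (h12 x)\<^sup>2 \<noteq> 0}"
  have "continuous_on W (\<lambda>x. (h11 x - h22 x)\<^sup>2 + (h12 x)\<^sup>2)"
    using smooth_h by (intro continuous_intros smooth_on_continuous_on W)
  from continuous_open_preimage[OF this W open_Compl[OF closed_singleton[of 0]]] have "open W'"
    by (simp add: W'_def vimage_def Int_def)
  then interpret W': biharmonic_frame W' u c1 c2 \<eta> f
    by (rule restrict) (auto simp: W'_def)
  have "W' = {}"
    by (rule W'.no_constant_nonumbilical) (auto simp: W'_def D1f D2f)
  then have "(h11 x - h22 x)\<^sup>2 + (h12 x)\<^sup>2 = 0" using x by (auto simp: W'_def)
  then have h: "h11 x = f x" "h22 x = f x" "h12 x = 0"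
    using trace_h[OF x] unfolding sum_power2_eq_zero_iff by auto
  have "f x * (2 * (f x)\<^sup>2 - 2) = 0"
    using laplace[OF x] D1f[OF x] D2f[OF x] dd_zero[where X="D1 f" and c=c1, OF D1f x]
      dd_zero[where X="D2 f" and c=c2, OF D2f x] by (simp add: h)
  then show "f x = 1" using f_pos[OF x] by (simp add: power2_eq_1_iff)
  with h D\<eta>[OF x] show "D1 \<eta> x = - E1 x" "D2 \<eta> x = - E2 x" by simp_all
qed

end


section \<open>Orthogonal projections and traces\<close>

lemma orth_proj_eqI:
  assumes "subspace S" "w \<in> S" "\<And>s. s \<in> S \<Longrightarrow> (v - w) \<bullet> s = 0"
  shows "orth_proj S v = w"
  unfolding orth_proj_def
proof (rule the_equality)
  show "w \<in> S \<and> (\<forall>s\<in>S. orthogonal (v - w) s)" using assms by (auto simp: orthogonal_def)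
next
  fix w' assume w': "w' \<in> S \<and> (\<forall>s\<in>S. orthogonal (v - w') s)"
  have "w' - w \<in> S" using w' assms by (auto intro: subspace_diff)
  then have "(v - w) \<bullet> (w' - w) = 0" "(v - w') \<bullet> (w' - w) = 0"
    using assms(3) w' by (auto simp: orthogonal_def)
  then have "(w' - w) \<bullet> (w' - w) = 0" by (simp add: inner_diff_left)
  then show "w' = w" by simp
qed

lemma orth_proj:
  assumes "subspace S"
  shows "orth_proj S v \<in> S" and "s \<in> S \<Longrightarrow> (v - orth_proj S v) \<bullet> s = 0"
proof -
  obtain y z where "y \<in> span S" "\<And>w. w \<in> span S \<Longrightarrow> orthogonal z w" "v = y + z"
    using orthogonal_subspace_decomp_exists[of S v] by metis
  then have yz: "y \<in> S" "\<And>w. w \<in> S \<Longrightarrow> (v - y) \<bullet> w = 0"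
    using assms by (auto simp: orthogonal_def span_eq_iff[THEN iffD2])
  then have "orth_proj S v = y" by (intro orth_proj_eqI assms)
  then show "orth_proj S v \<in> S" "s \<in> S \<Longrightarrow> (v - orth_proj S v) \<bullet> s = 0" using yz by auto
qed

lemma linear_orth_proj: assumes "subspace S" shows "linear (orth_proj S)"
proof
  note p = orth_proj[OF assms]
  show "orth_proj S (v + w) = orth_proj S v + orth_proj S w" for v w
    by (rule orth_proj_eqI[OF assms])
      (use p(2)[of _ v] p(2)[of _ w] in \<open>auto intro: subspace_add assms p simp: algebra_simps\<close>)
  show "orth_proj S (c *\<^sub>R v) = c *\<^sub>R orth_proj S v" for c v
    by (rule orth_proj_eqI[OF assms])
      (use p(2)[of _ v] in \<open>auto intro: subspace_mul assms p simp flip: scaleR_right_diff_distrib\<close>)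
qed

text \<open>It collapses the two projections in \<open>normal_cov_deriv\<close>, to the tangent
  space of N and then to the normal space, into one.\<close>

lemma orth_proj_nested:
  assumes "subspace A" "subspace B" "A \<subseteq> B"
  shows "orth_proj A (orth_proj B v) = orth_proj A v"
proof (rule orth_proj_eqI[OF assms(1) orth_proj(1)[OF assms(1)]])
  fix s assume s: "s \<in> A"
  have "(v - orth_proj B v) \<bullet> s = 0" "(v - orth_proj A v) \<bullet> s = 0"
    using orth_proj(2) assms s by blast+
  then show "(orth_proj B v - orth_proj A v) \<bullet> s = 0" by (simp add: inner_diff_left)
qed

lemma orth_proj_eq_0_iff:
  assumes "subspace S" shows "orth_proj S v = 0 \<longleftrightarrow> (\<forall>s\<in>S. v \<bullet> s = 0)"
  using orth_proj_eqI[OF assms subspace_0[OF assms], of v] orth_proj(2)[OF assms, of _ v] by fastforce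

lemma subspace_orth_within:
  assumes "subspace S" shows "subspace {v \<in> S. \<forall>w\<in>T. orthogonal v w}"
  using assms by (auto simp: subspace_def orthogonal_def inner_left_distrib)

text \<open>\<open>trace_on\<close> uses an unspecified orthonormal basis, so the sum is evaluated
  by Parseval in that basis. Asking for the coefficient formula only on S suits maps defined through
  tangent extensions.\<close>

lemma trace_on_frame:
  assumes orth: "e1 \<bullet> e1 = 1" "e1 \<bullet> e2 = 0" "e2 \<bullet> e2 = 1" and S: "S = span {e1, e2}"
    and b: "\<And>x y. x \<in> S \<Longrightarrow> y \<in> S \<Longrightarrow> b x y =
      ((x \<bullet> e1) * (y \<bullet> e1)) *\<^sub>R b11 + ((x \<bullet> e1) * (y \<bullet> e2)) *\<^sub>R b12
      + ((x \<bullet> e2) * (y \<bullet> e1)) *\<^sub>R b21 + ((x \<bullet> e2) * (y \<bullet> e2)) *\<^sub>R b22"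
  shows "trace_on S b = b11 + b22"
proof -
  define B where "B = (SOME B. orthonormal_basis_of S B)"
  have "orthonormal_basis_of S {e1, e2}"
    using orth S by (auto simp: orthonormal_basis_of_def pairwise_def orthogonal_def norm_eq_1 inner_commute)
  then have B: "pairwise orthogonal B" "\<And>e. e \<in> B \<Longrightarrow> norm e = 1" "span B = S"
    unfolding B_def using someI[of "orthonormal_basis_of S"] unfolding orthonormal_basis_of_def by blast+
  have fin: "finite B" using B(1) pairwise_orthogonal_imp_finite by blast
  have BS: "e \<in> S" if "e \<in> B" for e using B(3) span_base that by blast
  have parseval: "(\<Sum>e\<in>B. (e \<bullet> v) * (e \<bullet> w)) = v \<bullet> w" if "v \<in> S" for v w
  proof -
    have "v = (\<Sum>e\<in>B. (v \<bullet> e) *\<^sub>R e)"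
      using orthonormal_basis_expand[OF B(1,2) _ fin, of v] that B(3) by simp
    moreover have "(\<Sum>e\<in>B. (v \<bullet> e) *\<^sub>R e) \<bullet> w = (\<Sum>e\<in>B. (e \<bullet> v) * (e \<bullet> w))"
      by (simp add: inner_sum_left inner_commute[of v])
    ultimately show ?thesis by simp
  qed
  have e: "e1 \<in> S" "e2 \<in> S" using S by (auto intro: span_base)
  have "trace_on S b = (\<Sum>e\<in>B. b e e)" by (simp add: trace_on_def B_def)
  also have "\<dots> = (\<Sum>e\<in>B. ((e \<bullet> e1) * (e \<bullet> e1)) *\<^sub>R b11 + ((e \<bullet> e1) * (e \<bullet> e2)) *\<^sub>R b12
      + ((e \<bullet> e2) * (e \<bullet> e1)) *\<^sub>R b21 + ((e \<bullet> e2) * (e \<bullet> e2)) *\<^sub>R b22)"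
    by (intro sum.cong refl b BS)
  also have "\<dots> = b11 + b22"
    using orth e by (simp add: sum.distrib parseval inner_commute[of e2 e1] flip: scaleR_left.sum)
  finally show ?thesis .
qed

section \<open>Tangent spaces and derivatives\<close>

lemma tangent_curve:
  fixes p :: "'a::euclidean_space"
  assumes p: "p \<in> S" and v: "v \<in> tangent_space (top_of_set S) p"
  obtains \<gamma> T where "\<gamma> 0 = p" "(\<gamma> has_vector_derivative v) (at 0)" "open T" "0 \<in> T" "\<gamma> ` T \<subseteq> S"
proof -
  obtain \<gamma> :: "real \<Rightarrow> 'a" where \<gamma>: "\<gamma> 0 = p" "limitin (top_of_set S) \<gamma> p (at 0)" "(\<gamma> has_vector_derivative v) (at 0)"
    using v by (auto simp: tangent_space_def)
  have "eventually (\<lambda>t. \<gamma> t \<in> S) (at 0)"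
    using \<gamma>(2) by (auto simp: limitin_def)
  then have "eventually (\<lambda>t. \<gamma> t \<in> S) (nhds 0)"
    using \<gamma>(1) p by (auto simp: eventually_at_filter elim: eventually_mono)
  then obtain T where "open T" "0 \<in> T" "\<And>t. t \<in> T \<Longrightarrow> \<gamma> t \<in> S"
    by (auto simp: eventually_nhds)
  then show ?thesis using that[of \<gamma> T] \<gamma> by blast
qed

text \<open>Spheres in affine subspaces cover both the unit sphere and the small hypersphere, which
  is a sphere inside a hyperplane.\<close>

lemma tangent_space_subspace_sphere:
  fixes z p :: "'a::euclidean_space"
  assumes U: "subspace U" and r: "r > 0" and p: "p - z \<in> U" "norm (p - z) = r"
  defines "S \<equiv> {y. y - z \<in> U \<and> norm (y - z) = r}"
  shows "tangent_space (top_of_set S) p = {v \<in> U. v \<bullet> (p - z) = 0}"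
proof (intro set_eqI iffI)
  have pS: "p \<in> S" using p by (simp add: S_def)
  fix v assume "v \<in> tangent_space (top_of_set S) p"
  then obtain \<gamma> T where \<gamma>: "\<gamma> 0 = p" "(\<gamma> has_vector_derivative v) (at 0)"
    and T: "open T" "0 \<in> T" "\<And>t. t \<in> T \<Longrightarrow> \<gamma> t \<in> S"
    by (rule tangent_curve[OF pS]) blast
  have zero: "((\<lambda>t. (\<gamma> t - z) \<bullet> w) has_vector_derivative v \<bullet> w) (at 0)" for w
    using bounded_linear.has_vector_derivative[OF bounded_linear_inner_left has_vector_derivative_diff[OF \<gamma>(2) has_vector_derivative_const[of z]]]
    by simp
  \<comment> \<open>The curve keeps inner product 0 with every w orthogonal to U. Taking for w the
    part of v off U shows that this part vanishes.\<close>
  have "v \<bullet> w = 0" if "\<And>u. u \<in> U \<Longrightarrow> u \<bullet> w = 0" for w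
  proof (rule vector_derivative_unique_at[OF zero])
    show "((\<lambda>t. (\<gamma> t - z) \<bullet> w) has_vector_derivative 0) (at 0)"
      by (rule has_vector_derivative_transform_within_open[OF has_vector_derivative_const T(1,2)])
        (use T(3) that in \<open>auto simp: S_def\<close>)
  qed
  moreover have "s \<bullet> (v - orth_proj U v) = 0" if "s \<in> U" for s
    using orth_proj(2)[OF U that, of v] by (simp only: inner_commute)
  ultimately have "v \<bullet> (v - orth_proj U v) = 0" by blast
  then have "(v - orth_proj U v) \<bullet> (v - orth_proj U v) = 0"
    using orth_proj(2)[OF U orth_proj(1)[OF U, of v], of v] by (simp add: inner_diff_right inner_commute)
  then have "v = orth_proj U v" by (simp only: inner_eq_zero_iff right_minus_eq)
  then have vU: "v \<in> U" using orth_proj(1)[OF U] by metis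
  have "v \<bullet> (p - z) + (p - z) \<bullet> v = 0"
  proof (rule vector_derivative_unique_at)
    have "((\<lambda>t. \<gamma> t - z) has_derivative (\<lambda>h. h *\<^sub>R v)) (at 0)"
      using \<gamma>(2) by (auto simp: has_vector_derivative_def intro!: derivative_eq_intros)
    from has_derivative_inner[OF this this]
    show "((\<lambda>t. (\<gamma> t - z) \<bullet> (\<gamma> t - z)) has_vector_derivative v \<bullet> (p - z) + (p - z) \<bullet> v) (at 0)"
      by (simp add: has_vector_derivative_def \<gamma>(1) algebra_simps)
    show "((\<lambda>t. (\<gamma> t - z) \<bullet> (\<gamma> t - z)) has_vector_derivative 0) (at 0)"
      by (rule has_vector_derivative_transform_within_open[OF has_vector_derivative_const[of "r\<^sup>2"] T(1,2)])
        (use T(3) in \<open>auto simp: S_def simp flip: power2_norm_eq_inner\<close>)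
  qed
  then show "v \<in> {v \<in> U. v \<bullet> (p - z) = 0}" using vU by (simp add: inner_commute)
next
  fix v assume v: "v \<in> {v \<in> U. v \<bullet> (p - z) = 0}"
  \<comment> \<open>The witness curve projects the line p + t v radially onto the sphere. Here s t
    is |p - z + t v| / r, whose derivative at 0 vanishes.\<close>
  define s where "s t = sqrt (1 + t\<^sup>2 * ((norm v)\<^sup>2 / r\<^sup>2))" for t
  define \<gamma> where "\<gamma> t = z + (1 / s t) *\<^sub>R (p - z + t *\<^sub>R v)" for t
  have pos: "1 + t\<^sup>2 * ((norm v)\<^sup>2 / r\<^sup>2) > 0" for t :: real by (simp add: add_pos_nonneg)
  have s: "s t > 0" for t using pos by (simp add: s_def)
  have nrm: "norm (p - z + t *\<^sub>R v) = r * s t" for t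
  proof -
    have "(norm (p - z + t *\<^sub>R v))\<^sup>2 = r\<^sup>2 + t\<^sup>2 * (norm v)\<^sup>2"
      using norm_add_Pythagorean[of "p - z" "t *\<^sub>R v"] v p(2)
      by (simp add: orthogonal_def inner_commute power_mult_distrib)
    also have "\<dots> = (r * s t)\<^sup>2"
      using pos[of t] r by (simp add: s_def power_mult_distrib field_simps)
    finally show ?thesis using r s[of t] by (simp add: power2_eq_iff_nonneg)
  qed
  have S: "\<gamma> t \<in> S" for t
    using nrm[of t] s[of t] v p U
    by (auto simp: S_def \<gamma>_def intro!: subspace_scale subspace_add)
  have 0: "\<gamma> 0 = p" by (simp add: \<gamma>_def s_def)
  have "((\<lambda>t. 1 / s t) has_real_derivative 0) (at 0)"
    unfolding s_def using r by (auto intro!: derivative_eq_intros)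
  moreover have "((\<lambda>t. p - z + t *\<^sub>R v) has_vector_derivative v) (at 0)"
    by (auto intro!: derivative_eq_intros)
  ultimately have "((\<lambda>t. (1 / s t) *\<^sub>R (p - z + t *\<^sub>R v)) has_vector_derivative (1 / s 0) *\<^sub>R v + 0 *\<^sub>R (p - z + 0 *\<^sub>R v)) (at 0)"
    by (rule has_vector_derivative_scaleR)
  from has_vector_derivative_add[OF has_vector_derivative_const[of z] this]
  have "(\<gamma> has_vector_derivative v) (at 0)"
    by (simp add: \<gamma>_def[abs_def] s_def)
  moreover have "limitin (top_of_set S) \<gamma> p (at 0)"
  proof -
    have "(\<gamma> \<longlongrightarrow> p) (at 0)"
      using has_vector_derivative_continuous[OF calculation] 0 by (simp add: continuous_at)
    then show ?thesis
      using S S[of 0] 0 by (simp add: limitin_subtopology limitin_canonical_iff)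
  qed
  ultimately show "v \<in> tangent_space (top_of_set S) p" using 0 unfolding tangent_space_def by blast
qed

section \<open>Limits, derivatives and tangent vectors of an immersed surface read in a
  parametrization\<close>

locale surface_patch =
  fixes M :: "'a::euclidean_space topology" and V :: "'b::euclidean_space set" and u :: "'b \<Rightarrow> 'a"
  assumes param: "local_parametrization M V u"
begin

lemma V: "open V" and smooth_on_V: "smooth_on V u" and openin_image: "openin M (u ` V)"
  and inj_D: "a \<in> V \<Longrightarrow> inj (frechet_derivative u (at a))"
  and homeo: "homeomorphic_map (top_of_set V) (subtopology M (u ` V)) u"
  using param by (auto simp: local_parametrization_def)

lemma inj_on_u: "inj_on u V"
  using homeomorphic_imp_injective_map[OF homeo] by simp

lemma in_topspace: "a \<in> V \<Longrightarrow> u a \<in> topspace M"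
  using openin_subset[OF openin_image] by auto

abbreviation "L a \<equiv> frechet_derivative u (at a)"

lemma u_deriv: "a \<in> V \<Longrightarrow> (u has_derivative L a) (at a)"
  by (rule smooth_on_has_derivative[OF V smooth_on_V])

lemma linear_L: "a \<in> V \<Longrightarrow> linear (L a)"
  by (rule frechet_derivative_linear[OF V _ smooth_on_V])

lemma openin_preimage: assumes "openin M U" shows "open {b \<in> V. u b \<in> U}"
proof -
  have "openin (subtopology M (u ` V)) (U \<inter> u ` V)"
    using assms by (auto simp: openin_subtopology)
  then have "openin (top_of_set V) {b \<in> topspace (top_of_set V). u b \<in> U \<inter> u ` V}"
    by (rule openin_continuous_map_preimage[OF homeomorphic_imp_continuous_map[OF homeo]])
  moreover have "{b \<in> topspace (top_of_set V). u b \<in> U \<inter> u ` V} = {b \<in> V. u b \<in> U}" by auto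
  ultimately show ?thesis using V openin_open_trans by metis
qed

lemma openin_image_open: assumes "open S" "S \<subseteq> V" shows "openin M (u ` S)"
proof -
  have "openin (top_of_set V) S" using assms V by (simp add: open_subset)
  then have "openin (subtopology M (u ` V)) (u ` S)"
    using homeomorphic_imp_open_map[OF homeo] by (auto simp: open_map_def)
  then show ?thesis using openin_image openin_trans_full by blast
qed

text \<open>A parametrization is a homeomorphism onto an open part of M, so punctured neighbourhoods
  correspond. Limits along M thus move to the parameter domain, even if the topology of M is finer
  than the induced one.\<close>

lemma atin_eq: assumes a: "a \<in> V" shows "atin M (u a) = filtermap u (at a)"
proof (rule filter_eqI)
  fix P :: "'a \<Rightarrow> bool"
  have "eventually P (atin M (u a)) \<longleftrightarrow> (\<exists>U. openin M U \<and> u a \<in> U \<and> (\<forall>x\<in>U - {u a}. P x))"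
    using in_topspace[OF a] by (simp add: eventually_atin)
  also have "\<dots> \<longleftrightarrow> (\<exists>S. open S \<and> a \<in> S \<and> (\<forall>b\<in>S. b \<noteq> a \<longrightarrow> P (u b)))"
  proof
    assume "\<exists>U. openin M U \<and> u a \<in> U \<and> (\<forall>x\<in>U - {u a}. P x)"
    then obtain U where U: "openin M U" "u a \<in> U" "\<And>x. x \<in> U - {u a} \<Longrightarrow> P x" by auto
    show "\<exists>S. open S \<and> a \<in> S \<and> (\<forall>b\<in>S. b \<noteq> a \<longrightarrow> P (u b))"
      using openin_preimage[OF U(1)] U(2,3) a inj_on_u
      by (intro exI[of _ "{b \<in> V. u b \<in> U}"]) (auto simp: inj_on_def)
  next
    assume "\<exists>S. open S \<and> a \<in> S \<and> (\<forall>b\<in>S. b \<noteq> a \<longrightarrow> P (u b))"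
    then obtain S where S: "open S" "a \<in> S" "\<And>b. b \<in> S \<Longrightarrow> b \<noteq> a \<Longrightarrow> P (u b)" by auto
    show "\<exists>U. openin M U \<and> u a \<in> U \<and> (\<forall>x\<in>U - {u a}. P x)"
      using openin_image_open[of "S \<inter> V"] S a V by (intro exI[of _ "u ` (S \<inter> V)"]) auto
  qed
  finally show "eventually P (atin M (u a)) \<longleftrightarrow> eventually P (filtermap u (at a))"
    by (simp add: eventually_filtermap eventually_at_topological)
qed

lemma has_derivative_atin_iff:
  assumes a: "a \<in> V"
  shows "(X has_derivative g) (atin M (u a)) \<longleftrightarrow> bounded_linear g \<and>
    ((\<lambda>b. (X (u b) - X (u a) - g (u b - u a)) /\<^sub>R norm (u b - u a)) \<longlongrightarrow> 0) (at a)"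
proof -
  have "(u \<longlongrightarrow> u a) (at a)"
    using has_derivative_continuous[OF u_deriv[OF a]] by (simp add: continuous_at)
  then have "((\<lambda>x. x) \<longlongrightarrow> u a) (atin M (u a))"
    by (simp add: atin_eq[OF a] filterlim_filtermap)
  \<comment> \<open>For a general filter, \<open>has_derivative\<close> takes the limit of the
    identity as base point, which must be recognised as \<open>u a\<close>.\<close>
  then have "Lim (atin M (u a)) (\<lambda>x. x) = u a"
    by (intro tendsto_Lim) (simp_all add: atin_eq[OF a] filtermap_bot_iff)
  then show ?thesis by (simp add: has_derivative_def atin_eq[OF a] filterlim_filtermap)
qed

text \<open>An injective \<open>L a\<close> is bounded below, and near a the linearization error is
  at most half of that bound. Quotients by the two norms become interchangeable.\<close>

lemma norm_u_diff:
  assumes a: "a \<in> V"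
  obtains B C where "B > 0" "C > 0" "eventually (\<lambda>b. B * norm (b - a) \<le> norm (u b - u a) \<and> norm (u b - u a) \<le> C * norm (b - a)) (at a)"
proof -
  obtain B where B: "B > 0" "\<And>x. B * norm x \<le> norm (L a x)"
    using linear_inj_bounded_below_pos[OF linear_L[OF a] inj_D[OF a]] by blast
  obtain K where K: "K > 0" "\<And>x. norm (L a x) \<le> norm x * K"
    using bounded_linear.pos_bounded[OF has_derivative_bounded_linear[OF u_deriv[OF a]]] by blast
  have "((\<lambda>b. norm (u b - u a - L a (b - a)) / norm (b - a)) \<longlongrightarrow> 0) (at a)"
    using u_deriv[OF a] by (simp add: has_derivative_iff_norm)
  then have "eventually (\<lambda>b. norm (u b - u a - L a (b - a)) / norm (b - a) < B / 2) (at a)"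
    using B(1) by (intro order_tendstoD) auto
  then have "eventually (\<lambda>b. norm (u b - u a - L a (b - a)) \<le> B / 2 * norm (b - a)) (at a)"
    by eventually_elim (auto simp: divide_simps linear_0[OF linear_L[OF a]] split: if_splits)
  then have "eventually (\<lambda>b. B / 2 * norm (b - a) \<le> norm (u b - u a) \<and> norm (u b - u a) \<le> (K + B / 2) * norm (b - a)) (at a)"
  proof eventually_elim
    case (elim b)
    have "norm (L a (b - a)) \<le> norm (u b - u a) + norm (u b - u a - L a (b - a))"
      using norm_triangle_ineq4[of "u b - u a" "u b - u a - L a (b - a)"] by simp
    moreover have "norm (u b - u a) \<le> norm (L a (b - a)) + norm (u b - u a - L a (b - a))"
      using norm_triangle_ineq[of "L a (b - a)" "u b - u a - L a (b - a)"] by simp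
    ultimately show ?case using B(2)[of "b - a"] K(2)[of "b - a"] elim by (simp add: algebra_simps)
  qed
  then show ?thesis using B(1) K(1) that[of "B / 2" "K + B / 2"] by simp
qed

lemma has_derivative_atin:
  fixes X :: "'a \<Rightarrow> 'c::real_normed_vector"
  assumes a: "a \<in> V" and X: "((\<lambda>b. X (u b)) has_derivative d) (at a)"
    and g: "bounded_linear g" and gd: "\<And>v. g (L a v) = d v"
  shows "(X has_derivative g) (atin M (u a))"
  unfolding has_derivative_atin_iff[OF a]
proof
  show "bounded_linear g" by fact
  interpret g: bounded_linear g by fact
  obtain B C where BC: "B > 0" "C > 0" "eventually (\<lambda>b. B * norm (b - a) \<le> norm (u b - u a) \<and> norm (u b - u a) \<le> C * norm (b - a)) (at a)"
    by (rule norm_u_diff[OF a])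
  \<comment> \<open>After multiplication by norm (b - a) the linear terms cancel, because g after
    \<open>L a\<close> is d. What remains is the numerator of the required quotient.\<close>
  let ?R = "\<lambda>b. (X (u b) - X (u a) - d (b - a)) /\<^sub>R norm (b - a) - g ((u b - u a - L a (b - a)) /\<^sub>R norm (b - a))"
  have "((\<lambda>b. ?R b) \<longlongrightarrow> 0 - g 0) (at a)"
    using X u_deriv[OF a] by (intro tendsto_diff g.tendsto) (simp_all add: has_derivative_at_within)
  then have R: "((\<lambda>b. norm (?R b) * (1 / B)) \<longlongrightarrow> 0 * (1 / B)) (at a)"
    by (intro tendsto_mult tendsto_const) (simp add: g.zero tendsto_norm_zero)
  have "eventually (\<lambda>b. b \<noteq> a) (at a)" by (simp add: eventually_at_filter)
  with BC(3) have "eventually (\<lambda>b. norm ((X (u b) - X (u a) - g (u b - u a)) /\<^sub>R norm (u b - u a)) \<le> norm (?R b) * (1 / B)) (at a)"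
  proof eventually_elim
    case (elim b)
    have "n *\<^sub>R (p /\<^sub>R n - g (w /\<^sub>R n)) = p - g w" if "n \<noteq> 0" for n p w
      using that by (simp add: g.scaleR scaleR_diff_right)
    then have "norm (b - a) *\<^sub>R ?R b = X (u b) - X (u a) - d (b - a) - g (u b - u a - L a (b - a))"
      using elim by simp
    also have "\<dots> = X (u b) - X (u a) - g (u b - u a)" by (simp add: g.diff gd)
    finally have "X (u b) - X (u a) - g (u b - u a) = norm (b - a) *\<^sub>R ?R b" by (rule sym)
    then have "norm (X (u b) - X (u a) - g (u b - u a)) = norm (b - a) * norm (?R b)"
      by (simp only: norm_scaleR abs_norm_cancel)
    moreover have "norm (b - a) \<le> norm (u b - u a) * (1 / B)" using elim BC(1) by (simp add: field_simps)
    ultimately have le: "norm (X (u b) - X (u a) - g (u b - u a)) \<le> norm (u b - u a) * (1 / B) * norm (?R b)"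
      by (simp only: mult_right_mono[OF _ norm_ge_zero])
    have "B * norm (b - a) > 0" using elim BC(1) by simp
    then have pos: "norm (u b - u a) > 0" using elim by linarith
    have "norm (x /\<^sub>R N) \<le> R * (1 / B)" if "norm x \<le> N * (1 / B) * R" "N > 0" for x :: 'c and N R
      using that by (simp add: field_simps)
    from this[OF le pos] show ?case .
  qed
  then show "((\<lambda>b. (X (u b) - X (u a) - g (u b - u a)) /\<^sub>R norm (u b - u a)) \<longlongrightarrow> 0) (at a)"
    by (rule Lim_null_comparison) (use R in \<open>simp only: mult_zero_left\<close>)
qed

text \<open>The chain rule for X after u. It determines a derivative along M on tangent vectors
  only.\<close>

lemma has_derivative_atin_unique:
  fixes X :: "'a \<Rightarrow> 'c::real_normed_vector"
  assumes a: "a \<in> V" and X: "((\<lambda>b. X (u b)) has_derivative d) (at a)"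
    and g: "(X has_derivative g) (atin M (u a))"
  shows "g (L a v) = d v"
proof -
  have bl: "bounded_linear g" using g by (simp add: has_derivative_def)
  interpret g: bounded_linear g by fact
  obtain B C where BC: "B > 0" "C > 0" "eventually (\<lambda>b. B * norm (b - a) \<le> norm (u b - u a) \<and> norm (u b - u a) \<le> C * norm (b - a)) (at a)"
    by (rule norm_u_diff[OF a])
  let ?Q = "\<lambda>b. (X (u b) - X (u a) - g (u b - u a)) /\<^sub>R norm (u b - u a)"
  let ?R = "\<lambda>b. (u b - u a - L a (b - a)) /\<^sub>R norm (b - a)"
  have Q: "(?Q \<longlongrightarrow> 0) (at a)" using g by (simp add: has_derivative_atin_iff[OF a])
  have "((\<lambda>b. g (?R b)) \<longlongrightarrow> g 0) (at a)"
    using u_deriv[OF a] by (intro g.tendsto) (simp_all add: has_derivative_at_within)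
  then have lim: "((\<lambda>b. norm (?Q b) * C + norm (g (?R b))) \<longlongrightarrow> 0 * C + 0) (at a)"
    by (intro tendsto_add tendsto_mult tendsto_const tendsto_norm_zero[OF Q] tendsto_norm_zero)
      (simp only: g.zero)
  have "eventually (\<lambda>b. b \<noteq> a) (at a)" by (simp add: eventually_at_filter)
  with BC(3) have "eventually (\<lambda>b. norm ((X (u b) - X (u a) - g (L a (b - a))) /\<^sub>R norm (b - a)) \<le> norm (?Q b) * C + norm (g (?R b))) (at a)"
  proof eventually_elim
    case (elim b)
    have "B * norm (b - a) > 0" using elim BC(1) by simp
    then have pos: "norm (u b - u a) > 0" using elim by linarith
    have "(X (u b) - X (u a) - g (L a (b - a))) /\<^sub>R norm (b - a) = (norm (u b - u a) / norm (b - a)) *\<^sub>R ?Q b + g (?R b)"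
    proof -
      have "(q + g w) /\<^sub>R n = (m / n) *\<^sub>R (q /\<^sub>R m) + g (w /\<^sub>R n)" if "m \<noteq> 0" for q w and m n :: real
        using that by (simp add: g.scaleR scaleR_add_right divide_inverse mult.commute)
      moreover have "X (u b) - X (u a) - g (L a (b - a)) = X (u b) - X (u a) - g (u b - u a) + g (u b - u a - L a (b - a))"
        by (simp add: g.diff)
      ultimately show ?thesis using pos by (metis less_irrefl)
    qed
    then have "norm ((X (u b) - X (u a) - g (L a (b - a))) /\<^sub>R norm (b - a)) \<le> (norm (u b - u a) / norm (b - a)) * norm (?Q b) + norm (g (?R b))"
      using norm_triangle_ineq[of "(norm (u b - u a) / norm (b - a)) *\<^sub>R ?Q b" "g (?R b)"] by simp
    moreover have "(norm (u b - u a) / norm (b - a)) * norm (?Q b) \<le> C * norm (?Q b)"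
      using elim by (intro mult_right_mono) (auto simp: divide_le_eq)
    ultimately show ?case by (simp add: mult.commute)
  qed
  then have "((\<lambda>b. (X (u b) - X (u a) - g (L a (b - a))) /\<^sub>R norm (b - a)) \<longlongrightarrow> 0) (at a)"
    by (rule Lim_null_comparison) (use lim in \<open>simp only: mult_zero_left add_0_left\<close>)
  then have "((\<lambda>b. X (u b)) has_derivative (\<lambda>v. g (L a v))) (at a)"
    using bounded_linear_compose[OF bl has_derivative_bounded_linear[OF u_deriv[OF a]]]
    by (simp add: has_derivative_at_within)
  then show ?thesis using has_derivative_unique[OF X] by metis
qed

text \<open>A left inverse k of \<open>L a\<close> yields d after k as one derivative along M.
  \<open>frechet_derivative\<close> may select another one, but all of them agree on tangent
  vectors.\<close>

lemma deriv_along_eq: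
  assumes a: "a \<in> V" and X: "((\<lambda>b. X (u b)) has_derivative d) (at a)"
  shows "deriv_along M X (u a) (L a v) = d v"
proof -
  obtain k where k: "linear k" "k \<circ> L a = id"
    using linear_injective_left_inverse[OF linear_L[OF a] inj_D[OF a]] by blast
  have "k (L a v) = v" for v using k(2) by (simp add: fun_eq_iff)
  then have "(X has_derivative (\<lambda>w. d (k w))) (atin M (u a))"
    using k(1) has_derivative_bounded_linear[OF X]
    by (intro has_derivative_atin[OF a X] bounded_linear_compose[of d k]) (auto simp: linear_conv_bounded_linear)
  then have "(X has_derivative frechet_derivative X (atin M (u a))) (atin M (u a))"
    using frechet_derivative_works by (auto simp: differentiable_def)
  then show ?thesis unfolding deriv_along_def by (rule has_derivative_atin_unique[OF a X])
qed

text \<open>Curves in M are not lifted. Instead, the projection off the range of \<open>L a\<close>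
  has derivative 0 along M, so on a curve it is small compared with the displacement; dividing by t
  shows that the velocity lies in the range.\<close>

lemma tangent_space_eq: assumes a: "a \<in> V" shows "tangent_space M (u a) = range (L a)"
proof (intro set_eqI iffI)
  fix v assume "v \<in> range (L a)"
  then obtain w where w: "v = L a w" by auto
  define \<gamma> where "\<gamma> t = u (a + t *\<^sub>R w)" for t :: real
  have lim: "((\<lambda>t. a + t *\<^sub>R w) \<longlongrightarrow> a + 0 *\<^sub>R w) (at 0)" by (intro tendsto_intros)
  have "limitin M \<gamma> (u a) (at 0)"
    unfolding limitin_def
  proof (intro conjI allI impI in_topspace a)
    fix U assume U: "openin M U \<and> u a \<in> U"
    then have "eventually (\<lambda>t. a + t *\<^sub>R w \<in> {b \<in> V. u b \<in> U}) (at 0)"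
      using openin_preimage[of U] a lim by (intro topological_tendstoD[OF lim]) auto
    then show "eventually (\<lambda>t. \<gamma> t \<in> U) (at 0)" by eventually_elim (auto simp: \<gamma>_def)
  qed
  moreover have "(\<gamma> has_vector_derivative v) (at 0)"
  proof -
    have "(\<gamma> has_derivative (\<lambda>h. L a (h *\<^sub>R w))) (at 0)"
      unfolding \<gamma>_def
      by (rule has_derivative_compose[of "\<lambda>t. a + t *\<^sub>R w", where g=u])
        (auto intro!: derivative_eq_intros u_deriv a)
    then show ?thesis by (simp add: has_vector_derivative_def w linear_cmul[OF linear_L[OF a]])
  qed
  moreover have "\<gamma> 0 = u a" by (simp add: \<gamma>_def)
  ultimately show "v \<in> tangent_space M (u a)" unfolding tangent_space_def by blast
next
  fix v assume "v \<in> tangent_space M (u a)"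
  then obtain \<gamma> :: "real \<Rightarrow> 'a" where \<gamma>: "\<gamma> 0 = u a" "limitin M \<gamma> (u a) (at 0)" "(\<gamma> has_vector_derivative v) (at 0)"
    by (auto simp: tangent_space_def)
  let ?T = "range (L a)"
  have sub: "subspace ?T" using linear_L[OF a] linear_subspace_image subspace_UNIV by blast
  let ?p = "\<lambda>w. w - orth_proj ?T w"
  have blp: "bounded_linear ?p"
    using linear_orth_proj[OF sub] by (intro bounded_linear_sub bounded_linear_ident) (simp add: linear_conv_bounded_linear)
  have p0: "?p (L a w) = 0" for w
    using orth_proj_eqI[OF sub, of "L a w" "L a w"] by simp
  have "((\<lambda>b. ?p (u b)) has_derivative (\<lambda>v. ?p (L a v))) (at a)"
    by (rule bounded_linear.has_derivative[OF blp u_deriv[OF a]])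
  then have "(?p has_derivative (\<lambda>w. 0)) (atin M (u a))"
    by (intro has_derivative_atin[OF a]) (auto simp: p0)
  then have lim0: "((\<lambda>b. (?p (u b) - ?p (u a)) /\<^sub>R norm (u b - u a)) \<longlongrightarrow> 0) (at a)"
    using has_derivative_atin_iff[OF a, of ?p "\<lambda>w. 0"] by simp
  have small: "eventually (\<lambda>t. norm (?p (\<gamma> t - \<gamma> 0)) \<le> e * norm (\<gamma> t - \<gamma> 0)) (at 0)" if "e > 0" for e
  proof -
    have "eventually (\<lambda>b. norm ((?p (u b) - ?p (u a)) /\<^sub>R norm (u b - u a)) < e) (at a)"
      using tendstoD[OF lim0 that] by (simp only: dist_norm diff_zero)
    then have "eventually (\<lambda>q. norm ((?p q - ?p (u a)) /\<^sub>R norm (q - u a)) < e) (atin M (u a))"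
      by (simp only: atin_eq[OF a] eventually_filtermap)
    then obtain U where U: "openin M U" "u a \<in> U"
      "\<And>q. q \<in> U \<Longrightarrow> q \<noteq> u a \<Longrightarrow> norm ((?p q - ?p (u a)) /\<^sub>R norm (q - u a)) < e"
      using in_topspace[OF a] by (auto simp: eventually_atin)
    have "eventually (\<lambda>t. \<gamma> t \<in> U) (at 0)" using \<gamma>(2) U by (auto simp: limitin_def)
    then show ?thesis
    proof eventually_elim
      case (elim t)
      show ?case
      proof (cases "\<gamma> t = u a")
        case True
        then show ?thesis using orth_proj_eqI[OF sub subspace_0[OF sub], of 0] \<gamma>(1) by simp
      next
        case False
        have "norm (?p (\<gamma> t) - ?p (u a)) \<le> e * norm (\<gamma> t - u a)"
        proof -
          have "norm A \<le> e * n" if "norm (A /\<^sub>R n) < e" "n > 0" for A :: 'a and n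
            using that by (simp add: field_simps)
          moreover have "norm (\<gamma> t - u a) > 0" using False by simp
          ultimately show ?thesis using U(3)[OF elim False] by blast
        qed
        moreover have "?p (\<gamma> t - \<gamma> 0) = ?p (\<gamma> t) - ?p (u a)"
          using linear_diff[OF bounded_linear.linear[OF blp], of "\<gamma> t" "\<gamma> 0"] by (simp only: \<gamma>(1))
        ultimately show ?thesis by (simp only: \<gamma>(1))
      qed
    qed
  qed
  have "((\<lambda>t. (\<gamma> t - \<gamma> 0 - t *\<^sub>R v) /\<^sub>R norm t) \<longlongrightarrow> 0) (at 0)"
    using \<gamma>(3) by (simp add: has_vector_derivative_def has_derivative_at_within)
  then have g0: "((\<lambda>t. norm ((\<gamma> t - \<gamma> 0 - t *\<^sub>R v) /\<^sub>R norm t)) \<longlongrightarrow> 0) (at 0)"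
    by (rule tendsto_norm_zero)
  have gl: "((\<lambda>t. (\<gamma> t - \<gamma> 0) /\<^sub>R t) \<longlongrightarrow> v) (at 0)"
  proof -
    have eq: "norm ((\<gamma> t - \<gamma> 0 - t *\<^sub>R v) /\<^sub>R norm t) = norm ((\<gamma> t - \<gamma> 0) /\<^sub>R t - v)" if "t \<noteq> 0" for t
    proof -
      have "(\<gamma> t - \<gamma> 0) /\<^sub>R t - v = (\<gamma> t - \<gamma> 0 - t *\<^sub>R v) /\<^sub>R t"
        using that by (simp add: scaleR_diff_right)
      then show ?thesis by simp
    qed
    have "eventually (\<lambda>t. norm ((\<gamma> t - \<gamma> 0 - t *\<^sub>R v) /\<^sub>R norm t) = norm ((\<gamma> t - \<gamma> 0) /\<^sub>R t - v)) (at 0)"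
      by (rule eventually_mono[OF eventually_neq_at_within[of 0]]) (rule eq)
    from Lim_transform_eventually[OF g0 this]
    have "((\<lambda>t. (\<gamma> t - \<gamma> 0) /\<^sub>R t - v) \<longlongrightarrow> 0) (at 0)"
      by (rule tendsto_norm_zero_cancel)
    then show ?thesis by (rule LIM_zero_cancel)
  qed
  have pl: "((\<lambda>t. norm (?p ((\<gamma> t - \<gamma> 0) /\<^sub>R t))) \<longlongrightarrow> norm (?p v)) (at 0)"
    by (intro tendsto_norm bounded_linear.tendsto[OF blp] gl)
  have "norm (?p v) \<le> e * norm v" if e: "e > 0" for e
  proof (rule tendsto_le[OF _ _ pl])
    show "((\<lambda>t. e * norm ((\<gamma> t - \<gamma> 0) /\<^sub>R t)) \<longlongrightarrow> e * norm v) (at 0)"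
      by (intro tendsto_intros gl)
    show "eventually (\<lambda>t. norm (?p ((\<gamma> t - \<gamma> 0) /\<^sub>R t)) \<le> e * norm ((\<gamma> t - \<gamma> 0) /\<^sub>R t)) (at 0)"
      using small[OF e]
    proof eventually_elim
      case (elim t)
      have "?p ((\<gamma> t - \<gamma> 0) /\<^sub>R t) = ?p (\<gamma> t - \<gamma> 0) /\<^sub>R t"
        by (rule linear_cmul[OF bounded_linear.linear[OF blp]])
      then have "norm (?p ((\<gamma> t - \<gamma> 0) /\<^sub>R t)) = norm (?p (\<gamma> t - \<gamma> 0)) / \<bar>t\<bar>"
        by (simp add: divide_inverse mult.commute)
      moreover have "e * norm ((\<gamma> t - \<gamma> 0) /\<^sub>R t) = e * norm (\<gamma> t - \<gamma> 0) / \<bar>t\<bar>"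
        by (simp add: divide_inverse mult.commute)
      ultimately show ?case using divide_right_mono[OF elim abs_ge_zero[of t]] by (simp only:)
    qed
  qed simp
  then have "norm (?p v) \<le> 0 + e" if "e > 0" for e
  proof -
    \<comment> \<open>The divisor absorbs the factor norm v and stays positive for v = 0.\<close>
    have "norm (?p v) \<le> e / (norm v + 1) * norm v"
      using that by (intro \<open>\<And>e. e > 0 \<Longrightarrow> norm (?p v) \<le> e * norm v\<close>) (simp add: add_nonneg_pos)
    also have "\<dots> \<le> 0 + e"
      using that by (simp add: divide_simps add_nonneg_pos mult_left_mono)
    finally show ?thesis .
  qed
  then have "norm (?p v) = 0" using field_le_epsilon[of "norm (?p v)" 0] by simp
  then have "v = orth_proj ?T v" by simp
  then show "v \<in> ?T" using orth_proj(1)[OF sub] by metis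
qed

end


section \<open>The unit sphere\<close>

lemma tangent_space_unit_sphere:
  fixes p :: "'a::euclidean_space"
  assumes "norm p = 1"
  shows "tangent_space (top_of_set (sphere 0 1)) p = {v. v \<bullet> p = 0}"
proof -
  have "sphere 0 1 = {y :: 'a. y - 0 \<in> UNIV \<and> norm (y - 0) = 1}" by auto
  then show ?thesis
    using tangent_space_subspace_sphere[of UNIV 1 p 0] assms by simp
qed

lemma subspace_orth: "subspace {v. v \<bullet> p = 0}"
  by (auto simp: subspace_def inner_left_distrib)

lemma orth_proj_unit_orth:
  assumes "norm p = 1"
  shows "orth_proj {v. v \<bullet> p = 0} w = w - (w \<bullet> p) *\<^sub>R p"
  using assms by (intro orth_proj_eqI subspace_orth)
    (auto simp: inner_diff_left inner_diff_right norm_eq_1 inner_commute)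

text \<open>\<open>X\<close> agrees with the ambient formula \<open>Y\<close> only on the sphere.
  Derivatives within the sphere are not unique as linear maps, but each one gives the derivative of
  X along a curve with velocity x.\<close>

lemma deriv_along_sphere:
  fixes p :: "'a::euclidean_space"
  assumes p: "norm p = 1" and x: "x \<bullet> p = 0" and L: "(Y has_derivative L) (at p)"
    and XY: "\<And>q. norm q = 1 \<Longrightarrow> X q = Y q"
  shows "deriv_along (top_of_set (sphere 0 1)) X p x = L x"
proof -
  let ?S = "sphere 0 1 :: 'a set"
  have pS: "p \<in> ?S" using p by simp
  have at: "atin (top_of_set ?S) p = at p within ?S"
  proof (rule filter_eqI)
    show "eventually P (atin (top_of_set ?S) p) \<longleftrightarrow> eventually P (at p within ?S)" for P
      unfolding atin_subtopology_within[OF pS] eventually_atin_within eventually_at_topological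
      by (auto simp flip: open_openin)
  qed
  have "(X has_derivative L) (at p within ?S)"
    by (rule has_derivative_transform_within[OF has_derivative_at_withinI[OF L] zero_less_one pS])
      (simp add: XY)
  then have X': "(X has_derivative frechet_derivative X (at p within ?S)) (at p within ?S)"
    using frechet_derivative_works by (auto simp: differentiable_def)
  have "x \<in> tangent_space (top_of_set ?S) p" using x by (simp add: tangent_space_unit_sphere p)
  then obtain \<gamma> T where \<gamma>: "\<gamma> 0 = p" "(\<gamma> has_vector_derivative x) (at 0)"
    and T: "open T" "0 \<in> T" "\<gamma> ` T \<subseteq> ?S"
    using tangent_curve[OF pS] by metis
  have *: "((\<lambda>t. X (\<gamma> t)) has_vector_derivative g x) (at 0)" if g: "(X has_derivative g) (at p within ?S)" for g
  proof -
    have "(\<gamma> has_derivative (\<lambda>h. h *\<^sub>R x)) (at 0 within T)"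
      using \<gamma>(2) has_derivative_at_withinI by (auto simp: has_vector_derivative_def)
    moreover have "(X has_derivative g) (at (\<gamma> 0) within \<gamma> ` T)"
      using has_derivative_subset[OF g T(3)] by (simp only: \<gamma>(1))
    ultimately have "((\<lambda>t. X (\<gamma> t)) has_derivative (\<lambda>h. g (h *\<^sub>R x))) (at 0 within T)"
      by (rule has_derivative_in_compose)
    then have "((\<lambda>t. X (\<gamma> t)) has_derivative (\<lambda>h. g (h *\<^sub>R x))) (at 0)"
      by (simp only: at_within_open[OF T(2,1)])
    moreover have "g (h *\<^sub>R x) = h *\<^sub>R g x" for h
      using has_derivative_linear[OF g] by (simp add: linear_cmul)
    ultimately show ?thesis by (simp only: has_vector_derivative_def)
  qed
  show ?thesis
    unfolding deriv_along_def at
    by (rule vector_derivative_unique_at[OF *[OF X'] *[OF \<open>(X has_derivative L) (at p within ?S)\<close>]])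
qed

lemma tangent_extension_sphere:
  "norm q = 1 \<Longrightarrow> tangent_extension (top_of_set (sphere 0 1)) x q = x - (x \<bullet> q) *\<^sub>R q"
  by (simp add: tangent_extension_def tangent_space_unit_sphere orth_proj_unit_orth)

lemma deriv_along_extension_sphere:
  assumes "norm q = 1" "w \<bullet> q = 0"
  shows "deriv_along (top_of_set (sphere 0 1)) (tangent_extension (top_of_set (sphere 0 1)) z) q w
    = - (z \<bullet> w) *\<^sub>R q - (z \<bullet> q) *\<^sub>R w"
  by (rule deriv_along_sphere[OF assms _ tangent_extension_sphere])
    (auto intro!: derivative_eq_intros)

lemma cov_deriv_extension_sphere:
  assumes "norm q = 1" "w \<bullet> q = 0"
  shows "cov_deriv (top_of_set (sphere 0 1)) (top_of_set (sphere 0 1))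
      (tangent_extension (top_of_set (sphere 0 1)) z) q w = - (z \<bullet> q) *\<^sub>R w"
  unfolding cov_deriv_def deriv_along_extension_sphere[OF assms]
  using assms by (simp add: tangent_space_unit_sphere orth_proj_unit_orth inner_diff_left norm_eq_1)

text \<open>The inner covariant derivative at q carries the coefficient z . q, which is 0 at p. Only
  the derivative of this coefficient contributes, which gives constant curvature 1.\<close>

lemma curvature_sphere:
  assumes p: "norm p = 1" and x: "x \<bullet> p = 0" and y: "y \<bullet> p = 0" and z: "z \<bullet> p = 0"
  shows "curvature (top_of_set (sphere 0 1)) p x y z = (z \<bullet> y) *\<^sub>R x - (z \<bullet> x) *\<^sub>R y"
proof -
  let ?S = "top_of_set (sphere 0 1)"
  let ?X = "tangent_extension ?S"
  have ext: "?X v p = v" if "v \<bullet> p = 0" for v using tangent_extension_sphere[OF p] that by simp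
  have cov2: "cov_deriv ?S ?S (\<lambda>q. cov_deriv ?S ?S (?X z) q (?X v q)) p w = - (z \<bullet> w) *\<^sub>R v"
    if v: "v \<bullet> p = 0" and w: "w \<bullet> p = 0" for v w
  proof -
    have "deriv_along ?S (\<lambda>q. cov_deriv ?S ?S (?X z) q (?X v q)) p w
        = - ((z \<bullet> w) *\<^sub>R (v - (v \<bullet> p) *\<^sub>R p)) - (z \<bullet> p) *\<^sub>R (- ((v \<bullet> w) *\<^sub>R p) - (v \<bullet> p) *\<^sub>R w)"
    proof (rule deriv_along_sphere[OF p w])
      show "((\<lambda>q. - ((z \<bullet> q) *\<^sub>R (v - (v \<bullet> q) *\<^sub>R q))) has_derivative
        (\<lambda>w. - ((z \<bullet> w) *\<^sub>R (v - (v \<bullet> p) *\<^sub>R p)) - (z \<bullet> p) *\<^sub>R (- ((v \<bullet> w) *\<^sub>R p) - (v \<bullet> p) *\<^sub>R w))) (at p)"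
        by (rule derivative_eq_intros refl | simp add: algebra_simps)+
      show "cov_deriv ?S ?S (?X z) q (?X v q) = - ((z \<bullet> q) *\<^sub>R (v - (v \<bullet> q) *\<^sub>R q))" if q: "norm q = 1" for q
        using q by (subst cov_deriv_extension_sphere) (auto simp: tangent_extension_sphere inner_diff_left norm_eq_1)
    qed
    then show ?thesis
      using v w z p by (simp add: cov_deriv_def tangent_space_unit_sphere orth_proj_unit_orth inner_diff_left)
  qed
  \<comment> \<open>Both ambient derivatives equal -(x . y) p, so their difference vanishes.\<close>
  have "lie_bracket ?S (?X x) (?X y) p = 0"
    using p x y by (simp add: lie_bracket_def ext deriv_along_extension_sphere inner_commute)
  then show ?thesis
    using cov2[OF y x] cov2[OF x y] cov_deriv_extension_sphere[OF p, of 0 z]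
    by (simp add: curvature_def Let_def ext x y)
qed

section \<open>Frames on a surface\<close>

text \<open>The frame may live on a smaller set W than the parametrization, because a frame along a
  gradient exists only where the gradient is nonzero.\<close>

locale framed_surface = surface_patch M V u + sphere_frame W u c1 c2
  for M :: "'a::euclidean_space topology" and V :: "'b::euclidean_space set" and u :: "'b \<Rightarrow> 'a" and W c1 c2 +
  assumes WV: "W \<subseteq> V"
begin

lemma tangent_space_frame: assumes x: "x \<in> W" shows "tangent_space M (u x) = span {E1 x, E2 x}"
proof -
  have xV: "x \<in> V" using x WV by auto
  have "subspace (range (L x))" using linear_subspace_image[OF linear_L[OF xV] subspace_UNIV] .
  then have "span {E1 x, E2 x} \<subseteq> range (L x)" by (intro span_minimal) (auto simp: dir_deriv_def)
  then show ?thesis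
    unfolding tangent_space_eq[OF xV] by (intro equalityI image_subsetI tangent[OF x])
qed

lemma E_tangent: "x \<in> W \<Longrightarrow> E1 x \<in> tangent_space M (u x)" "x \<in> W \<Longrightarrow> E2 x \<in> tangent_space M (u x)"
  by (simp_all add: tangent_space_frame span_base)

lemma subspace_tangent: "x \<in> W \<Longrightarrow> subspace (tangent_space M (u x))"
  by (simp add: tangent_space_frame)

lemma orth_tangent_iff:
  "x \<in> W \<Longrightarrow> (\<forall>w\<in>tangent_space M (u x). orthogonal v w) \<longleftrightarrow> v \<bullet> E1 x = 0 \<and> v \<bullet> E2 x = 0"
  using orthogonal_to_span[of _ "{E1 x, E2 x}" v] E_tangent[of x]
  by (auto simp: tangent_space_frame simp flip: orthogonal_def)

lemma orth_proj_tangent: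
  assumes x: "x \<in> W"
  shows "orth_proj (tangent_space M (u x)) v = (v \<bullet> E1 x) *\<^sub>R E1 x + (v \<bullet> E2 x) *\<^sub>R E2 x"
proof (rule orth_proj_eqI[OF subspace_tangent[OF x]])
  show "(v \<bullet> E1 x) *\<^sub>R E1 x + (v \<bullet> E2 x) *\<^sub>R E2 x \<in> tangent_space M (u x)"
    by (intro subspace_add subspace_scale subspace_tangent x E_tangent)
  have "\<forall>w\<in>tangent_space M (u x). orthogonal (v - ((v \<bullet> E1 x) *\<^sub>R E1 x + (v \<bullet> E2 x) *\<^sub>R E2 x)) w"
    unfolding orth_tangent_iff[OF x] using E11[OF x] E12[OF x] E12[OF x, THEN inner_swap] E22[OF x]
    by (simp add: inner_diff_left inner_left_distrib)
  then show "(v - ((v \<bullet> E1 x) *\<^sub>R E1 x + (v \<bullet> E2 x) *\<^sub>R E2 x)) \<bullet> s = 0" if "s \<in> tangent_space M (u x)" for s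
    using that by (auto simp: orthogonal_def)
qed

lemma tangent_vector: "x \<in> W \<Longrightarrow> v \<in> tangent_space M (u x) \<Longrightarrow> v = (v \<bullet> E1 x) *\<^sub>R E1 x + (v \<bullet> E2 x) *\<^sub>R E2 x"
  using tangent_expand by (simp only: tangent_space_frame)

lemma extension_frame: "x \<in> W \<Longrightarrow> tangent_extension M y (u x) = (y \<bullet> E1 x) *\<^sub>R E1 x + (y \<bullet> E2 x) *\<^sub>R E2 x"
  by (simp add: tangent_extension_def orth_proj_tangent)

lemma extension_self: "x \<in> W \<Longrightarrow> v \<in> tangent_space M (u x) \<Longrightarrow> tangent_extension M v (u x) = v"
  using extension_frame tangent_vector by metis

lemma deriv_along_frame:
  assumes x: "x \<in> W" and v: "v \<in> tangent_space M (u x)" and Y: "smooth_on W Y" and XY: "\<And>b. b \<in> W \<Longrightarrow> X (u b) = Y b"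
  shows "deriv_along M X (u x) v = (v \<bullet> E1 x) *\<^sub>R D1 Y x + (v \<bullet> E2 x) *\<^sub>R D2 Y x"
proof -
  have xV: "x \<in> V" using x WV by auto
  let ?c = "(v \<bullet> E1 x) *\<^sub>R c1 x + (v \<bullet> E2 x) *\<^sub>R c2 x"
  have "L x ?c = (v \<bullet> E1 x) *\<^sub>R E1 x + (v \<bullet> E2 x) *\<^sub>R E2 x"
    by (simp add: linear_add[OF linear_L[OF xV]] linear_cmul[OF linear_L[OF xV]] dir_deriv_def)
  then have v': "v = L x ?c" using tangent_vector[OF x v] by simp
  have "((\<lambda>b. X (u b)) has_derivative frechet_derivative Y (at x)) (at x)"
    by (rule has_derivative_transform_within_open[OF smooth_on_has_derivative[OF W Y x] W x]) (simp add: XY)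
  from deriv_along_eq[OF xV this, of ?c] have "deriv_along M X (u x) v = frechet_derivative Y (at x) ?c"
    using v' by simp
  then show ?thesis using frechet_derivative_linear[OF W x Y] by (simp add: linear_add linear_cmul dir_deriv_def)
qed

lemma dd_extension:
  assumes x: "x \<in> W"
  shows "dir_deriv c (\<lambda>x. (y \<bullet> E1 x) *\<^sub>R E1 x + (y \<bullet> E2 x) *\<^sub>R E2 x) x
    = (y \<bullet> dir_deriv c E1 x) *\<^sub>R E1 x + (y \<bullet> E1 x) *\<^sub>R dir_deriv c E1 x
      + ((y \<bullet> dir_deriv c E2 x) *\<^sub>R E2 x + (y \<bullet> E2 x) *\<^sub>R dir_deriv c E2 x)"
  by (simp add: dir_deriv_add[OF W x] dir_deriv_scaleR[OF W x] dir_deriv_inner[OF W x] smooth_rules)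

lemma smooth_extension: "smooth_on W (\<lambda>x. (y \<bullet> E1 x) *\<^sub>R E1 x + (y \<bullet> E2 x) *\<^sub>R E2 x)"
  by (intro smooth_rules)

text \<open>Derivatives of the frame coefficients are tangent to M and die under the normal
  projection. N is kept general: the formula serves for the unit sphere and, at the end, for the
  small hypersphere.\<close>

lemma mean_curvature_frame:
  assumes x: "x \<in> W" and N: "subspace (tangent_space N (u x))"
  shows "mean_curvature_vector M N (u x) = orth_proj (normal_space M N (u x)) (D1 E1 x + D2 E2 x) /\<^sub>R 2"
proof -
  let ?\<nu> = "orth_proj (normal_space M N (u x))"
  have sub: "subspace (normal_space M N (u x))"
    unfolding normal_space_def by (rule subspace_orth_within[OF N])
  have lin: "linear ?\<nu>" by (rule linear_orth_proj[OF sub])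
  have nE: "?\<nu> (E1 x) = 0" "?\<nu> (E2 x) = 0"
    using E_tangent[OF x] unfolding orth_proj_eq_0_iff[OF sub]
    by (auto simp: normal_space_def orthogonal_def inner_commute)
  have nested: "?\<nu> (orth_proj (tangent_space N (u x)) v) = ?\<nu> v" for v
    by (rule orth_proj_nested[OF sub N]) (auto simp: normal_space_def)
  have sff: "second_fundamental_form M N (u x) v y =
      ((v \<bullet> E1 x) * (y \<bullet> E1 x)) *\<^sub>R ?\<nu> (D1 E1 x) + ((v \<bullet> E1 x) * (y \<bullet> E2 x)) *\<^sub>R ?\<nu> (D1 E2 x)
      + ((v \<bullet> E2 x) * (y \<bullet> E1 x)) *\<^sub>R ?\<nu> (D2 E1 x) + ((v \<bullet> E2 x) * (y \<bullet> E2 x)) *\<^sub>R ?\<nu> (D2 E2 x)"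
    if v: "v \<in> tangent_space M (u x)" for v y
    unfolding second_fundamental_form_def normal_cov_deriv_def cov_deriv_def nested
    by (subst deriv_along_frame[OF x v smooth_extension extension_frame])
      (simp_all add: dd_extension[OF x] linear_add[OF lin] linear_cmul[OF lin] nE algebra_simps)
  have "trace_on (tangent_space M (u x)) (second_fundamental_form M N (u x)) = ?\<nu> (D1 E1 x) + ?\<nu> (D2 E2 x)"
    by (rule trace_on_frame[OF E11[OF x] E12[OF x] E22[OF x] tangent_space_frame[OF x] sff])
  moreover have "dim (tangent_space M (u x)) = 2"
  proof -
    have ne: "E1 x \<noteq> E2 x" "E1 x \<noteq> 0" "E2 x \<noteq> 0" using E11[OF x] E12[OF x] E22[OF x] by auto
    have "independent {E1 x, E2 x}"
      using ne E12[OF x] by (intro pairwise_orthogonal_independent) (auto simp: pairwise_def orthogonal_def inner_commute)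
    then show ?thesis using ne by (simp add: tangent_space_frame[OF x] dim_eq_card_independent)
  qed
  ultimately show ?thesis by (simp add: mean_curvature_vector_def linear_add[OF lin])
qed

section \<open>Mean curvature vector and biharmonic equation in a frame of a surface in the unit
  sphere\<close>

abbreviation "S \<equiv> top_of_set (sphere 0 1 :: 'a set)"

lemma norm_u: "x \<in> W \<Longrightarrow> norm (u x) = 1" using unit by (simp add: norm_eq_1)

lemma tangent_S: "x \<in> W \<Longrightarrow> tangent_space S (u x) = {v. v \<bullet> u x = 0}"
  by (rule tangent_space_unit_sphere[OF norm_u])

lemma normal_S: "x \<in> W \<Longrightarrow> normal_space M S (u x) = {v. v \<bullet> u x = 0 \<and> v \<bullet> E1 x = 0 \<and> v \<bullet> E2 x = 0}"
  using orth_tangent_iff by (auto simp: normal_space_def tangent_S)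

lemma subspace_normal_S: "x \<in> W \<Longrightarrow> subspace (normal_space M S (u x))"
  unfolding normal_space_def tangent_S by (rule subspace_orth_within[OF subspace_orth])

definition "Hv x = mean_curvature_vector M S (u x)"
definition "fm x = norm (Hv x)"
definition "\<eta>v x = Hv x /\<^sub>R fm x"

lemma Hv_eq:
  assumes x: "x \<in> W"
  shows "Hv x = orth_proj (normal_space M S (u x)) (D1 E1 x + D2 E2 x) /\<^sub>R 2"
  unfolding Hv_def by (rule mean_curvature_frame[OF x]) (simp add: tangent_S x subspace_orth)

text \<open>A formula without \<open>orth_proj\<close>, from which smoothness of H can be read
  off.\<close>

lemma Hv_explicit:
  assumes x: "x \<in> W"
  shows "Hv x = (1/2) *\<^sub>R ((D1 E1 x + D2 E2 x) - ((D1 E1 x + D2 E2 x) \<bullet> u x) *\<^sub>R u x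
     - ((D1 E1 x + D2 E2 x) \<bullet> E1 x) *\<^sub>R E1 x - ((D1 E1 x + D2 E2 x) \<bullet> E2 x) *\<^sub>R E2 x)"
proof -
  note s = E11[OF x] E12[OF x] E12[OF x, THEN inner_swap] E22[OF x] unit[OF x] uE[OF x] uE[OF x, THEN inner_swap]
  have "orth_proj (normal_space M S (u x)) d = d - (d \<bullet> u x) *\<^sub>R u x - (d \<bullet> E1 x) *\<^sub>R E1 x - (d \<bullet> E2 x) *\<^sub>R E2 x" for d
    by (rule orth_proj_eqI[OF subspace_normal_S[OF x]])
      (auto simp: normal_S[OF x] inner_diff_left inner_left_distrib s, auto simp: inner_commute)
  then show ?thesis by (simp add: Hv_eq[OF x])
qed

lemma Hv_orth: assumes x: "x \<in> W" shows "Hv x \<bullet> u x = 0" "Hv x \<bullet> E1 x = 0" "Hv x \<bullet> E2 x = 0"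
  using orth_proj(1)[OF subspace_normal_S[OF x], of "D1 E1 x + D2 E2 x"]
  by (simp_all add: Hv_eq[OF x] normal_S[OF x])

lemma smooth_Hv: "smooth_on W Hv"
  by (rule smooth_on_cong[OF W _ Hv_explicit[symmetric]]) (intro smooth_rules, assumption)

text \<open>Differentiating H . u = 0 leaves the products of H with the frame, which vanish as H is
  normal. So the connection of the sphere acts on H as plain differentiation.\<close>

lemma DHv_u: assumes x: "x \<in> W" shows "D1 Hv x \<bullet> u x = 0" "D2 Hv x \<bullet> u x = 0"
  using dd_inner_const[OF smooth_Hv smooth_u Hv_orth(1) x] Hv_orth[OF x] by simp_all

lemma cov_deriv_H:
  assumes x: "x \<in> W" and v: "v \<in> tangent_space M (u x)"
  shows "cov_deriv M S (mean_curvature_vector M S) (u x) v = (v \<bullet> E1 x) *\<^sub>R D1 Hv x + (v \<bullet> E2 x) *\<^sub>R D2 Hv x"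
  unfolding cov_deriv_def
  by (subst deriv_along_frame[OF x v smooth_Hv])
    (simp_all add: Hv_def tangent_S[OF x] orth_proj_unit_orth[OF norm_u[OF x]] inner_left_distrib DHv_u[OF x])

text \<open>Differentiating the extension of y creates products of y with derivatives of the frame.
  They reappear in the correction term along the covariant derivative of the extension and cancel,
  leaving the form that \<open>trace_on_frame\<close> expects.\<close>

lemma second_cov_deriv_H:
  assumes x: "x \<in> W" and v: "v \<in> tangent_space M (u x)"
  defines "Q \<equiv> orth_proj {v. v \<bullet> u x = 0}"
  shows "second_cov_deriv M S (mean_curvature_vector M S) (u x) v y =
    ((v \<bullet> E1 x) * (y \<bullet> E1 x)) *\<^sub>R Q (D1 (D1 Hv) x - \<alpha> x *\<^sub>R D2 Hv x)
    + ((v \<bullet> E1 x) * (y \<bullet> E2 x)) *\<^sub>R Q (D1 (D2 Hv) x + \<alpha> x *\<^sub>R D1 Hv x)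
    + ((v \<bullet> E2 x) * (y \<bullet> E1 x)) *\<^sub>R Q (D2 (D1 Hv) x - \<beta> x *\<^sub>R D2 Hv x)
    + ((v \<bullet> E2 x) * (y \<bullet> E2 x)) *\<^sub>R Q (D2 (D2 Hv) x + \<beta> x *\<^sub>R D1 Hv x)"
proof -
  let ?H = "mean_curvature_vector M S"
  let ?Y = "tangent_extension M y"
  let ?\<Phi> = "\<lambda>b. (y \<bullet> E1 b) *\<^sub>R D1 Hv b + (y \<bullet> E2 b) *\<^sub>R D2 Hv b"
  note E = E11[OF x] E12[OF x] E12[OF x, THEN inner_swap] E22[OF x]
  have linQ: "linear Q" unfolding Q_def by (rule linear_orth_proj[OF subspace_orth])
  have QD: "Q (D1 Hv x) = D1 Hv x" "Q (D2 Hv x) = D2 Hv x"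
    using DHv_u[OF x] by (simp_all add: Q_def orth_proj_unit_orth[OF norm_u[OF x]])
  have \<Phi>: "cov_deriv M S ?H (u b) (?Y (u b)) = ?\<Phi> b" if b: "b \<in> W" for b
  proof -
    have "?Y (u b) \<in> tangent_space M (u b)"
      unfolding extension_frame[OF b] by (intro subspace_add subspace_scale subspace_tangent b E_tangent)
    from cov_deriv_H[OF b this] show ?thesis
      by (simp add: extension_frame[OF b] inner_left_distrib E11[OF b] E12[OF b] E12[OF b, THEN inner_swap] E22[OF b])
  qed
  have s\<Phi>: "smooth_on W ?\<Phi>" by (intro smooth_rules smooth_Hv)
  have D\<Phi>: "dir_deriv c ?\<Phi> x = (y \<bullet> dir_deriv c E1 x) *\<^sub>R D1 Hv x + (y \<bullet> E1 x) *\<^sub>R dir_deriv c (D1 Hv) x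
      + ((y \<bullet> dir_deriv c E2 x) *\<^sub>R D2 Hv x + (y \<bullet> E2 x) *\<^sub>R dir_deriv c (D2 Hv) x)" for c
    by (simp add: dir_deriv_add[OF W x] dir_deriv_scaleR[OF W x] dir_deriv_inner[OF W x] smooth_rules smooth_Hv)
  have 1: "cov_deriv M S (\<lambda>q. cov_deriv M S ?H q (?Y q)) (u x) v = (v \<bullet> E1 x) *\<^sub>R Q (D1 ?\<Phi> x) + (v \<bullet> E2 x) *\<^sub>R Q (D2 ?\<Phi> x)"
    unfolding cov_deriv_def[of M S "\<lambda>q. cov_deriv M S ?H q (?Y q)"]
    by (subst deriv_along_frame[OF x v s\<Phi> \<Phi>])
      (simp_all add: tangent_S[OF x] linear_add[OF linQ] linear_cmul[OF linQ] flip: Q_def)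
  let ?t = "cov_deriv M M ?Y (u x) v"
  have t: "?t = orth_proj (tangent_space M (u x)) ((v \<bullet> E1 x) *\<^sub>R D1 (\<lambda>x. (y \<bullet> E1 x) *\<^sub>R E1 x + (y \<bullet> E2 x) *\<^sub>R E2 x) x
      + (v \<bullet> E2 x) *\<^sub>R D2 (\<lambda>x. (y \<bullet> E1 x) *\<^sub>R E1 x + (y \<bullet> E2 x) *\<^sub>R E2 x) x)"
    unfolding cov_deriv_def by (subst deriv_along_frame[OF x v smooth_extension extension_frame]) simp_all
  have tE: "?t \<bullet> E1 x = (v \<bullet> E1 x) * (y \<bullet> D1 E1 x - \<alpha> x * (y \<bullet> E2 x)) + (v \<bullet> E2 x) * (y \<bullet> D2 E1 x - \<beta> x * (y \<bullet> E2 x))"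
    "?t \<bullet> E2 x = (v \<bullet> E1 x) * (y \<bullet> D1 E2 x + \<alpha> x * (y \<bullet> E1 x)) + (v \<bullet> E2 x) * (y \<bullet> D2 E2 x + \<beta> x * (y \<bullet> E1 x))"
    unfolding t orth_proj_tangent[OF x] dd_extension[OF x]
    by (simp_all add: inner_left_distrib E frame_derivs[OF x, THEN inner_swap] algebra_simps)
  have "?t \<in> tangent_space M (u x)" unfolding t by (rule orth_proj(1)[OF subspace_tangent[OF x]])
  from cov_deriv_H[OF x this] have 2: "cov_deriv M S ?H (u x) ?t = (?t \<bullet> E1 x) *\<^sub>R D1 Hv x + (?t \<bullet> E2 x) *\<^sub>R D2 Hv x" .
  show ?thesis
    unfolding second_cov_deriv_def Let_def extension_self[OF x v] 1 2 tE D\<Phi>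
    by (simp add: linear_add[OF linQ] linear_diff[OF linQ] linear_cmul[OF linQ] QD algebra_simps)
qed

lemma biharmonic_frame_eq:
  assumes x: "x \<in> W" and bi: "biharmonic_in M S" and v: "v \<bullet> u x = 0"
  shows "v \<bullet> (D1 (D1 Hv) x + D2 (D2 Hv) x - \<alpha> x *\<^sub>R D2 Hv x + \<beta> x *\<^sub>R D1 Hv x) = - 2 * (v \<bullet> Hv x)"
proof -
  let ?Q = "orth_proj {v. v \<bullet> u x = 0}" and ?T = "tangent_space M (u x)"
  have "x \<in> V" using x WV by auto
  then have "rough_laplacian M S (mean_curvature_vector M S) (u x)
      + trace_on ?T (\<lambda>v y. curvature S (u x) v (Hv x) y) = 0"
    using bi in_topspace unfolding biharmonic_in_def Let_def Hv_def by blast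
  moreover have "trace_on ?T (second_cov_deriv M S (mean_curvature_vector M S) (u x))
      = ?Q (D1 (D1 Hv) x - \<alpha> x *\<^sub>R D2 Hv x) + ?Q (D2 (D2 Hv) x + \<beta> x *\<^sub>R D1 Hv x)"
    by (rule trace_on_frame[OF E11[OF x] E12[OF x] E22[OF x] tangent_space_frame[OF x] second_cov_deriv_H[OF x]])
  \<comment> \<open>For a unit tangent vector e, R(e,H)e = (e . H) e - H = -H, since H is normal;
    there are two such directions.\<close>
  moreover have "trace_on ?T (\<lambda>v y. curvature S (u x) v (Hv x) y) = - Hv x + - Hv x"
  proof (rule trace_on_frame[OF E11[OF x] E12[OF x] E22[OF x] tangent_space_frame[OF x]])
    fix v y assume vy: "v \<in> ?T" "y \<in> ?T"
    have v: "v = (v \<bullet> E1 x) *\<^sub>R E1 x + (v \<bullet> E2 x) *\<^sub>R E2 x" and y: "y = (y \<bullet> E1 x) *\<^sub>R E1 x + (y \<bullet> E2 x) *\<^sub>R E2 x"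
      using tangent_vector[OF x] vy by auto
    note uE' = uE[OF x, THEN inner_swap] Hv_orth[OF x, THEN inner_swap]
    have vu: "v \<bullet> u x = 0" by (subst v) (simp add: inner_left_distrib uE')
    have yu: "y \<bullet> u x = 0" by (subst y) (simp add: inner_left_distrib uE')
    have yH: "y \<bullet> Hv x = 0" by (subst y) (simp add: inner_left_distrib uE')
    have yv: "y \<bullet> v = (v \<bullet> E1 x) * (y \<bullet> E1 x) + (v \<bullet> E2 x) * (y \<bullet> E2 x)"
      by (subst v) (simp add: inner_right_distrib)
    show "curvature S (u x) v (Hv x) y = ((v \<bullet> E1 x) * (y \<bullet> E1 x)) *\<^sub>R (- Hv x) + ((v \<bullet> E1 x) * (y \<bullet> E2 x)) *\<^sub>R 0
      + ((v \<bullet> E2 x) * (y \<bullet> E1 x)) *\<^sub>R 0 + ((v \<bullet> E2 x) * (y \<bullet> E2 x)) *\<^sub>R (- Hv x)"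
      unfolding curvature_sphere[OF norm_u[OF x] vu Hv_orth(1)[OF x] yu]
      by (simp add: yH yv algebra_simps)
  qed
  ultimately have "?Q (D1 (D1 Hv) x - \<alpha> x *\<^sub>R D2 Hv x) + ?Q (D2 (D2 Hv) x + \<beta> x *\<^sub>R D1 Hv x) = - Hv x + - Hv x"
    by (simp only: rough_laplacian_def add_eq_0_iff minus_minus)
  then have "v \<bullet> (?Q (D1 (D1 Hv) x - \<alpha> x *\<^sub>R D2 Hv x) + ?Q (D2 (D2 Hv) x + \<beta> x *\<^sub>R D1 Hv x)) = - 2 * (v \<bullet> Hv x)"
    by (simp add: inner_diff_right)
  moreover have "v \<bullet> ?Q w = v \<bullet> w" for w
    using v by (simp add: orth_proj_unit_orth[OF norm_u[OF x]] inner_diff_right)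
  ultimately show ?thesis by (simp add: inner_add_right inner_diff_right)
qed

lemma biharmonic_frame:
  assumes pnmc: "PNMC_in M S" and bi: "biharmonic_in M S"
  shows "biharmonic_frame W u c1 c2 \<eta>v fm"
proof
  have pos: "fm x > 0" if "x \<in> W" for x
    using pnmc in_topspace[of x] WV that
    by (auto simp: PNMC_in_def Let_def fm_def Hv_def mean_curvature_def)
  then have nz: "Hv x \<noteq> 0" if "x \<in> W" for x using that by (auto simp: fm_def)
  show fm: "smooth_on W fm" unfolding fm_def[abs_def] by (rule smooth_on_norm[OF W smooth_Hv nz])
  show \<eta>: "smooth_on W \<eta>v"
    unfolding \<eta>v_def[abs_def] using pos
    by (intro smooth_on_scaleR[OF W] smooth_on_inverse[OF W] fm smooth_Hv) fastforce
  have H: "(\<lambda>x. fm x *\<^sub>R \<eta>v x) = Hv"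
  proof
    show "fm x *\<^sub>R \<eta>v x = Hv x" for x by (cases "Hv x = 0") (simp_all add: \<eta>v_def fm_def)
  qed
  fix x assume x: "x \<in> W"
  show "fm x > 0" by (rule pos[OF x])
  show "\<eta>v x \<bullet> \<eta>v x = 1" using nz[OF x] unfolding norm_eq_1[symmetric] by (simp add: \<eta>v_def fm_def)
  show "\<eta>v x \<bullet> u x = 0" "\<eta>v x \<bullet> E1 x = 0" "\<eta>v x \<bullet> E2 x = 0" using Hv_orth[OF x] by (simp_all add: \<eta>v_def)
  fix v
  show "v \<bullet> (D1 (D1 (\<lambda>x. fm x *\<^sub>R \<eta>v x)) x + D2 (D2 (\<lambda>x. fm x *\<^sub>R \<eta>v x)) x
        - \<alpha> x *\<^sub>R D2 (\<lambda>x. fm x *\<^sub>R \<eta>v x) x + \<beta> x *\<^sub>R D1 (\<lambda>x. fm x *\<^sub>R \<eta>v x) x) = - 2 * fm x * (v \<bullet> \<eta>v x)"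
    if "v \<bullet> u x = 0"
    unfolding H using biharmonic_frame_eq[OF x bi that] pos[OF x] by (simp add: \<eta>v_def)
  assume v: "v \<bullet> u x = 0" "v \<bullet> E1 x = 0" "v \<bullet> E2 x = 0"
  then have vN: "v \<in> normal_space M S (u x)" by (simp add: normal_S[OF x])
  have "v \<bullet> Hv x = (v \<bullet> D1 E1 x + v \<bullet> D2 E2 x) / 2"
    using orth_proj(2)[OF subspace_normal_S[OF x] vN, of "D1 E1 x + D2 E2 x"]
    by (simp add: Hv_eq[OF x] inner_diff_left inner_left_distrib inner_commute[of v])
  then show "v \<bullet> D1 E1 x + v \<bullet> D2 E2 x = 2 * fm x * (v \<bullet> \<eta>v x)"
    using pos[OF x] by (simp add: \<eta>v_def field_simps)
  have D: "v \<bullet> ((w \<bullet> E1 x) *\<^sub>R D1 \<eta>v x + (w \<bullet> E2 x) *\<^sub>R D2 \<eta>v x) = 0" if w: "w \<in> tangent_space M (u x)" for w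
  proof -
    have "x \<in> V" using x WV by auto
    then have "normal_cov_deriv M S (\<lambda>q. mean_curvature_vector M S q /\<^sub>R mean_curvature M S q) (u x) w = 0"
      using pnmc in_topspace w by (auto simp: PNMC_in_def Let_def)
    moreover have "deriv_along M (\<lambda>q. mean_curvature_vector M S q /\<^sub>R mean_curvature M S q) (u x) w
        = (w \<bullet> E1 x) *\<^sub>R D1 \<eta>v x + (w \<bullet> E2 x) *\<^sub>R D2 \<eta>v x"
      by (rule deriv_along_frame[OF x w \<eta>]) (simp add: \<eta>v_def Hv_def fm_def mean_curvature_def)
    moreover have "orth_proj (normal_space M S (u x)) (orth_proj (tangent_space S (u x)) d) = orth_proj (normal_space M S (u x)) d" for d
      by (rule orth_proj_nested[OF subspace_normal_S[OF x]]) (auto simp: tangent_S[OF x] subspace_orth normal_S[OF x])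
    ultimately have "orth_proj (normal_space M S (u x)) ((w \<bullet> E1 x) *\<^sub>R D1 \<eta>v x + (w \<bullet> E2 x) *\<^sub>R D2 \<eta>v x) = 0"
      by (simp add: normal_cov_deriv_def cov_deriv_def)
    then show ?thesis using vN by (simp only: orth_proj_eq_0_iff[OF subspace_normal_S[OF x]] inner_commute[of v]) 
  qed
  show "v \<bullet> D1 \<eta>v x = 0 \<and> v \<bullet> D2 \<eta>v x = 0"
    using D[OF E_tangent(1)[OF x]] D[OF E_tangent(2)[OF x]] E11[OF x] E12[OF x] E12[OF x, THEN inner_swap] E22[OF x] by simp
qed

end


section \<open>Construction of orthonormal frames, adaptation to a gradient, and local
  rigidity\<close>

lemma (in surface_patch) orthonormal_frame:
  fixes i1 i2 :: 'b
  assumes i: "span {i1, i2} = UNIV" "i1 \<noteq> 0" "i2 \<notin> span {i1}" and sph: "topspace M \<subseteq> sphere 0 1"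
  obtains c1 c2 where "framed_surface M V u V c1 c2"
proof -
  define u1 where "u1 x = L x i1" for x
  define u2 where "u2 x = L x i2" for x
  define e1 where "e1 x = (1 / norm (u1 x)) *\<^sub>R u1 x" for x
  define w where "w x = u2 x - (u2 x \<bullet> e1 x) *\<^sub>R e1 x" for x
  \<comment> \<open>Gram-Schmidt for the images of \<open>i1\<close> and \<open>i2\<close>, carried
    out on the parameter side so that the resulting fields induce \<open>e1\<close> and the
    normalized \<open>w\<close>.\<close>
  define c1 where "c1 x = (1 / norm (u1 x)) *\<^sub>R i1" for x
  define c2 where "c2 x = (1 / norm (w x)) *\<^sub>R (i2 - (u2 x \<bullet> e1 x) *\<^sub>R c1 x)" for x
  have sm12: "smooth_on V u1" "smooth_on V u2"
    unfolding u1_def u2_def by (intro smooth_on_frechet_derivative[OF V smooth_on_V])+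
  have u1: "u1 x \<noteq> 0" if "x \<in> V" for x
    using i(2) injD[OF inj_D[OF that], of i1 0] linear_0[OF linear_L[OF that]] by (auto simp: u1_def)
  have n1: "norm (u1 x) \<noteq> 0" if "x \<in> V" for x using u1[OF that] by simp
  have sm_e1: "smooth_on V e1" unfolding e1_def
    by (intro smooth_on_scaleR smooth_on_divide smooth_on_const smooth_on_norm sm12 V u1 n1)
  have sm_c1: "smooth_on V c1" unfolding c1_def
    by (intro smooth_on_scaleR smooth_on_divide smooth_on_const smooth_on_norm sm12 V u1 n1)
  have Lc1: "L x (c1 x) = e1 x" if "x \<in> V" for x
    by (simp add: c1_def e1_def u1_def linear_cmul[OF linear_L[OF that]])
  have Lw: "w x = L x (i2 - (u2 x \<bullet> e1 x) *\<^sub>R c1 x)" if "x \<in> V" for x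
    by (simp add: w_def u2_def Lc1 that linear_diff[OF linear_L[OF that]] linear_cmul[OF linear_L[OF that]])
  have w: "w x \<noteq> 0" if x: "x \<in> V" for x
  proof
    assume "w x = 0"
    then have "L x (i2 - (u2 x \<bullet> e1 x) *\<^sub>R c1 x) = L x 0"
      using Lw[OF x] linear_0[OF linear_L[OF x]] by simp
    then have "i2 = (u2 x \<bullet> e1 x) *\<^sub>R c1 x" using inj_D[OF x] by (auto dest: injD)
    then have "i2 \<in> span {i1}" by (simp add: c1_def span_base span_scale)
    then show False using i(3) by simp
  qed
  have nw: "norm (w x) \<noteq> 0" if "x \<in> V" for x using w[OF that] by simp
  have sm_w: "smooth_on V w" unfolding w_def
    by (intro smooth_on_scaleR smooth_on_diff smooth_on_inner sm12 sm_e1 V)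
  have sm_c2: "smooth_on V c2" unfolding c2_def
    by (intro smooth_on_scaleR smooth_on_divide smooth_on_const smooth_on_norm smooth_on_diff smooth_on_inner
        sm12 sm_e1 sm_c1 sm_w V w nw)
  have E: "dir_deriv c1 u x = e1 x" "dir_deriv c2 u x = (1 / norm (w x)) *\<^sub>R w x" if "x \<in> V" for x
    using Lc1[OF that] Lw[OF that] by (simp_all add: dir_deriv_def c2_def linear_cmul[OF linear_L[OF that]])
  have "framed_surface M V u V c1 c2"
  proof
    show "open V" "smooth_on V u" "smooth_on V c1" "smooth_on V c2" "V \<subseteq> V"
      using V smooth_on_V sm_c1 sm_c2 by auto
    fix x assume x: "x \<in> V"
    show "inj (frechet_derivative u (at x))" by (rule inj_D[OF x])
    have "norm (u x) = 1" using sph in_topspace[OF x] by auto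
    then show "u x \<bullet> u x = 1" by (simp add: norm_eq_1)
    have e1: "e1 x \<bullet> e1 x = 1"
      using u1[OF x] unfolding norm_eq_1[symmetric] by (simp add: e1_def)
    then show "dir_deriv c1 u x \<bullet> dir_deriv c1 u x = 1" by (simp add: E x)
    show "dir_deriv c1 u x \<bullet> dir_deriv c2 u x = 0"
      using e1 by (simp add: E x w_def inner_diff_right inner_commute)
    show "dir_deriv c2 u x \<bullet> dir_deriv c2 u x = 1"
      using w[OF x] unfolding norm_eq_1[symmetric] by (simp add: E x)
    let ?S = "span {dir_deriv c1 u x, dir_deriv c2 u x}"
    have m1: "L x i1 \<in> ?S"
    proof -
      have "L x i1 = norm (u1 x) *\<^sub>R dir_deriv c1 u x" using u1[OF x] by (simp add: E x e1_def u1_def)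
      then show ?thesis by (simp add: span_base span_scale)
    qed
    have m2: "L x i2 \<in> ?S"
    proof -
      have "L x i2 = norm (w x) *\<^sub>R dir_deriv c2 u x + (u2 x \<bullet> e1 x) *\<^sub>R dir_deriv c1 u x"
        using w[OF x] by (simp add: E x) (simp add: w_def u2_def)
      then show ?thesis by (simp add: span_base span_scale span_add)
    qed
    fix v
    have "v \<in> span {i1, i2}" using i(1) by simp
    then obtain a b where "v = a *\<^sub>R i1 + b *\<^sub>R i2"
      by (auto simp: span_insert span_singleton algebra_simps)
    then show "frechet_derivative u (at x) v \<in> ?S"
      using m1 m2 by (simp add: linear_add[OF linear_L[OF x]] linear_cmul[OF linear_L[OF x]] span_add span_scale)
  qed
  then show ?thesis by (rule that)
qed

context framed_surface
begin

text \<open>The frame is rotated until its first vector points along the gradient of g; the second,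
  a quarter turn further, then annihilates g.\<close>

lemma gradient_frame:
  fixes g :: "'b \<Rightarrow> real"
  assumes g: "smooth_on W g"
  defines "W' \<equiv> {x \<in> W. (D1 g x)\<^sup>2 + (D2 g x)\<^sup>2 \<noteq> 0}"
  obtains d1 d2 where "framed_surface M V u W' d1 d2"
    "\<forall>x\<in>W'. dir_deriv d1 g x \<noteq> 0" "\<forall>x\<in>W'. dir_deriv d2 g x = 0"
proof -
  define s where "s x = sqrt (D1 g x * D1 g x + D2 g x * D2 g x)" for x
  define d1 where "d1 x = (D1 g x / s x) *\<^sub>R c1 x + (D2 g x / s x) *\<^sub>R c2 x" for x
  define d2 where "d2 x = (- D2 g x / s x) *\<^sub>R c1 x + (D1 g x / s x) *\<^sub>R c2 x" for x
  have WW: "W' \<subseteq> W" by (auto simp: W'_def)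
  have "continuous_on W (\<lambda>x. (D1 g x)\<^sup>2 + (D2 g x)\<^sup>2)"
    by (intro continuous_intros smooth_on_continuous_on W smooth_D g)
  from continuous_open_preimage[OF this W open_Compl[OF closed_singleton[of 0]]] have W': "open W'"
    by (simp add: W'_def vimage_def Int_def)
  note sub = smooth_on_subset[OF _ WW]
  have pos: "D1 g x * D1 g x + D2 g x * D2 g x > 0" if "x \<in> W'" for x
    using that by (auto simp: W'_def power2_eq_square sum_squares_gt_zero_iff)
  have s: "s x > 0" "s x \<noteq> 0" if "x \<in> W'" for x
  proof -
    show "s x > 0" unfolding s_def real_sqrt_gt_0_iff by (rule pos[OF that])
    then show "s x \<noteq> 0" by simp
  qed
  have ss: "s x * s x = D1 g x * D1 g x + D2 g x * D2 g x" for x by (simp add: s_def)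
  have sm_s: "smooth_on W' s"
    unfolding s_def by (intro smooth_on_sqrt smooth_on_add smooth_on_mult sub[OF smooth_D(1)[OF g]] sub[OF smooth_D(2)[OF g]] W' pos)
  note sD = sub[OF smooth_D(1)[OF g]] sub[OF smooth_D(2)[OF g]]
  have q: "smooth_on W' (\<lambda>x. D1 g x / s x)" "smooth_on W' (\<lambda>x. D2 g x / s x)" "smooth_on W' (\<lambda>x. - D2 g x / s x)"
    using smooth_on_divide[OF W' sD(1) sm_s s(2)] smooth_on_divide[OF W' sD(2) sm_s s(2)]
      smooth_on_divide[OF W' smooth_on_minus[OF W' sD(2)] sm_s s(2)] by blast+
  note sc = smooth_on_scaleR[OF W' _ sub[OF smooth_c1]] smooth_on_scaleR[OF W' _ sub[OF smooth_c2]]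
  have sm: "smooth_on W' d1" "smooth_on W' d2"
    unfolding d1_def d2_def
    using smooth_on_add[OF W' sc(1)[OF q(1)] sc(2)[OF q(2)]] smooth_on_add[OF W' sc(1)[OF q(3)] sc(2)[OF q(1)]]
    by blast+
  have dd: "dir_deriv d1 X x = (D1 g x / s x) *\<^sub>R D1 X x + (D2 g x / s x) *\<^sub>R D2 X x"
    "dir_deriv d2 X x = (- D2 g x / s x) *\<^sub>R D1 X x + (D1 g x / s x) *\<^sub>R D2 X x"
    if "x \<in> W'" "smooth_on W X" for x and X :: "'b \<Rightarrow> 'c::euclidean_space"
  proof -
    have xW: "x \<in> W" using that(1) WW by auto
    show "dir_deriv d1 X x = (D1 g x / s x) *\<^sub>R D1 X x + (D2 g x / s x) *\<^sub>R D2 X x"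
      unfolding d1_def[abs_def] by (rule dir_deriv_lincomb[OF W xW that(2)])
    show "dir_deriv d2 X x = (- D2 g x / s x) *\<^sub>R D1 X x + (D1 g x / s x) *\<^sub>R D2 X x"
      unfolding d2_def[abs_def] by (rule dir_deriv_lincomb[OF W xW that(2)])
  qed
  have "framed_surface M V u W' d1 d2"
  proof
    show "open W'" "smooth_on W' u" "smooth_on W' d1" "smooth_on W' d2" "W' \<subseteq> V"
      using W' sub[OF smooth_u] sm WW WV by auto
    fix x assume x: "x \<in> W'"
    then have xW: "x \<in> W" using WW by auto
    note f = E11[OF xW] E12[OF xW] E12[OF xW, THEN inner_swap] E22[OF xW] dd[OF x smooth_u]
    show "inj (frechet_derivative u (at x))" "u x \<bullet> u x = 1" using inj unit xW by auto
    define a b where "a = D1 g x / s x" and "b = D2 g x / s x"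
    have "a * a + b * b = (D1 g x * D1 g x + D2 g x * D2 g x) / (s x * s x)"
      by (simp add: a_def b_def add_divide_distrib)
    also have "\<dots> = 1" unfolding ss using pos[OF x] by (intro divide_self less_imp_neq[symmetric])
    finally have ab: "a * a + b * b = 1" .
    have d: "dir_deriv d1 u x = a *\<^sub>R E1 x + b *\<^sub>R E2 x" "dir_deriv d2 u x = - b *\<^sub>R E1 x + a *\<^sub>R E2 x"
      by (simp_all add: f a_def b_def)
    show "dir_deriv d1 u x \<bullet> dir_deriv d1 u x = 1" "dir_deriv d2 u x \<bullet> dir_deriv d2 u x = 1"
      "dir_deriv d1 u x \<bullet> dir_deriv d2 u x = 0"
      unfolding d using ab by (simp_all add: inner_diff_left inner_diff_right inner_left_distrib inner_right_distrib f(1-4) add.commute)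
    have "E1 x = a *\<^sub>R dir_deriv d1 u x + (- b) *\<^sub>R dir_deriv d2 u x"
      "E2 x = b *\<^sub>R dir_deriv d1 u x + a *\<^sub>R dir_deriv d2 u x"
    proof -
      have "a *\<^sub>R dir_deriv d1 u x + (- b) *\<^sub>R dir_deriv d2 u x = (a * a + b * b) *\<^sub>R E1 x"
        "b *\<^sub>R dir_deriv d1 u x + a *\<^sub>R dir_deriv d2 u x = (a * a + b * b) *\<^sub>R E2 x"
        unfolding d by (simp_all add: algebra_simps)
      then show "E1 x = a *\<^sub>R dir_deriv d1 u x + (- b) *\<^sub>R dir_deriv d2 u x"
        "E2 x = b *\<^sub>R dir_deriv d1 u x + a *\<^sub>R dir_deriv d2 u x"
        by (simp_all only: ab scaleR_one)
    qed
    then have "{E1 x, E2 x} \<subseteq> span {dir_deriv d1 u x, dir_deriv d2 u x}"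
      by (metis empty_subsetI insert_subset span_add span_base span_scale insertI1 insertI2)
    then have "span {E1 x, E2 x} \<subseteq> span {dir_deriv d1 u x, dir_deriv d2 u x}"
      by (rule span_minimal) simp
    then show "frechet_derivative u (at x) v \<in> span {dir_deriv d1 u x, dir_deriv d2 u x}" for v
      using tangent[OF xW] by blast
  qed
  moreover have "dir_deriv d1 g x \<noteq> 0" "dir_deriv d2 g x = 0" if x: "x \<in> W'" for x
  proof -
    have "dir_deriv d1 g x = (D1 g x * D1 g x + D2 g x * D2 g x) / s x"
      by (simp add: dd[OF x g] add_divide_distrib)
    then show "dir_deriv d1 g x \<noteq> 0" using pos[OF x] s(1)[OF x] by (metis divide_pos_pos less_irrefl)
    show "dir_deriv d2 g x = 0" by (simp add: dd[OF x g])
  qed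
  ultimately show ?thesis using that by simp
qed

lemma umbilical_frame:
  assumes pnmc: "PNMC_in M S" and bi: "biharmonic_in M S" and x: "x \<in> W"
  shows "fm x = 1" "D1 \<eta>v x = - E1 x" "D2 \<eta>v x = - E2 x"
proof -
  interpret bf: biharmonic_frame W u c1 c2 \<eta>v fm by (rule biharmonic_frame[OF pnmc bi])
  define W' where "W' = {x \<in> W. (D1 fm x)\<^sup>2 + (D2 fm x)\<^sup>2 \<noteq> 0}"
  obtain d1 d2 where d: "framed_surface M V u W' d1 d2"
    "\<forall>x\<in>W'. dir_deriv d1 fm x \<noteq> 0" "\<forall>x\<in>W'. dir_deriv d2 fm x = 0"
    by (rule gradient_frame[OF bf.smooth_f, folded W'_def])
  interpret d: framed_surface M V u W' d1 d2 by fact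
  \<comment> \<open>\<open>\<eta>v\<close> and \<open>fm\<close> are built from the mean curvature
    vector alone, so the rotated frame satisfies the equations with the same functions.\<close>
  interpret df: biharmonic_frame W' u d1 d2 \<eta>v fm by (rule d.biharmonic_frame[OF pnmc bi])
  have "W' = {}" by (rule df.no_adapted_frame[OF d(2,3)[rule_format]])
  then have "(D1 fm y)\<^sup>2 + (D2 fm y)\<^sup>2 = 0" if "y \<in> W" for y using that by (auto simp: W'_def)
  then have D: "D1 fm y = 0" "D2 fm y = 0" if "y \<in> W" for y
    using that unfolding sum_power2_eq_zero_iff by auto
  show "fm x = 1" "D1 \<eta>v x = - E1 x" "D2 \<eta>v x = - E2 x"
    using bf.umbilical[OF D x] by auto
qed

text \<open>As fm = 1, H coincides with \<open>\<eta>v\<close>, whose derivatives along the frame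
  are -E1 and -E2; they cancel those of the position vector.\<close>

lemma center_derivative:
  assumes pnmc: "PNMC_in M S" and bi: "biharmonic_in M S" and x: "x \<in> W"
  shows "((\<lambda>x. u x + Hv x) has_derivative (\<lambda>v. 0)) (at x)"
proof -
  have H: "Hv y = \<eta>v y" if "y \<in> W" for y using umbilical_frame(1)[OF pnmc bi that] by (simp add: \<eta>v_def)
  have sm: "smooth_on W (\<lambda>x. u x + Hv x)" by (intro smooth_rules smooth_Hv)
  have D: "dir_deriv c Hv x = dir_deriv c \<eta>v x" for c
    by (rule dir_deriv_cong_open[OF W smooth_Hv x, symmetric]) (rule H)
  have "frechet_derivative (\<lambda>x. u x + Hv x) (at x) v = 0" for v
  proof -
    have xV: "x \<in> V" using x WV by auto
    define c where "c = (L x v \<bullet> E1 x) *\<^sub>R c1 x + (L x v \<bullet> E2 x) *\<^sub>R c2 x"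
    have "L x c = (L x v \<bullet> E1 x) *\<^sub>R E1 x + (L x v \<bullet> E2 x) *\<^sub>R E2 x"
      by (simp add: c_def linear_add[OF linear_L[OF xV]] linear_cmul[OF linear_L[OF xV]] dir_deriv_def)
    then have "L x c = L x v" using tangent_expand[OF x tangent[OF x], of v] by (rule trans[OF _ sym])
    then have vc: "v = c" by (rule injD[OF inj_D[OF xV], symmetric])
    have z: "dir_deriv c1 (\<lambda>x. u x + Hv x) x = 0" "dir_deriv c2 (\<lambda>x. u x + Hv x) x = 0"
      using umbilical_frame(2,3)[OF pnmc bi x] by (simp_all add: dir_deriv_add[OF W x smooth_u smooth_Hv] D)
    have lin: "linear (frechet_derivative (\<lambda>x. u x + Hv x) (at x))" by (rule frechet_derivative_linear[OF W x sm])
    have "frechet_derivative (\<lambda>x. u x + Hv x) (at x) c = 0"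
      unfolding c_def using z by (simp add: linear_add[OF lin] linear_cmul[OF lin] dir_deriv_def)
    then show ?thesis by (simp only: vc[symmetric])
  qed
  then have "frechet_derivative (\<lambda>x. u x + Hv x) (at x) = (\<lambda>v. 0)" by auto
  then show ?thesis using smooth_on_has_derivative[OF W sm x] by simp
qed

end

section \<open>From the local result to the hypersphere\<close>

lemma connected_space_locally_constant:
  assumes "connected_space X"
    and "\<And>p. p \<in> topspace X \<Longrightarrow> \<exists>U. openin X U \<and> p \<in> U \<and> (\<forall>q\<in>U. c q = c p)"
    and "p \<in> topspace X" "q \<in> topspace X"
  shows "c q = c p"
proof -
  have op: "openin X {q \<in> topspace X. P (c q)}" for P
  proof -
    have "\<exists>T. openin X T \<and> q \<in> T \<and> T \<subseteq> {q \<in> topspace X. P (c q)}"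
      if q: "q \<in> topspace X" "P (c q)" for q
    proof -
      obtain U where U: "openin X U" "q \<in> U" "\<forall>r\<in>U. c r = c q" using assms(2)[OF q(1)] by blast
      have "U \<subseteq> {q \<in> topspace X. P (c q)}"
      proof
        fix r assume r: "r \<in> U"
        then have "c r = c q" using U(3) by simp
        then show "r \<in> {q \<in> topspace X. P (c q)}" using r q(2) openin_subset[OF U(1)] by auto
      qed
      then show ?thesis using U(1,2) by blast
    qed
    then show ?thesis using openin_subopen[of X "{q \<in> topspace X. P (c q)}"] by simp
  qed
  have "topspace X - {q \<in> topspace X. c q = c p} = {q \<in> topspace X. c q \<noteq> c p}" by auto
  then have "closedin X {q \<in> topspace X. c q = c p}"
    unfolding closedin_def using op[of "\<lambda>z. z \<noteq> c p"] by (simp only: Collect_restrict simp_thms)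
  then have "{q \<in> topspace X. c q = c p} = {} \<or> {q \<in> topspace X. c q = c p} = topspace X"
    using assms(1)[unfolded connected_space_clopen_in, rule_format, OF conjI[OF op[of "\<lambda>z. z = c p"]]] by simp
  then show ?thesis using assms(3,4) by auto
qed

text \<open>The Householder reflection in the hyperplane orthogonal to a - e exchanges the two unit
  vectors.\<close>

lemma orthogonal_transformation_exists_unit:
  fixes a e :: "'a::euclidean_space"
  assumes "norm a = 1" "norm e = 1"
  obtains T where "orthogonal_transformation T" "T a = e"
proof -
  define w where "w = a - e"
  \<comment> \<open>For a = e, w is 0 and the division by zero yields k = 0; T is then the identity,
    as required.\<close>
  define k where "k v = 2 * (v \<bullet> w) / (w \<bullet> w)" for v
  define T where "T v = v - k v *\<^sub>R w" for v
  have kw: "k v * (w \<bullet> w) = 2 * (v \<bullet> w)" for v by (simp add: k_def)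
  have k: "k (v + v') = k v + k v'" "k (r *\<^sub>R v) = r * k v" for v v' r
    by (simp_all add: k_def inner_left_distrib distrib_left add_divide_distrib)
  have "T v \<bullet> T v' = v \<bullet> v'" for v v'
  proof -
    have "T v \<bullet> T v' = v \<bullet> v' - k v' * (v \<bullet> w) - (k v * (v' \<bullet> w) - k v * (k v' * (w \<bullet> w)))"
      by (simp add: T_def inner_diff_left inner_diff_right inner_commute[of w v'] right_diff_distrib)
    also have "\<dots> = v \<bullet> v'" using kw[of v] kw[of v'] by algebra
    finally show ?thesis .
  qed
  moreover have "linear T"
    by (rule linearI) (simp_all add: T_def k scaleR_left_distrib scaleR_right_diff_distrib)
  ultimately have "orthogonal_transformation T"
    unfolding orthogonal_transformation_def by simp
  moreover have "T a = e"
  proof -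
    have "w \<bullet> w = 2 * (a \<bullet> w)"
      using assms by (simp add: w_def norm_eq_1 inner_diff_left inner_diff_right inner_commute[of e a])
    then have "k a = 1" if "w \<noteq> 0" using that by (simp add: k_def flip: \<open>w \<bullet> w = 2 * (a \<bullet> w)\<close>)
    then show ?thesis by (cases "w = 0") (simp_all add: T_def w_def)
  qed
  ultimately show ?thesis by (rule that)
qed

text \<open>Described by a norm and one inner product, the hypersphere can be transported by
  orthogonal maps.\<close>

lemma small_hypersphere_eq: "small_hypersphere = {z. norm z = 1 \<and> z \<bullet> (0, 1) = 1 / sqrt 2}"
proof -
  have "norm (x, 1 / sqrt 2) = 1 \<longleftrightarrow> (norm x)\<^sup>2 = 1 / 2" for x :: "real^'n"
    by (simp add: norm_Pair power_divide real_sqrt_eq_1_iff) arith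
  then show ?thesis by (auto simp: small_hypersphere_def)
qed

theorem corollary4p5:
  fixes M :: "((real^'n) \<times> real) topology"
  assumes "immersed_surface M"
    and "topspace M \<subseteq> unit_sphere"
    and "PNMC_in M (top_of_set unit_sphere)"
    and "biharmonic_in M (top_of_set unit_sphere)"
  shows "\<exists>T :: (real^'n) \<times> real \<Rightarrow> (real^'n) \<times> real.
           orthogonal_transformation T \<and> minimal_in M (top_of_set (T ` small_hypersphere))"
proof (cases "topspace M = {}")
  case True
  \<comment> \<open>All conditions are vacuous for the empty surface, so the identity serves as
    T.\<close>
  then show ?thesis
    by (intro exI[of _ "\<lambda>x. x"]) (simp add: minimal_in_def orthogonal_transformation_def linear_ident)
next
  case False
  let ?S = "top_of_set (unit_sphere :: ((real^'n) \<times> real) set)"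
  let ?H = "mean_curvature_vector M ?S"
  define c where "c p = p + ?H p" for p
  have frame: "\<exists>(V::(real^2) set) u c1 c2 a. framed_surface M V u V c1 c2 \<and> a \<in> V \<and> u a = p"
    if p: "p \<in> topspace M" for p
  proof -
    obtain V :: "(real^2) set" and u where Vu: "local_parametrization M V u" "p \<in> u ` V"
      using assms(1) p by (auto simp: immersed_surface_def)
    interpret surface_patch M V u by unfold_locales (rule Vu)
    let ?i1 = "axis 1 1 :: real^2" and ?i2 = "axis 2 1 :: real^2"
    have "x = (x $ 1) *\<^sub>R ?i1 + (x $ 2) *\<^sub>R ?i2" for x :: "real^2"
      by (simp add: vec_eq_iff forall_2 axis_def)
    moreover have "r *\<^sub>R ?i1 + s *\<^sub>R ?i2 \<in> span {?i1, ?i2}" for r s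
      by (intro span_add span_scale span_base) auto
    ultimately have 1: "span {?i1, ?i2} = UNIV" by (metis UNIV_eq_I)
    have 2: "?i1 \<noteq> 0" by (simp add: axis_eq_0_iff)
    have 3: "?i2 \<notin> span {?i1}"
      by (auto simp: span_singleton vec_eq_iff axis_def forall_2)
    obtain c1 c2 where "framed_surface M V u V c1 c2"
      by (rule orthonormal_frame[OF 1 2 3 assms(2)])
    then show ?thesis using Vu(2) by blast
  qed
  have loc: "\<exists>U. openin M U \<and> p \<in> U \<and> (\<forall>q\<in>U. c q = c p)" if p: "p \<in> topspace M" for p
  proof -
    obtain V :: "(real^2) set" and u c1 c2 a where fr: "framed_surface M V u V c1 c2" and a: "a \<in> V" "u a = p"
      using frame[OF p] by blast
    interpret framed_surface M V u V c1 c2 by fact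
    obtain r where r: "r > 0" "ball a r \<subseteq> V" using W a(1) openE by blast
    have d: "((\<lambda>x. u x + Hv x) has_derivative (\<lambda>v. 0)) (at x within ball a r)" if "x \<in> ball a r" for x
      using center_derivative[OF assms(3,4)] that r(2) by (blast intro: has_derivative_at_withinI)
    obtain k where "\<And>x. x \<in> ball a r \<Longrightarrow> u x + Hv x = k"
      using has_derivative_zero_constant[OF convex_ball d] by blast
    moreover have "a \<in> ball a r" using r by simp
    ultimately have "c (u x) = c p" if "x \<in> ball a r" for x
      using that a(2) by (metis Hv_def c_def)
    then show ?thesis
      using openin_image_open[OF open_ball r(2)] a(2) \<open>a \<in> ball a r\<close> by (intro exI[of _ "u ` ball a r"]) auto
  qed
  obtain p0 where p0: "p0 \<in> topspace M" using False by blast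
  define k where "k = c p0"
  have "connected_space M" using assms(1) by (simp add: immersed_surface_def)
  then have ck: "c q = k" if "q \<in> topspace M" for q
    unfolding k_def by (rule connected_space_locally_constant[OF _ loc p0 that])
  have H: "?H q = k - q" "norm q = 1" "norm (?H q) = 1" "?H q \<bullet> q = 0" if q: "q \<in> topspace M" for q
  proof -
    show Hq: "?H q = k - q" using ck[OF q] by (simp add: c_def algebra_simps)
    show "norm q = 1" using q assms(2) by auto
    obtain V :: "(real^2) set" and u c1 c2 a where fr: "framed_surface M V u V c1 c2" and a: "a \<in> V" "u a = q"
      using frame[OF q] by blast
    interpret framed_surface M V u V c1 c2 by fact
    show "norm (?H q) = 1" "?H q \<bullet> q = 0"
      using umbilical_frame(1)[OF assms(3,4) a(1)] Hv_orth(1)[OF a(1)] a(2) by (simp_all add: fm_def Hv_def)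
  qed
  have qk: "q \<bullet> k = 1" if "q \<in> topspace M" for q
  proof -
    have "(k - q) \<bullet> q = 0" using H(1,4)[OF that] by simp
    then show ?thesis using H(2)[OF that] by (simp add: inner_diff_left norm_eq_1 inner_commute[of q k])
  qed
  have kk: "k \<bullet> k = 2"
  proof -
    have "norm (k - p0) = 1" using H(1,3)[OF p0] by simp
    then show ?thesis using H(2)[OF p0] qk[OF p0]
      by (simp add: norm_eq_1 inner_diff_left inner_diff_right inner_commute[of k p0])
  qed
  \<comment> \<open>k is the sum of the orthonormal vectors q and H(q), so its length is sqrt 2;
    after normalization the plane q . k = 1 has height 1 / sqrt 2 in direction e.\<close>
  define e where "e = k /\<^sub>R sqrt 2"
  have ee: "e \<bullet> e = 1" using kk by (simp add: e_def field_simps)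
  then obtain T :: "(real^'n) \<times> real \<Rightarrow> (real^'n) \<times> real" where T: "orthogonal_transformation T" "T (0, 1) = e"
    using orthogonal_transformation_exists_unit[of "(0, 1)" e] by (auto simp: norm_eq_1)
  define N where "N = {y. norm y = 1 \<and> y \<bullet> e = 1 / sqrt 2}"
  have TN: "T ` small_hypersphere = N"
  proof -
    have iso: "T v \<bullet> T w = v \<bullet> w" for v w using T(1) unfolding orthogonal_transformation_def by blast
    have TN': "norm (T z) = norm z" "T z \<bullet> e = z \<bullet> (0, 1)" for z
      using iso[of z "(0, 1)"] by (simp_all only: norm_eq_sqrt_inner iso T(2))
    show ?thesis
    proof (intro equalityI subsetI)
      fix y assume "y \<in> T ` small_hypersphere"
      then obtain z where "y = T z" "z \<in> small_hypersphere" by blast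
      then show "y \<in> N"
        using TN'[of z] by (simp only: small_hypersphere_eq N_def mem_Collect_eq)
    next
      fix y assume y: "y \<in> N"
      obtain z where z: "y = T z" using orthogonal_transformation_surj[OF T(1)] by (rule surjE)
      then have "z \<in> small_hypersphere"
        using y TN'[of z] by (simp only: small_hypersphere_eq N_def mem_Collect_eq)
      then show "y \<in> T ` small_hypersphere" using z by blast
    qed
  qed
  have MN: "topspace M \<subseteq> N"
    using H(2) qk by (auto simp: N_def e_def divide_inverse)
  \<comment> \<open>The section is a round sphere with centre e / sqrt 2 and radius 1 / sqrt 2 in an
    affine hyperplane, the form covered by \<open>tangent_space_subspace_sphere\<close>.\<close>
  have Neq: "N = {y. y - e /\<^sub>R sqrt 2 \<in> {v. v \<bullet> e = 0} \<and> norm (y - e /\<^sub>R sqrt 2) = 1 / sqrt 2}"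
  proof (intro set_eqI)
    fix y :: "(real^'n) \<times> real"
    have 1: "(y - e /\<^sub>R sqrt 2) \<bullet> e = y \<bullet> e - 1 / sqrt 2"
      by (simp add: inner_diff_left ee divide_inverse)
    have 2: "(norm (y - e /\<^sub>R sqrt 2))\<^sup>2 = (norm y)\<^sup>2 - 1 / 2" if "y \<bullet> e = 1 / sqrt 2"
    proof -
      define t where "t = inverse (sqrt 2)"
      have t: "y \<bullet> e = t" "t * t = 1 / 2" using that by (simp_all add: t_def field_simps)
      have "(norm (y - t *\<^sub>R e))\<^sup>2 = (norm y)\<^sup>2 - 2 * (t * (y \<bullet> e)) + t * t * (e \<bullet> e)"
        unfolding power2_norm_eq_inner
        by (simp add: inner_diff_left inner_diff_right inner_commute[of e y] right_diff_distrib)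
      then show ?thesis by (simp add: t ee flip: t_def)
    qed
    have "norm (y - e /\<^sub>R sqrt 2) = 1 / sqrt 2 \<longleftrightarrow> (norm (y - e /\<^sub>R sqrt 2))\<^sup>2 = (1 / sqrt 2)\<^sup>2"
      by (intro power2_eq_iff_nonneg[symmetric]) auto
    moreover have "norm y = 1 \<longleftrightarrow> (norm y)\<^sup>2 = 1\<^sup>2"
      by (intro power2_eq_iff_nonneg[symmetric]) auto
    ultimately show "y \<in> N \<longleftrightarrow> y \<in> {y. y - e /\<^sub>R sqrt 2 \<in> {v. v \<bullet> e = 0} \<and> norm (y - e /\<^sub>R sqrt 2) = 1 / sqrt 2}"
      using 1 2 by (cases "y \<bullet> e = 1 / sqrt 2") (simp_all add: N_def power_divide)
  qed
  have TN_eq: "tangent_space (top_of_set N) q = {v. v \<bullet> e = 0 \<and> v \<bullet> q = 0}" if q: "q \<in> topspace M" for q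
  proof -
    have "q \<in> N" using MN q by blast
    then have qN: "q - e /\<^sub>R sqrt 2 \<in> {v. v \<bullet> e = 0}" "norm (q - e /\<^sub>R sqrt 2) = 1 / sqrt 2"
      unfolding Neq by blast+
    have "1 / sqrt 2 > (0 :: real)" by simp
    from tangent_space_subspace_sphere[OF subspace_orth this qN]
    have "tangent_space (top_of_set N) q = {v \<in> {v. v \<bullet> e = 0}. v \<bullet> (q - e /\<^sub>R sqrt 2) = 0}"
      by (simp only: flip: Neq)
    also have "\<dots> = {v. v \<bullet> e = 0 \<and> v \<bullet> q = 0}"
      by (rule set_eqI) (simp add: inner_diff_right cong: conj_cong)
    finally show ?thesis .
  qed
  have "mean_curvature_vector M (top_of_set N) q = 0" if q: "q \<in> topspace M" for q
  proof -
    obtain V :: "(real^2) set" and u c1 c2 a where fr: "framed_surface M V u V c1 c2" and a: "a \<in> V" "u a = q"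
      using frame[OF q] by blast
    interpret framed_surface M V u V c1 c2 by fact
    interpret bf: biharmonic_frame V u c1 c2 \<eta>v fm by (rule biharmonic_frame[OF assms(3,4)])
    have sub: "subspace (tangent_space (top_of_set N) (u a))"
      unfolding a(2) TN_eq[OF q] by (auto simp: subspace_def inner_left_distrib)
    have subn: "subspace (normal_space M (top_of_set N) (u a))"
      unfolding normal_space_def by (rule subspace_orth_within[OF sub])
    \<comment> \<open>A vector normal to M within N is orthogonal to k and to the position, hence to
      H = k - q. By \<open>bf.mean\<close> it is then orthogonal to the trace whose projection gives
      the mean curvature in N.\<close>
    have "(D1 E1 a + D2 E2 a) \<bullet> s = 0" if s: "s \<in> normal_space M (top_of_set N) (u a)" for s
    proof -
      have s': "s \<bullet> e = 0" "s \<bullet> u a = 0" "s \<bullet> E1 a = 0" "s \<bullet> E2 a = 0"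
        using s orth_tangent_iff[OF a(1), of s] TN_eq[OF q] a(2) by (auto simp: normal_space_def)
      have "s \<bullet> k = 0" using s'(1) by (simp add: e_def)
      then have "s \<bullet> Hv a = 0" using H(1)[OF q] s'(2) a(2) by (simp add: Hv_def inner_diff_right)
      then show ?thesis using bf.mean[OF a(1) s'(2-4)]
        by (simp add: \<eta>v_def inner_left_distrib inner_commute[of s])
    qed
    then have "orth_proj (normal_space M (top_of_set N) (u a)) (D1 E1 a + D2 E2 a) = 0"
      by (simp add: orth_proj_eq_0_iff[OF subn])
    then show ?thesis using mean_curvature_frame[OF a(1) sub] a(2) by simp
  qed
  then have "minimal_in M (top_of_set N)" using MN unfolding minimal_in_def by simp
  then have "minimal_in M (top_of_set (T ` small_hypersphere))" by (simp only: TN)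
  with T(1) show ?thesis by (intro exI conjI)
qed

end
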